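(* Let $G$ be a compact, connected, simply-connected, simple Lie group of dimension $n$, and let $\mathcal{C}\subseteq G$ be a regular conjugacy class. Then the universal centralizer $$\Lambda_{\mathcal{C}}:=\{(g,h)\in G\times G: h\in\mathcal{C}\text{ and }ghg^{-1}=h\}$$ is a Lagrangian submanifold of the internally fused double $D(G)=G\times G$, i.e. $\Lambda_{\mathcal{C}}\subseteq D(G)^{\circ}$, $\dim(\Lambda_{\mathcal{C}})=n$, and $\Lambda_{\mathcal{C}}$ is isotropic with respect to the quasi-Hamiltonian $2$-form $\omega_{D(G)}$ on $D(G)$ (the pullback of $\omega_{D(G)}$ to $\Lambda_{\mathcal{C}}$ is zero).
   Context: Let $\mathfrak{g}$ be the Lie algebra of $G$ and $r$ the rank of $G$. Let $G_g$ be the centralizer of $g\in G$ and $G_{\mathrm{reg}}=\{g\in G:\dim G_g=r\}$; a conjugacy class $\mathcal{C}$ is regular if $\mathcal{C}\subseteq G_{\mathrm{reg}}$. Let $\langle\cdot,\cdot\rangle$ be the unique $G$-invariant inner product on $\mathfrak{g}$ for which (in the induced inner product on $\mathfrak{t}^*$, with $\mathfrak{t}$ the Lie algebra of a maximal torus $T$, roots being viewed in $\mathfrak{t}^*$ via $\alpha\mapsto\frac{1}{2\pi i}(d\alpha)_e$ for characters $\alpha:T\to S^1$) long roots have length $\sqrt{2}$. For $\mathfrak{g}$-valued $1$-forms $\alpha,\beta$ on a manifold, $(\alpha,\beta)$ is the $2$-form $(\alpha,\beta)_m(v_1,v_2)=\langle\alpha_m(v_1),\beta_m(v_2)\rangle-\langle\alpha_m(v_2),\beta_m(v_1)\rangle$.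 Let $\theta^L,\theta^R\in\Omega^1(G;\mathfrak{g})$ be the left- and right-invariant Maurer--Cartan forms. The internally fused double is $D(G)=G\times G$ with the simultaneous conjugation action of $G$ and the $2$-form $$\omega_{D(G)}=\tfrac12(\pi_1^*\theta^L,\pi_2^*\theta^R)+\tfrac12(\pi_1^*\theta^R,\pi_2^*\theta^L)+\tfrac12((\pi_1\pi_2)^*\theta^L,(\pi_1^{-1}\pi_2^{-1})^*\theta^R),$$ where $\pi_1,\pi_2$ are the two projections, $(\pi_1\pi_2)(g,h)=gh$ and $(\pi_1^{-1}\pi_2^{-1})(g,h)=g^{-1}h^{-1}$. Its moment map is $\mu_{D(G)}(g,h)=ghg^{-1}h^{-1}$. $D(G)^{\circ}$ denotes the open set of points at which $\omega_{D(G)}$ is non-degenerate. *)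

theory Defs
  imports "HOL-Analysis.Analysis" "HOL-Algebra.Group"
begin

section \<open>Smooth functions between Euclidean spaces\<close>

text \<open>These notions are only applied to open sets \<open>S\<close>, where they are the usual \<open>C\<^sup>k\<close> and
  \<open>C\<^sup>\<infinity>\<close>: all iterated directional derivatives up to the given order exist and are
  continuous.\<close>

primrec times_differentiable_on ::
    "nat \<Rightarrow> 'a::real_normed_vector set \<Rightarrow> ('a \<Rightarrow> 'b::real_normed_vector) \<Rightarrow> bool" where
  "times_differentiable_on 0 S f \<longleftrightarrow> continuous_on S f"
| "times_differentiable_on (Suc k) S f \<longleftrightarrow>
     (\<forall>x\<in>S. f differentiable (at x)) \<and>
     (\<forall>v. times_differentiable_on k S (\<lambda>x. frechet_derivative f (at x) v))"

definition smooth_on :: "'a::real_normed_vector set \<Rightarrow> ('a \<Rightarrow> 'b::real_normed_vector) \<Rightarrow> bool" where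
  "smooth_on S f \<longleftrightarrow> (\<forall>k. times_differentiable_on k S f)"


section \<open>Smooth manifolds\<close>

text \<open>A manifold is a second countable Hausdorff type with an atlas of charts \<open>(U, \<phi>)\<close>, where
  \<open>\<phi>\<close> is a homeomorphism from the open set \<open>U\<close> onto an open subset of the Euclidean model
  space; the dimension is that of the model space. The values of \<open>\<phi>\<close> outside \<open>U\<close> are
  irrelevant.\<close>

type_synonym ('m, 'e) chart = "'m set \<times> ('m \<Rightarrow> 'e)"

definition is_chart :: "('m::topological_space, 'e::euclidean_space) chart \<Rightarrow> bool" where
  "is_chart c \<longleftrightarrow> (case c of (U, \<phi>) \<Rightarrow>
     open U \<and> open (\<phi> ` U) \<and> homeomorphism U (\<phi> ` U) \<phi> (inv_into U \<phi>))"

definition transition_smooth ::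
    "('m, 'e::euclidean_space) chart \<Rightarrow> ('m, 'e) chart \<Rightarrow> bool" where
  "transition_smooth c d \<longleftrightarrow> (case (c, d) of ((U, \<phi>), (V, \<psi>)) \<Rightarrow>
     smooth_on (\<phi> ` (U \<inter> V)) (\<lambda>x. \<psi> (inv_into U \<phi> x)))"

definition smooth_atlas ::
    "('m::{second_countable_topology, t2_space}, 'e::euclidean_space) chart set \<Rightarrow> bool" where
  "smooth_atlas A \<longleftrightarrow>
     (\<forall>c\<in>A. is_chart c) \<and> (\<Union>c\<in>A. fst c) = UNIV \<and>
     (\<forall>c\<in>A. \<forall>d\<in>A. transition_smooth c d)"

definition maximal_atlas ::
    "('m::topological_space, 'e::euclidean_space) chart set \<Rightarrow> ('m, 'e) chart set" where
  "maximal_atlas A =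
     {c. is_chart c \<and> (\<forall>d\<in>A. transition_smooth c d \<and> transition_smooth d c)}"

definition product_atlas ::
    "('m, 'e) chart set \<Rightarrow> ('n, 'f) chart set \<Rightarrow> ('m \<times> 'n, 'e \<times> 'f) chart set" where
  "product_atlas A B = {(U \<times> V, map_prod \<phi> \<psi>) | U \<phi> V \<psi>. (U, \<phi>) \<in> A \<and> (V, \<psi>) \<in> B}"

definition smooth_map ::
    "('m::topological_space, 'e::euclidean_space) chart set \<Rightarrow>
     ('n::topological_space, 'f::euclidean_space) chart set \<Rightarrow> ('m \<Rightarrow> 'n) \<Rightarrow> bool" where
  "smooth_map A B f \<longleftrightarrow> continuous_on UNIV f \<and>
     (\<forall>(U, \<phi>)\<in>A. \<forall>(V, \<psi>)\<in>B.
        smooth_on (\<phi> ` (U \<inter> f -` V)) (\<lambda>x. \<psi> (f (inv_into U \<phi> x))))"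

text \<open>The tangent space at \<open>p\<close> is the model space, read in one chart around \<open>p\<close> that is
  chosen once and for all; \<open>tangent_map\<close> is the differential of a map with respect to these
  identifications.\<close>

definition chart_at :: "('m, 'e) chart set \<Rightarrow> 'm \<Rightarrow> ('m, 'e) chart" where
  "chart_at A p = (SOME c. c \<in> A \<and> p \<in> fst c)"

definition coord :: "('m, 'e) chart set \<Rightarrow> 'm \<Rightarrow> 'm \<Rightarrow> 'e" where
  "coord A p = snd (chart_at A p)"

definition inv_coord :: "('m, 'e) chart set \<Rightarrow> 'm \<Rightarrow> 'e \<Rightarrow> 'm" where
  "inv_coord A p = inv_into (fst (chart_at A p)) (coord A p)"

definition tangent_map ::
    "('m, 'e::euclidean_space) chart set \<Rightarrow> ('n, 'f::euclidean_space) chart set \<Rightarrow>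
     ('m \<Rightarrow> 'n) \<Rightarrow> 'm \<Rightarrow> 'e \<Rightarrow> 'f" where
  "tangent_map A B f p =
     frechet_derivative (\<lambda>x. coord B (f p) (f (inv_coord A p x))) (at (coord A p p))"

definition embedded_submanifold ::
    "('m::topological_space, 'e::euclidean_space) chart set \<Rightarrow> nat \<Rightarrow> 'm set \<Rightarrow> bool" where
  "embedded_submanifold A k S \<longleftrightarrow>
     (\<forall>p\<in>S. \<exists>(U, \<phi>)\<in>maximal_atlas A. p \<in> U \<and>
        (\<exists>L. subspace L \<and> dim L = k \<and> \<phi> ` (U \<inter> S) = \<phi> ` U \<inter> L))"

text \<open>Smooth curves in \<open>S\<close> through \<open>p\<close> (at time 0) with velocity \<open>v\<close>, and the tangent
  space of an embedded submanifold \<open>S\<close> as a subspace of the tangent space of the ambient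
  manifold.\<close>

definition tangent_curve ::
    "('m, 'e::euclidean_space) chart set \<Rightarrow> 'm set \<Rightarrow> 'm \<Rightarrow> (real \<Rightarrow> 'm) \<Rightarrow> 'e \<Rightarrow> bool" where
  "tangent_curve A S p \<gamma> v \<longleftrightarrow> \<gamma> 0 = p \<and>
     (\<exists>\<epsilon>>0. \<gamma> ` {-\<epsilon><..<\<epsilon>} \<subseteq> S \<inter> fst (chart_at A p) \<and>
        smooth_on {-\<epsilon><..<\<epsilon>} (\<lambda>t. coord A p (\<gamma> t))) \<and>
     ((\<lambda>t. coord A p (\<gamma> t)) has_vector_derivative v) (at 0)"

definition tangent_space ::
    "('m, 'e::euclidean_space) chart set \<Rightarrow> 'm set \<Rightarrow> 'm \<Rightarrow> 'e set" where
  "tangent_space A S p = {v. \<exists>\<gamma>. tangent_curve A S p \<gamma> v}"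


section \<open>Lie groups and their Lie algebras\<close>

locale lie_group = group G
  for G :: "'g::{second_countable_topology, t2_space} monoid" (structure) +
  fixes A :: "('g, 'e::euclidean_space) chart set"
  assumes carrier_eq_UNIV: "carrier G = UNIV"
    and atlas: "smooth_atlas A"
    and smooth_mult: "smooth_map (product_atlas A A) A (\<lambda>(x, y). x \<otimes> y)"
    and smooth_inv: "smooth_map A A (\<lambda>x. inv x)"

text \<open>The Lie algebra is the tangent space at the identity, with bracket
  \<open>[X, Y] = (d Ad)\<^sub>e(X) Y\<close>.\<close>

definition Ad :: "'g monoid \<Rightarrow> ('g, 'e::euclidean_space) chart set \<Rightarrow> 'g \<Rightarrow> 'e \<Rightarrow> 'e" where
  "Ad G A x = tangent_map A A (\<lambda>y. x \<otimes>\<^bsub>G\<^esub> y \<otimes>\<^bsub>G\<^esub> inv\<^bsub>G\<^esub> x) \<one>\<^bsub>G\<^esub>"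

definition lie_bracket :: "'g monoid \<Rightarrow> ('g, 'e::euclidean_space) chart set \<Rightarrow> 'e \<Rightarrow> 'e \<Rightarrow> 'e" where
  "lie_bracket G A X Y =
     frechet_derivative (\<lambda>x. Ad G A (inv_coord A \<one>\<^bsub>G\<^esub> x) Y) (at (coord A \<one>\<^bsub>G\<^esub> \<one>\<^bsub>G\<^esub>)) X"

definition simple_lie_algebra :: "('e::real_vector \<Rightarrow> 'e \<Rightarrow> 'e) \<Rightarrow> bool" where
  "simple_lie_algebra br \<longleftrightarrow> (\<exists>X Y. br X Y \<noteq> 0) \<and>
     (\<forall>I. subspace I \<and> (\<forall>X. \<forall>Y\<in>I. br X Y \<in> I) \<longrightarrow> I = {0} \<or> I = UNIV)"


section \<open>Maximal tori, rank, regular conjugacy classes\<close>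

definition is_torus ::
    "'g::topological_space monoid \<Rightarrow> ('g, 'e::euclidean_space) chart set \<Rightarrow> 'g set \<Rightarrow> bool" where
  "is_torus G A T \<longleftrightarrow> subgroup T G \<and> (\<exists>k. embedded_submanifold A k T) \<and>
     compact T \<and> connected T \<and> (\<forall>s\<in>T. \<forall>t\<in>T. s \<otimes>\<^bsub>G\<^esub> t = t \<otimes>\<^bsub>G\<^esub> s)"

definition maximal_torus ::
    "'g::topological_space monoid \<Rightarrow> ('g, 'e::euclidean_space) chart set \<Rightarrow> 'g set \<Rightarrow> bool" where
  "maximal_torus G A T \<longleftrightarrow> is_torus G A T \<and> (\<forall>T'. is_torus G A T' \<and> T \<subseteq> T' \<longrightarrow> T' = T)"

definition lie_rank ::
    "'g::topological_space monoid \<Rightarrow> ('g, 'e::euclidean_space) chart set \<Rightarrow> nat" where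
  "lie_rank G A = (THE r. \<exists>T. maximal_torus G A T \<and> embedded_submanifold A r T)"

definition centralizer :: "'g monoid \<Rightarrow> 'g \<Rightarrow> 'g set" where
  "centralizer G g = {x \<in> carrier G. x \<otimes>\<^bsub>G\<^esub> g = g \<otimes>\<^bsub>G\<^esub> x}"

definition regular_elements ::
    "'g::topological_space monoid \<Rightarrow> ('g, 'e::euclidean_space) chart set \<Rightarrow> 'g set" where
  "regular_elements G A =
     {g \<in> carrier G. embedded_submanifold A (lie_rank G A) (centralizer G g)}"

definition conjugacy_class :: "'g monoid \<Rightarrow> 'g \<Rightarrow> 'g set" where
  "conjugacy_class G h = {x \<otimes>\<^bsub>G\<^esub> h \<otimes>\<^bsub>G\<^esub> inv\<^bsub>G\<^esub> x | x. x \<in> carrier G}"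

definition regular_conjugacy_class ::
    "'g::topological_space monoid \<Rightarrow> ('g, 'e::euclidean_space) chart set \<Rightarrow> 'g set \<Rightarrow> bool" where
  "regular_conjugacy_class G A C \<longleftrightarrow>
     (\<exists>h\<in>carrier G. C = conjugacy_class G h) \<and> C \<subseteq> regular_elements G A"


section \<open>Roots and the basic inner product\<close>

definition torus_character :: "'g::topological_space monoid \<Rightarrow> 'g set \<Rightarrow> ('g \<Rightarrow> complex) \<Rightarrow> bool" where
  "torus_character G T \<alpha> \<longleftrightarrow> continuous_on T \<alpha> \<and> (\<forall>t\<in>T. norm (\<alpha> t) = 1) \<and>
     (\<forall>s\<in>T. \<forall>t\<in>T. \<alpha> (s \<otimes>\<^bsub>G\<^esub> t) = \<alpha> s * \<alpha> t)"

text \<open>A root is a nontrivial character with a nonzero weight vector \<open>X + i Y\<close> in the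
  complexified Lie algebra: \<open>Ad\<^sub>t (X + i Y) = \<alpha>(t) (X + i Y)\<close>, written out in real and imaginary
  parts.\<close>

definition root_character ::
    "'g::topological_space monoid \<Rightarrow> ('g, 'e::euclidean_space) chart set \<Rightarrow> 'g set \<Rightarrow>
     ('g \<Rightarrow> complex) \<Rightarrow> bool" where
  "root_character G A T \<alpha> \<longleftrightarrow> torus_character G T \<alpha> \<and> (\<exists>t\<in>T. \<alpha> t \<noteq> 1) \<and>
     (\<exists>X Y. (X, Y) \<noteq> (0, 0) \<and>
        (\<forall>t\<in>T. Ad G A t X = Re (\<alpha> t) *\<^sub>R X - Im (\<alpha> t) *\<^sub>R Y \<and>
               Ad G A t Y = Im (\<alpha> t) *\<^sub>R X + Re (\<alpha> t) *\<^sub>R Y))"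

text \<open>Functionals on the Lie algebra of \<open>T\<close> are represented by functions on the ambient
  Lie algebra of which only the restriction matters. The condition says that the functional is
  \<open>(d\<alpha>)\<^sub>e / (2 \<pi> i)\<close>.\<close>

definition roots ::
    "'g::topological_space monoid \<Rightarrow> ('g, 'e::euclidean_space) chart set \<Rightarrow> 'g set \<Rightarrow>
     ('e \<Rightarrow> real) set" where
  "roots G A T = {l. \<exists>\<alpha>. root_character G A T \<alpha> \<and>
     (\<forall>\<gamma> v. tangent_curve A T \<one>\<^bsub>G\<^esub> \<gamma> v \<longrightarrow>
        ((\<lambda>t. \<alpha> (\<gamma> t)) has_vector_derivative 2 * of_real pi * \<i> * of_real (l v)) (at 0))}"

definition is_inner_product :: "('e::real_vector \<Rightarrow> 'e \<Rightarrow> real) \<Rightarrow> bool" where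
  "is_inner_product ip \<longleftrightarrow> (\<forall>X. linear (ip X)) \<and> (\<forall>X Y. ip X Y = ip Y X) \<and>
     (\<forall>X. X \<noteq> 0 \<longrightarrow> ip X X > 0)"

text \<open>The length of a functional on \<open>V\<close> in the inner product on the dual of \<open>V\<close> induced
  by \<open>ip\<close>, that is, the length of its Riesz representative in \<open>V\<close>.\<close>

definition dual_length ::
    "('e::real_vector \<Rightarrow> 'e \<Rightarrow> real) \<Rightarrow> 'e set \<Rightarrow> ('e \<Rightarrow> real) \<Rightarrow> real" where
  "dual_length ip V l =
     (let H = (THE H. H \<in> V \<and> (\<forall>v\<in>V. l v = ip H v)) in sqrt (ip H H))"

text \<open>Long roots are the roots of maximal length.\<close>

definition basic_inner_product ::
    "'g::topological_space monoid \<Rightarrow> ('g, 'e::euclidean_space) chart set \<Rightarrow>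
     ('e \<Rightarrow> 'e \<Rightarrow> real) \<Rightarrow> bool" where
  "basic_inner_product G A ip \<longleftrightarrow> is_inner_product ip \<and>
     (\<forall>g\<in>carrier G. \<forall>X Y. ip (Ad G A g X) (Ad G A g Y) = ip X Y) \<and>
     (\<forall>T. maximal_torus G A T \<longrightarrow>
        (let len = dual_length ip (tangent_space A T \<one>\<^bsub>G\<^esub>) in
           \<forall>l\<in>roots G A T. (\<forall>m\<in>roots G A T. len m \<le> len l) \<longrightarrow> len l = sqrt 2))"


section \<open>The internally fused double\<close>

text \<open>Vector-valued 1-forms and real 2-forms on a manifold modelled on \<open>'e\<close>, as functions of
  a point and one or two tangent vectors.\<close>

type_synonym ('m, 'e, 'v) one_form = "'m \<Rightarrow> 'e \<Rightarrow> 'v"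
type_synonym ('m, 'e) two_form = "'m \<Rightarrow> 'e \<Rightarrow> 'e \<Rightarrow> real"

definition pullback ::
    "('m, 'e::euclidean_space) chart set \<Rightarrow> ('n, 'f::euclidean_space) chart set \<Rightarrow>
     ('m \<Rightarrow> 'n) \<Rightarrow> ('n, 'f, 'v) one_form \<Rightarrow> ('m, 'e, 'v) one_form" where
  "pullback A B f \<alpha> m v = \<alpha> (f m) (tangent_map A B f m v)"

definition form_pairing ::
    "('v \<Rightarrow> 'v \<Rightarrow> real) \<Rightarrow> ('m, 'e, 'v) one_form \<Rightarrow> ('m, 'e, 'v) one_form \<Rightarrow> ('m, 'e) two_form" where
  "form_pairing ip \<alpha> \<beta> m v1 v2 = ip (\<alpha> m v1) (\<beta> m v2) - ip (\<alpha> m v2) (\<beta> m v1)"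

definition theta_L ::
    "'g monoid \<Rightarrow> ('g, 'e::euclidean_space) chart set \<Rightarrow> ('g, 'e, 'e) one_form" where
  "theta_L G A g = tangent_map A A (\<lambda>x. inv\<^bsub>G\<^esub> g \<otimes>\<^bsub>G\<^esub> x) g"

definition theta_R ::
    "'g monoid \<Rightarrow> ('g, 'e::euclidean_space) chart set \<Rightarrow> ('g, 'e, 'e) one_form" where
  "theta_R G A g = tangent_map A A (\<lambda>x. x \<otimes>\<^bsub>G\<^esub> inv\<^bsub>G\<^esub> g) g"

definition omega_double ::
    "'g monoid \<Rightarrow> ('g, 'e::euclidean_space) chart set \<Rightarrow> ('e \<Rightarrow> 'e \<Rightarrow> real) \<Rightarrow>
     ('g \<times> 'g, 'e \<times> 'e) two_form" where
  "omega_double G A ip p v w =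
     (let pb = pullback (product_atlas A A) A;
          \<theta>L = theta_L G A;
          \<theta>R = theta_R G A;
          prd = (\<lambda>(g, h). g \<otimes>\<^bsub>G\<^esub> h);
          prd_inv = (\<lambda>(g, h). inv\<^bsub>G\<^esub> g \<otimes>\<^bsub>G\<^esub> inv\<^bsub>G\<^esub> h)
      in 1/2 * form_pairing ip (pb fst \<theta>L) (pb snd \<theta>R) p v w
       + 1/2 * form_pairing ip (pb fst \<theta>R) (pb snd \<theta>L) p v w
       + 1/2 * form_pairing ip (pb prd \<theta>L) (pb prd_inv \<theta>R) p v w)"

definition nondegenerate_locus :: "('m, 'e::zero) two_form \<Rightarrow> 'm set" where
  "nondegenerate_locus \<omega> = {p. \<forall>v. v \<noteq> 0 \<longrightarrow> (\<exists>w. \<omega> p v w \<noteq> 0)}"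

definition isotropic ::
    "('m, 'e::euclidean_space) chart set \<Rightarrow> ('m, 'e) two_form \<Rightarrow> 'm set \<Rightarrow> bool" where
  "isotropic A \<omega> S \<longleftrightarrow>
     (\<forall>p\<in>S. \<forall>v\<in>tangent_space A S p. \<forall>w\<in>tangent_space A S p. \<omega> p v w = 0)"

definition universal_centralizer :: "'g monoid \<Rightarrow> 'g set \<Rightarrow> ('g \<times> 'g) set" where
  "universal_centralizer G C =
     {(g, h). g \<in> carrier G \<and> h \<in> C \<and> g \<otimes>\<^bsub>G\<^esub> h \<otimes>\<^bsub>G\<^esub> inv\<^bsub>G\<^esub> g = h}"

end

theory Submission
  imports Defs
begin

text \<open>
  Trivialize \<open>T(G \<times> G)\<close> by left translations and put \<open>S = Ad\<^bsub>g\<^sup>-\<^sup>1\<^esub>\<close>, \<open>T = Ad\<^bsub>h\<^sup>-\<^sup>1\<^esub>\<close>; at a point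
  with \<open>g h = h g\<close> these are commuting isometries and the two-form is an explicit expression in
  \<open>S\<close> and \<open>T\<close>. As a two-by-two block matrix of commuting operators it has determinant \<open>4\<close>, which
  gives non-degeneracy. The vectors tangent to the universal centralizer have the form
  \<open>((S - 1) \<xi> + \<kappa>, (T - 1) \<xi>)\<close> with \<open>T \<kappa> = \<kappa>\<close>, and on these the form vanishes.

  The orbit map \<open>x \<mapsto> x h x\<^sup>-\<^sup>1\<close> has constant rank by equivariance, and by compactness it is open onto
  the conjugacy class. So the class is locally a graph over the range of the differential of the orbit
  map, and the universal centralizer is locally the zero set of a submersion
  \<open>G \<times> G \<rightarrow> \<gg>\<close>.
\<close>

section \<open>Calculus of smooth functions\<close>

text \<open>Why a single \<open>\<gg>\<close>-valued equation suffices: membership of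
  \<open>h\<close> in \<open>C\<close> costs n - dim \<open>C\<close> equations; once it holds, the
  conjugate of \<open>h\<close> by \<open>g\<close> lies in \<open>C\<close> too, so their equality
  is tested by dim \<open>C\<close> coordinates only. Together these are n equations, whereas
  imposing all n coordinates of g h g^-1 = h besides would in general be overdetermined. The graph
  description of \<open>C\<close> makes both groups explicit, and a projection lets them be added
  into one function without losing either. The formal argument is shaped by the fact that tangent
  spaces are read in charts picked by choice: the chart picked on a product need not be the product
  of the charts picked on its factors. Differentials are therefore mostly handled through the
  relation \<open>has_tangent\<close>, and identities between them come from differentiating one map
  in two ways and invoking uniqueness.\<close>

lemma times_differentiable_on_cong:
  assumes "open S" "\<And>x. x \<in> S \<Longrightarrow> f x = g x" "times_differentiable_on k S f"
  shows "times_differentiable_on k S g"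
  using assms
proof (induction k arbitrary: f g)
  case 0
  then show ?case by (auto simp: continuous_on_cong[of S S f g])
next
  case (Suc k)
  have d: "(g has_derivative frechet_derivative f (at x)) (at x)" if "x \<in> S" for x
  proof (rule has_derivative_transform_within_open[OF _ Suc.prems(1) that])
    show "(f has_derivative frechet_derivative f (at x)) (at x)"
      using Suc.prems(3) that by (intro frechet_derivative_works[THEN iffD1]) simp
  qed (rule Suc.prems(2))
  have "times_differentiable_on k S (\<lambda>x. frechet_derivative g (at x) v)" for v
  proof (rule Suc.IH[OF Suc.prems(1)])
    show "frechet_derivative f (at x) v = frechet_derivative g (at x) v" if "x \<in> S" for x
      using frechet_derivative_at[OF d[OF that]] by simp
    show "times_differentiable_on k S (\<lambda>x. frechet_derivative f (at x) v)"
      using Suc.prems(3) by simp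
  qed
  moreover have "\<forall>x\<in>S. g differentiable (at x)"
    using d differentiableI by blast
  ultimately show ?case
    by simp
qed

lemma times_differentiable_on_subset:
  "times_differentiable_on k S f \<Longrightarrow> T \<subseteq> S \<Longrightarrow> times_differentiable_on k T f"
  by (induction k arbitrary: f) (auto intro: continuous_on_subset)

lemma times_differentiable_on_SucI:
  assumes "open S" "\<And>x. x \<in> S \<Longrightarrow> (f has_derivative f' x) (at x)"
    "\<And>v. times_differentiable_on k S (\<lambda>x. f' x v)"
  shows "times_differentiable_on (Suc k) S f"
proof -
  have "times_differentiable_on k S (\<lambda>x. frechet_derivative f (at x) v)" for v
  proof (rule times_differentiable_on_cong[OF assms(1) _ assms(3)])
    show "f' x v = frechet_derivative f (at x) v" if "x \<in> S" for x
      using frechet_derivative_at[OF assms(2)[OF that]] by simp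
  qed
  moreover have "\<forall>x\<in>S. f differentiable (at x)"
    using assms(2) differentiableI by blast
  ultimately show ?thesis
    by simp
qed

lemma times_differentiable_on_SucD:
  assumes "times_differentiable_on (Suc k) S f"
  shows "x \<in> S \<Longrightarrow> (f has_derivative frechet_derivative f (at x)) (at x)"
    "times_differentiable_on k S (\<lambda>x. frechet_derivative f (at x) v)"
  using assms frechet_derivative_works by auto

lemma times_differentiable_on_Suc_imp:
  assumes "times_differentiable_on (Suc k) S f"
  shows "times_differentiable_on k S f"
  using assms
proof (induction k arbitrary: f)
  case 0
  then show ?case
    by (auto intro!: continuous_at_imp_continuous_on differentiable_imp_continuous_within)
next
  case (Suc k)
  then show ?case by simp
qed

lemma times_differentiable_on_const: "open S \<Longrightarrow> times_differentiable_on k S (\<lambda>x. c)"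
proof (induction k arbitrary: c)
  case (Suc k)
  then show ?case
    by (intro times_differentiable_on_SucI[where f' = "\<lambda>x v. 0"]) auto
qed simp

lemma times_differentiable_on_bounded_linear:
  assumes "open S" "bounded_linear L" "times_differentiable_on k S f"
  shows "times_differentiable_on k S (\<lambda>x. L (f x))"
  using assms(3)
proof (induction k arbitrary: f)
  case 0
  then show ?case by (auto intro: bounded_linear.continuous_on[OF assms(2)])
next
  case (Suc k)
  note D = times_differentiable_on_SucD[OF Suc.prems]
  show ?case
    using D by (intro times_differentiable_on_SucI[where f' = "\<lambda>x v. L (frechet_derivative f (at x) v)"]
        assms Suc.IH bounded_linear.has_derivative[OF assms(2)]) auto
qed

lemma times_differentiable_on_id: "open S \<Longrightarrow> times_differentiable_on k S (\<lambda>x. x)"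
  by (cases k)
    (auto intro!: times_differentiable_on_SucI[where f' = "\<lambda>x v. v"] times_differentiable_on_const
      simp del: times_differentiable_on.simps(2))

lemma times_differentiable_on_add:
  assumes "open S" "times_differentiable_on k S f" "times_differentiable_on k S g"
  shows "times_differentiable_on k S (\<lambda>x. f x + g x)"
  using assms(2,3)
proof (induction k arbitrary: f g)
  case 0
  then show ?case by (auto intro: continuous_intros)
next
  case (Suc k)
  note D = times_differentiable_on_SucD[OF Suc.prems(1)] times_differentiable_on_SucD[OF Suc.prems(2)]
  show ?case
    using D by (intro times_differentiable_on_SucI[where f' = "\<lambda>x v. frechet_derivative f (at x) v
        + frechet_derivative g (at x) v"] assms Suc.IH has_derivative_add) auto
qed

lemma times_differentiable_on_sum:
  assumes "open S" "finite I" "\<And>i. i \<in> I \<Longrightarrow> times_differentiable_on k S (f i)"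
  shows "times_differentiable_on k S (\<lambda>x. \<Sum>i\<in>I. f i x)"
  using assms(2,3)
  by (induction I) (auto intro!: times_differentiable_on_const times_differentiable_on_add assms(1))

lemma times_differentiable_on_scaleR:
  assumes "open S" "times_differentiable_on k S f" "times_differentiable_on k S g"
  shows "times_differentiable_on k S (\<lambda>x. f x *\<^sub>R g x)"
  using assms(2,3)
proof (induction k arbitrary: f g)
  case 0
  then show ?case by (auto intro: continuous_intros)
next
  case (Suc k)
  note D = times_differentiable_on_SucD[OF Suc.prems(1)] times_differentiable_on_SucD[OF Suc.prems(2)]
  show ?case
    using D Suc.prems[THEN times_differentiable_on_Suc_imp]
    by (intro times_differentiable_on_SucI[where f' = "\<lambda>x v. f x *\<^sub>R frechet_derivative g (at x) v
        + frechet_derivative f (at x) v *\<^sub>R g x"] assms times_differentiable_on_add Suc.IH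
        has_derivative_scaleR) auto
qed

lemma linear_expand:
  fixes L :: "'a::euclidean_space \<Rightarrow> 'b::real_vector"
  assumes "linear L"
  shows "L v = (\<Sum>b\<in>Basis. (v \<bullet> b) *\<^sub>R L b)"
proof -
  have "L v = L (\<Sum>b\<in>Basis. (v \<bullet> b) *\<^sub>R b)"
    by (simp add: euclidean_representation)
  then show ?thesis
    using assms by (simp add: linear_sum linear_scale)
qed

text \<open>Expanding \<open>u x\<close> in the basis turns operator application into a finite sum
  of scalars times vectors, so a family of operators need only be controlled on each fixed
  vector.\<close>

lemma times_differentiable_on_apply:
  fixes L :: "'x::real_normed_vector \<Rightarrow> 'a::euclidean_space \<Rightarrow> 'b::real_normed_vector"
  assumes "open S" "\<And>x. x \<in> S \<Longrightarrow> linear (L x)" "\<And>v. times_differentiable_on k S (\<lambda>x. L x v)"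
    "times_differentiable_on k S u"
  shows "times_differentiable_on k S (\<lambda>x. L x (u x))"
proof (rule times_differentiable_on_cong[OF assms(1)])
  show "(\<Sum>b\<in>Basis. (u x \<bullet> b) *\<^sub>R L x b) = L x (u x)" if "x \<in> S" for x
    using linear_expand assms(2) that by metis
  show "times_differentiable_on k S (\<lambda>x. \<Sum>b\<in>Basis. (u x \<bullet> b) *\<^sub>R L x b)"
    using assms by (intro times_differentiable_on_sum times_differentiable_on_scaleR
        times_differentiable_on_bounded_linear[OF _ bounded_linear_inner_left]) auto
qed

lemma times_differentiable_on_compose:
  fixes f :: "'b::euclidean_space \<Rightarrow> 'c::real_normed_vector"
  assumes "open S" "open T" "times_differentiable_on k T f" "times_differentiable_on k S g"
    "g ` S \<subseteq> T"
  shows "times_differentiable_on k S (\<lambda>x. f (g x))"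
  using assms(3,4)
proof (induction k arbitrary: f)
  case 0
  then show ?case using assms(5) by (auto intro: continuous_on_compose2)
next
  case (Suc k)
  note D = times_differentiable_on_SucD[OF Suc.prems(1)]
  note E = times_differentiable_on_SucD[OF Suc.prems(2)]
  show ?case
  proof (rule times_differentiable_on_SucI[where f' = "\<lambda>x v. frechet_derivative f (at (g x))
        (frechet_derivative g (at x) v)", OF assms(1)])
    show "((\<lambda>x. f (g x)) has_derivative (\<lambda>v. frechet_derivative f (at (g x))
        (frechet_derivative g (at x) v))) (at x)" if "x \<in> S" for x
      using E(1)[OF that] D(1)[of "g x"] assms(5) that
      by (auto intro: has_derivative_compose)
    show "times_differentiable_on k S (\<lambda>x. frechet_derivative f (at (g x))
        (frechet_derivative g (at x) v))" for v
    proof (rule times_differentiable_on_apply[OF assms(1) _ _ E(2)])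
      show "linear (frechet_derivative f (at (g x)))" if "x \<in> S" for x
        using D(1)[of "g x"] assms(5) that by (auto intro: has_derivative_linear)
      show "times_differentiable_on k S (\<lambda>x. frechet_derivative f (at (g x)) w)" for w
        using Suc.IH[OF D(2)] Suc.prems(2)[THEN times_differentiable_on_Suc_imp] by blast
    qed
  qed
qed

lemma smooth_onD:
  assumes "smooth_on S f" "x \<in> S"
  shows "(f has_derivative frechet_derivative f (at x)) (at x)"
  using assms times_differentiable_on_SucD(1) unfolding smooth_on_def by blast

lemma smooth_on_deriv: "smooth_on S f \<Longrightarrow> smooth_on S (\<lambda>x. frechet_derivative f (at x) v)"
  using times_differentiable_on_SucD(2) unfolding smooth_on_def by blast

lemma smooth_on_imp_continuous_on: "smooth_on S f \<Longrightarrow> continuous_on S f"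
  unfolding smooth_on_def using times_differentiable_on.simps(1) by blast

lemma smooth_on_cong:
  "smooth_on S f \<Longrightarrow> open S \<Longrightarrow> (\<And>x. x \<in> S \<Longrightarrow> f x = g x) \<Longrightarrow> smooth_on S g"
  unfolding smooth_on_def using times_differentiable_on_cong by blast

lemma smooth_on_subset: "smooth_on S f \<Longrightarrow> T \<subseteq> S \<Longrightarrow> smooth_on T f"
  unfolding smooth_on_def using times_differentiable_on_subset by blast

lemma smooth_on_const: "open S \<Longrightarrow> smooth_on S (\<lambda>x. c)"
  by (simp add: smooth_on_def times_differentiable_on_const)

lemma smooth_on_id: "open S \<Longrightarrow> smooth_on S (\<lambda>x. x)"
  by (simp add: smooth_on_def times_differentiable_on_id)

lemma smooth_on_add:
  "open S \<Longrightarrow> smooth_on S f \<Longrightarrow> smooth_on S g \<Longrightarrow> smooth_on S (\<lambda>x. f x + g x)"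
  by (simp add: smooth_on_def times_differentiable_on_add)

lemma smooth_on_bounded_linear:
  "open S \<Longrightarrow> bounded_linear L \<Longrightarrow> smooth_on S f \<Longrightarrow> smooth_on S (\<lambda>x. L (f x))"
  by (simp add: smooth_on_def times_differentiable_on_bounded_linear)

lemma smooth_on_diff:
  "open S \<Longrightarrow> smooth_on S f \<Longrightarrow> smooth_on S g \<Longrightarrow> smooth_on S (\<lambda>x. f x - g x)"
  using smooth_on_add[of S f "\<lambda>x. - g x"]
    smooth_on_bounded_linear[OF _ bounded_linear_minus[OF bounded_linear_ident], of S g]
  by simp

lemma smooth_on_Pair:
  assumes "open S" "smooth_on S f" "smooth_on S g"
  shows "smooth_on S (\<lambda>x. (f x, g x))"
proof -
  have "smooth_on S (\<lambda>x. (f x, 0) + (0, g x))"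
    using assms by (intro smooth_on_add smooth_on_bounded_linear[of S "\<lambda>y. (y, 0)"]
        smooth_on_bounded_linear[of S "\<lambda>y. (0, y)"] bounded_linear_Pair bounded_linear_ident
        bounded_linear_zero) auto
  then show ?thesis by simp
qed

lemma smooth_on_compose:
  fixes f :: "'b::euclidean_space \<Rightarrow> 'c::real_normed_vector"
  assumes "smooth_on T f" "smooth_on S g" "open S" "open T" "g ` S \<subseteq> T"
  shows "smooth_on S (\<lambda>x. f (g x))"
  using assms times_differentiable_on_compose unfolding smooth_on_def by blast

text \<open>A product rule with one factor merely continuous: since \<open>e\<close> vanishes at
  \<open>x\<close>, the error \<open>e y *\<^sub>R (q y - q x)\<close> is of smaller order than the
  distance from \<open>y\<close> to \<open>x\<close>. It serves to differentiate an inverse matrix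
  at a stage where only continuity of the inverse is known.\<close>

lemma has_derivative_vanishing_scaleR:
  fixes e :: "'a::real_normed_vector \<Rightarrow> real" and q :: "'a \<Rightarrow> 'b::real_normed_vector"
  assumes e: "(e has_derivative d) (at x)" "e x = 0" and q: "isCont q x"
  shows "((\<lambda>y. e y *\<^sub>R q y) has_derivative (\<lambda>h. d h *\<^sub>R q x)) (at x)"
proof -
  have d: "bounded_linear d"
    using e(1) by (rule has_derivative_bounded_linear)
  then obtain K where K: "\<And>h. norm (d h) \<le> norm h * K" "K > 0"
    using bounded_linear.pos_bounded by blast
  let ?r = "\<lambda>y. (e y - e x - d (y - x)) /\<^sub>R norm (y - x)"
  have r: "(?r \<longlongrightarrow> 0) (at x)"
    using e(1) by (auto simp: has_derivative_at_within)
  have 1: "((\<lambda>y. ?r y *\<^sub>R q y) \<longlongrightarrow> 0 *\<^sub>R q x) (at x)"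
    using q by (intro tendsto_scaleR r) (simp add: isCont_def)
  have qd: "((\<lambda>y. q y - q x) \<longlongrightarrow> 0) (at x)"
    using q by (simp add: isCont_def LIM_zero)
  have 2: "((\<lambda>y. (d (y - x) / norm (y - x)) *\<^sub>R (q y - q x)) \<longlongrightarrow> 0) (at x)"
  proof (rule Lim_null_comparison)
    have "norm ((d (y - x) / norm (y - x)) *\<^sub>R (q y - q x)) \<le> K * norm (q y - q x)" for y
    proof -
      have *: "norm (d (y - x) / norm (y - x)) \<le> K"
        using K(1)[of "y - x"] K(2) by (cases "y = x") (auto simp: field_simps)
      then show ?thesis
        using mult_right_mono[OF * norm_ge_zero[of "q y - q x"]] by (simp only: norm_scaleR real_norm_def)
    qed
    then show "\<forall>\<^sub>F y in at x. norm ((d (y - x) / norm (y - x)) *\<^sub>R (q y - q x)) \<le> K * norm (q y - q x)"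
      by simp
    show "((\<lambda>y. K * norm (q y - q x)) \<longlongrightarrow> 0) (at x)"
      using tendsto_mult_right_zero[OF tendsto_norm_zero[OF qd]] by auto
  qed
  have "((\<lambda>y. (e y *\<^sub>R q y - e x *\<^sub>R q x - d (y - x) *\<^sub>R q x) /\<^sub>R norm (y - x)) \<longlongrightarrow> 0) (at x)"
  proof (rule Lim_transform_eventually)
    show "((\<lambda>y. ?r y *\<^sub>R q y + (d (y - x) / norm (y - x)) *\<^sub>R (q y - q x)) \<longlongrightarrow> 0) (at x)"
      using tendsto_add[OF 1 2] by simp
    show "\<forall>\<^sub>F y in at x. ?r y *\<^sub>R q y + (d (y - x) / norm (y - x)) *\<^sub>R (q y - q x) =
        (e y *\<^sub>R q y - e x *\<^sub>R q x - d (y - x) *\<^sub>R q x) /\<^sub>R norm (y - x)"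
      using e(2) by (auto simp: algebra_simps divide_inverse)
  qed
  moreover have "bounded_linear (\<lambda>h. d h *\<^sub>R q x)"
    using d by (rule bounded_linear_scaleR_const)
  ultimately show ?thesis
    by (simp add: has_derivative_at_within)
qed

text \<open>The inverse of a matrix of \<open>C\<^sup>k\<close> functions is \<open>C\<^sup>k\<close>, because
  \<open>B x v - B y v = - B x ((A x - A y) (B y v))\<close>.\<close>

lemma times_differentiable_on_inverse_matrix:
  fixes A B :: "'x::real_normed_vector \<Rightarrow> 'a::euclidean_space \<Rightarrow> 'a"
  assumes S: "open S" and A: "\<And>x. x \<in> S \<Longrightarrow> linear (A x)" and B: "\<And>x. x \<in> S \<Longrightarrow> linear (B x)"
    and AB: "\<And>x v. x \<in> S \<Longrightarrow> A x (B x v) = v" and BA: "\<And>x v. x \<in> S \<Longrightarrow> B x (A x v) = v"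
    and "\<And>v. times_differentiable_on k S (\<lambda>x. A x v)"
  shows "times_differentiable_on k S (\<lambda>x. B x v)"
proof -
  have diff: "B y v - B x v = - B y (A y (B x v) - A x (B x v))" if "x \<in> S" "y \<in> S" for x y v
    using that AB BA B by (simp add: linear_diff)
  have cont: "isCont (\<lambda>x. B x v) x"
    if x: "x \<in> S" and c: "\<And>v. continuous_on S (\<lambda>x. A x v)" for x v
  proof -
    \<comment> \<open>\<open>A x\<close> is bounded below by some \<open>m\<close>; once
      \<open>A y\<close> is within \<open>m / 2\<close> of it, \<open>A y\<close> is bounded below
      by \<open>m / 2\<close>, so the inverses \<open>B y\<close> are uniformly bounded near
      \<open>x\<close>.\<close>
    have "inj (A x)"
      using BA[OF x] by (metis injI)
    then obtain m where m: "m > 0" "\<And>u. m * norm u \<le> norm (A x u)"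
      using linear_inj_bounded_below_pos[OF A[OF x]] by auto
    have lim: "((\<lambda>y. A y u) \<longlongrightarrow> A x u) (at x)" for u
      using c[of u] S x by (simp add: continuous_on_eq_continuous_at isCont_def)
    have "((\<lambda>y. \<Sum>b\<in>Basis. norm (A y b - A x b)) \<longlongrightarrow> (\<Sum>b\<in>(Basis::'a set). 0)) (at x)"
      using lim by (intro tendsto_sum tendsto_norm_zero LIM_zero) auto
    then have "\<forall>\<^sub>F y in at x. (\<Sum>b\<in>(Basis::'a set). norm (A y b - A x b)) < m / 2"
      using m(1) by (intro order_tendstoD(2)) auto
    then have bd: "\<forall>\<^sub>F y in at x. \<forall>w. norm (B y w) \<le> (2 / m) * norm w"
      using eventually_at_in_open'[OF S x]
    proof eventually_elim
      case (elim y)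
      show ?case
      proof
        fix w
        let ?u = "B y w"
        have lin: "linear (\<lambda>u. A y u - A x u)"
          using A elim x by (intro linear_compose_sub) auto
        have "norm (A y ?u - A x ?u) \<le> (\<Sum>b\<in>Basis. norm ((?u \<bullet> b) *\<^sub>R (A y b - A x b)))"
          by (subst linear_expand[OF lin]) (rule norm_sum)
        also have "\<dots> \<le> (\<Sum>b\<in>Basis. norm ?u * norm (A y b - A x b))"
          by (intro sum_mono) (auto intro!: mult_right_mono Basis_le_norm)
        also have "\<dots> = norm ?u * (\<Sum>b\<in>Basis. norm (A y b - A x b))"
          by (simp add: sum_distrib_left)
        also have "\<dots> \<le> norm ?u * (m / 2)"
          using elim by (intro mult_left_mono) auto
        finally have "norm (A x ?u) \<le> norm (A y ?u) + norm ?u * (m / 2)"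
          using norm_triangle_ineq3[of "A y ?u" "A x ?u"] by linarith
        then have "m * norm ?u \<le> norm w + norm ?u * (m / 2)"
          using m(2)[of ?u] AB elim by simp
        then show "norm ?u \<le> (2 / m) * norm w"
          using m(1) by (simp add: field_simps)
      qed
    qed
    have "((\<lambda>y. B y v - B x v) \<longlongrightarrow> 0) (at x)"
    proof (rule Lim_null_comparison)
      show "\<forall>\<^sub>F y in at x. norm (B y v - B x v) \<le> (2 / m) * norm (A y (B x v) - A x (B x v))"
        using bd eventually_at_in_open'[OF S x]
        by eventually_elim (simp add: diff x)
      show "((\<lambda>y. (2 / m) * norm (A y (B x v) - A x (B x v))) \<longlongrightarrow> 0) (at x)"
        using lim[of "B x v"] by (intro tendsto_mult_right_zero tendsto_norm_zero LIM_zero)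
    qed
    then show ?thesis
      by (simp add: isCont_def LIM_zero_iff)
  qed
  show ?thesis
    using assms(6)
  proof (induction k arbitrary: v)
    case 0
    then show ?case
      using cont by (simp add: continuous_at_imp_continuous_on)
  next
    case (Suc k)
    note D = times_differentiable_on_SucD[OF Suc.prems]
    have Ac: "continuous_on S (\<lambda>x. A x v)" for v
      using Suc.prems[of v] D(1)[of _ v] has_derivative_continuous
      by (blast intro: continuous_at_imp_continuous_on)
    have IH: "times_differentiable_on k S (\<lambda>x. B x v)" for v
      using Suc.IH Suc.prems[THEN times_differentiable_on_Suc_imp] by blast
    define A' where "A' x w = (\<lambda>u. frechet_derivative (\<lambda>x. A x u) (at x) w)" for x w
    have A': "((\<lambda>x. A x u) has_derivative (\<lambda>w. A' x w u)) (at x)" if "x \<in> S" for x u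
      using D(1)[of x u] that by (simp add: A'_def)
    have linA': "linear (A' x w)" if x: "x \<in> S" for x w
    proof (rule linearI)
      fix u1 u2 :: 'a and r :: real
      have "((\<lambda>x. A x u1 + A x u2) has_derivative (\<lambda>w. A' x w (u1 + u2))) (at x)"
        using A'[OF x, of "u1 + u2"]
        by (rule has_derivative_transform_within_open[OF _ S x]) (simp add: A linear_add)
      moreover have "((\<lambda>x. A x u1 + A x u2) has_derivative (\<lambda>w. A' x w u1 + A' x w u2)) (at x)"
        using A'[OF x] by (intro has_derivative_add)
      ultimately show "A' x w (u1 + u2) = A' x w u1 + A' x w u2"
        using has_derivative_unique by metis
      have "((\<lambda>x. r *\<^sub>R A x u1) has_derivative (\<lambda>w. A' x w (r *\<^sub>R u1))) (at x)"
        using A'[OF x, of "r *\<^sub>R u1"]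
        by (rule has_derivative_transform_within_open[OF _ S x]) (simp add: A linear_scale)
      moreover have "((\<lambda>x. r *\<^sub>R A x u1) has_derivative (\<lambda>w. r *\<^sub>R A' x w u1)) (at x)"
        using A'[OF x] by (intro has_derivative_scaleR_right)
      ultimately show "A' x w (r *\<^sub>R u1) = r *\<^sub>R A' x w u1"
        using has_derivative_unique by metis
    qed
    show ?case
    proof (rule times_differentiable_on_SucI[where f' = "\<lambda>x w. - B x (A' x w (B x v))", OF S])
      fix x assume x: "x \<in> S"
      \<comment> \<open>The argument of \<open>B y\<close> in the difference formula vanishes at
        \<open>y = x\<close>; expanded in the basis, each term is a scalar vanishing at
        \<open>x\<close> times the continuous factor \<open>B y b\<close>.\<close>
      have "((\<lambda>y. (A y (B x v) - A x (B x v)) \<bullet> b) has_derivative (\<lambda>w. A' x w (B x v) \<bullet> b)) (at x)" for b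
        using A'[OF x] by (auto intro!: derivative_eq_intros)
      then have "((\<lambda>y. ((A y (B x v) - A x (B x v)) \<bullet> b) *\<^sub>R B y b) has_derivative
          (\<lambda>w. (A' x w (B x v) \<bullet> b) *\<^sub>R B x b)) (at x)" for b
        using cont[OF x Ac] by (intro has_derivative_vanishing_scaleR) auto
      then have "((\<lambda>y. B x v - (\<Sum>b\<in>Basis. ((A y (B x v) - A x (B x v)) \<bullet> b) *\<^sub>R B y b)) has_derivative
          (\<lambda>w. 0 - (\<Sum>b\<in>Basis. (A' x w (B x v) \<bullet> b) *\<^sub>R B x b))) (at x)"
        by (intro has_derivative_diff has_derivative_const has_derivative_sum)
      moreover have "(\<Sum>b\<in>Basis. (A' x w (B x v) \<bullet> b) *\<^sub>R B x b) = B x (A' x w (B x v))" for w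
        using linear_expand[OF B[OF x], symmetric] .
      ultimately have "((\<lambda>y. B x v - (\<Sum>b\<in>Basis. ((A y (B x v) - A x (B x v)) \<bullet> b) *\<^sub>R B y b)) has_derivative
          (\<lambda>w. - B x (A' x w (B x v)))) (at x)"
        by simp
      then show "((\<lambda>x. B x v) has_derivative (\<lambda>w. - B x (A' x w (B x v)))) (at x)"
      proof (rule has_derivative_transform_within_open[OF _ S x])
        fix y assume y: "y \<in> S"
        show "B x v - (\<Sum>b\<in>Basis. ((A y (B x v) - A x (B x v)) \<bullet> b) *\<^sub>R B y b) = B y v"
          unfolding linear_expand[OF B[OF y], symmetric]
          using diff[OF x y, of v] by (simp add: algebra_simps)
      qed
    next
      fix w
      have "times_differentiable_on k S (\<lambda>x. A' x w u)" for u
        unfolding A'_def by (rule D(2))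
      from times_differentiable_on_apply[OF S B IH times_differentiable_on_apply[OF S linA' this IH]]
      have "times_differentiable_on k S (\<lambda>x. B x (A' x w (B x v)))" .
      then show "times_differentiable_on k S (\<lambda>x. - B x (A' x w (B x v)))"
        by (rule times_differentiable_on_bounded_linear[OF S bounded_linear_minus[OF bounded_linear_ident]])
    qed
  qed
qed

text \<open>Bootstrapping: \<open>g' y\<close> is the inverse matrix of the derivative of
  \<open>f\<close> at \<open>g y\<close>. If \<open>g\<close> has k continuous derivatives, so has
  that matrix and hence its inverse, which gives \<open>g\<close> one derivative more.\<close>

lemma smooth_on_local_inverse:
  fixes f g :: "'a::euclidean_space \<Rightarrow> 'a"
  assumes "open T" "open S" "smooth_on S f" "g ` T \<subseteq> S"
    and g: "\<And>y. y \<in> T \<Longrightarrow> (g has_derivative g' y) (at y)"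
    and inv: "\<And>y v. y \<in> T \<Longrightarrow> frechet_derivative f (at (g y)) (g' y v) = v"
      "\<And>y v. y \<in> T \<Longrightarrow> g' y (frechet_derivative f (at (g y)) v) = v"
  shows "smooth_on T g"
proof -
  have "times_differentiable_on k T g" for k
  proof (induction k)
    case 0
    then show ?case
      using has_derivative_continuous[OF g] by (simp add: continuous_at_imp_continuous_on)
  next
    case (Suc k)
    show ?case
    proof (rule times_differentiable_on_SucI[OF assms(1) g])
      fix v
      show "times_differentiable_on k T (\<lambda>y. g' y v)"
      proof (rule times_differentiable_on_inverse_matrix[OF assms(1) _ _ inv])
        show "linear (frechet_derivative f (at (g y)))" if "y \<in> T" for y
          using smooth_onD[OF assms(3)] assms(4) that by (blast intro: has_derivative_linear)
        show "linear (g' y)" if "y \<in> T" for y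
          using g[OF that] by (rule has_derivative_linear)
        show "times_differentiable_on k T (\<lambda>y. frechet_derivative f (at (g y)) w)" for w
          using smooth_on_deriv[OF assms(3), of w] assms Suc unfolding smooth_on_def
          by (intro times_differentiable_on_compose[of T S k "\<lambda>x. frechet_derivative f (at x) w"]) auto
      qed
    qed
  qed
  then show ?thesis by (simp add: smooth_on_def)
qed

text \<open>The derivative at \<open>x0\<close> is normalized to the identity because the
  straightening maps \<open>\<Theta>\<close> used below are built that way. Bijectivity on all of
  \<open>U\<close> is recorded for the comparison of ranks at nearby points.\<close>

theorem smooth_inverse_function_theorem:
  fixes f :: "'a::euclidean_space \<Rightarrow> 'a"
  assumes "open X" "smooth_on X f" "x0 \<in> X" "(f has_derivative (\<lambda>v. v)) (at x0)"
  obtains U V g where "open U" "x0 \<in> U" "U \<subseteq> X" "open V" "homeomorphism U V f g" "smooth_on V g"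
    "\<And>x. x \<in> U \<Longrightarrow> bij (frechet_derivative f (at x))"
proof -
  define F where "F x = Blinfun (frechet_derivative f (at x))" for x
  have F: "blinfun_apply (F x) = frechet_derivative f (at x)" if "x \<in> X" for x
    using smooth_onD[OF assms(2) that]
    by (simp add: F_def bounded_linear_Blinfun_apply has_derivative_bounded_linear)
  have "continuous_on X (\<lambda>x. blinfun_apply (F x) i)" for i
    using smooth_on_imp_continuous_on[OF smooth_on_deriv[OF assms(2), of i]] F
    by (simp cong: continuous_on_cong)
  then have contF: "continuous_on X F"
    by (intro continuous_on_blinfun_componentwise)
  have F0: "F x0 = id_blinfun"
    using F[OF assms(3)] frechet_derivative_at[OF assms(4)] by (intro blinfun_eqI) auto
  have derF: "(f has_derivative blinfun_apply (F x)) (at x)" if "x \<in> X" for x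
    using F smooth_onD[OF assms(2)] that by simp
  have "id_blinfun o\<^sub>L F x0 = id_blinfun"
    by (simp add: F0 blinfun_eqI)
  from inverse_function_theorem[OF assms(1) derF contF assms(3) this]
  obtain U V g g' where *: "open U" "U \<subseteq> X" "x0 \<in> U" "open V" "f x0 \<in> V" "homeomorphism U V f g"
    "\<And>y. y \<in> V \<Longrightarrow> (g has_derivative (g' y)) (at y)"
    "\<And>y. y \<in> V \<Longrightarrow> g' y = inv_into UNIV (blinfun_apply (F (g y)))"
    "\<And>y. y \<in> V \<Longrightarrow> bij (blinfun_apply (F (g y)))"
    by blast
  have gU: "g y \<in> U" if "y \<in> V" for y
    using *(6) that by (auto simp: homeomorphism_def)
  have "smooth_on V g"
  proof (rule smooth_on_local_inverse[OF *(4) assms(1,2) _ *(7)])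
    show "g ` V \<subseteq> X" using gU *(2) by auto
    fix y v assume y: "y \<in> V"
    then have b: "bij (frechet_derivative f (at (g y)))" "g' y = inv_into UNIV (frechet_derivative f (at (g y)))"
      using *(8,9)[OF y] F[of "g y"] gU[OF y] *(2) by auto
    show "frechet_derivative f (at (g y)) (g' y v) = v"
      using b by (simp add: bij_is_surj surj_f_inv_f)
    show "g' y (frechet_derivative f (at (g y)) v) = v"
      using b by (simp add: bij_is_inj)
  qed
  moreover have "bij (frechet_derivative f (at x))" if "x \<in> U" for x
  proof -
    have "g (f x) = x" "f x \<in> V" using *(6) that by (auto simp: homeomorphism_def)
    then show ?thesis using *(9)[of "f x"] F[of x] *(2) that by auto
  qed
  ultimately show ?thesis
    using that * by blast
qed


section \<open>Normal forms of submersions and of maps of constant rank\<close>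

lemma kernel_trivial_on_image:
  fixes P :: "'a::euclidean_space \<Rightarrow> 'b::euclidean_space"
  assumes "linear P" "subspace S" "dim S \<le> dim (P ` S)" "u \<in> S" "P u = 0"
  shows "u = 0"
proof -
  \<comment> \<open>A right inverse of \<open>P\<close> on the image of \<open>S\<close> maps into
    \<open>S\<close> without losing dimension, so it fills \<open>S\<close>; hence \<open>P\<close>
    is injective on \<open>S\<close>.\<close>
  obtain g where g: "range g \<subseteq> S" "linear g" "\<And>v. v \<in> P ` S \<Longrightarrow> P (g v) = v"
    using linear_exists_right_inverse_on[OF assms(1,2)] by auto
  have PS: "subspace (P ` S)"
    using assms by (simp add: linear_subspace_image)
  have "inj_on g (P ` S)"
    using g(3) by (metis inj_onI)
  then have "dim (g ` (P ` S)) = dim (P ` S)"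
    using PS g(2) by (intro dim_image_eq) (simp_all add: span_eq_iff[THEN iffD2])
  then have "g ` (P ` S) = S"
    using assms(3) g(1) PS assms(2)
    by (intro subspace_dim_equal linear_subspace_image[OF g(2)]) auto
  then obtain w where "w \<in> P ` S" "u = g w"
    using assms(4) by blast
  then show ?thesis
    using g(3)[of w] assms(5) linear_0[OF g(2)] by simp
qed

lemma dim_kernel_of_surjective:
  fixes D :: "'a::euclidean_space \<Rightarrow> 'b::euclidean_space"
  assumes "linear D" "surj D"
  shows "dim {v. D v = 0} + DIM('b) = DIM('a)"
proof -
  obtain J where J: "linear J" "\<And>u. D (J u) = u"
    using linear_surjective_right_inverse[OF assms] by (metis comp_apply id_apply)
  let ?K = "{v. D v = 0}"
  have inj: "inj J"
    using J(2) by (metis injI)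
  have K: "subspace ?K"
    using assms(1) by (rule linear_subspace_kernel)
  have R: "subspace (range J)"
    using linear_subspace_image[OF J(1)] by simp
  have "v = (v - J (D v)) + J (D v)" "D (v - J (D v)) = 0" for v
    using assms(1) J by (simp_all add: linear_diff)
  then have "{x + y |x y. x \<in> ?K \<and> y \<in> range J} = UNIV"
    by blast
  moreover have "?K \<inter> range J = {0}"
    using J linear_0[OF J(1)] linear_0[OF assms(1)] by auto
  moreover have "dim (range J) = DIM('b)"
    using dim_image_eq[OF J(1), of UNIV] inj by simp
  ultimately show ?thesis
    using dim_sums_Int[OF K R] by simp
qed

text \<open>If \<open>D \<circ> J\<close> is the identity, the map \<open>x \<mapsto> x + J (\<Phi> x - D x)\<close> has derivative the
  identity at \<open>x0\<close> and turns \<open>\<Phi>\<close> into \<open>D\<close>.\<close>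

lemma submersion_slice:
  fixes \<Phi> :: "'a::euclidean_space \<Rightarrow> 'b::euclidean_space"
  assumes "open X" "smooth_on X \<Phi>" "x0 \<in> X" "(\<Phi> has_derivative D) (at x0)" "surj D"
  obtains U V and \<Theta> :: "'a \<Rightarrow> 'a" and g L where "open U" "x0 \<in> U" "U \<subseteq> X" "open V" "homeomorphism U V \<Theta> g"
    "smooth_on U \<Theta>" "smooth_on V g" "subspace L" "dim L + DIM('b) = DIM('a)"
    "\<And>x. \<Phi> x = 0 \<longleftrightarrow> \<Theta> x \<in> L"
proof -
  have lin: "linear D"
    using assms(4) by (rule has_derivative_linear)
  obtain J where J: "linear J" "\<And>u. D (J u) = u"
    using linear_surjective_right_inverse[OF lin assms(5)] by (metis comp_apply id_apply)
  define \<Theta> where "\<Theta> x = x + J (\<Phi> x - D x)" for x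
  have bl: "bounded_linear J" "bounded_linear D"
    using J(1) lin linear_conv_bounded_linear by auto
  have smooth: "smooth_on X \<Theta>"
    unfolding \<Theta>_def
    by (intro smooth_on_add smooth_on_bounded_linear[OF _ bl(1)] smooth_on_diff
        smooth_on_bounded_linear[OF _ bl(2)] smooth_on_id assms)
  have "(\<Theta> has_derivative (\<lambda>v. v + J (D v - D v))) (at x0)"
    unfolding \<Theta>_def
    by (intro has_derivative_add has_derivative_ident bounded_linear.has_derivative[OF bl(1)]
        has_derivative_diff assms(4) bounded_linear_imp_has_derivative bl)
  then have der: "(\<Theta> has_derivative (\<lambda>v. v)) (at x0)"
    using linear_0[OF J(1)] by simp
  have D\<Theta>: "D (\<Theta> x) = \<Phi> x" for x
    using lin J(2) by (simp add: \<Theta>_def linear_add linear_diff)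
  obtain U V g where "open U" "x0 \<in> U" "U \<subseteq> X" "open V" "homeomorphism U V \<Theta> g" "smooth_on V g"
    using smooth_inverse_function_theorem[OF assms(1) smooth assms(3) der] by metis
  moreover have "\<Phi> x = 0 \<longleftrightarrow> \<Theta> x \<in> {v. D v = 0}" for x
    using D\<Theta> by simp
  ultimately show ?thesis
    by (intro that[OF _ _ _ _ _ smooth_on_subset[OF smooth] _ linear_subspace_kernel[OF lin]
        dim_kernel_of_surjective[OF lin assms(5)]])
qed

text \<open>With \<open>D \<circ> J \<circ> D = D\<close> and \<open>P = D \<circ> J\<close>, the map \<open>x \<mapsto> x + J (P (f x) - D x)\<close> has derivative the
  identity at \<open>x0\<close> and turns \<open>P \<circ> f\<close> into \<open>D\<close>; since the rank is constant, \<open>f\<close> is locally a function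
  of \<open>P \<circ> f\<close>.\<close>

lemma constant_rank_image:
  fixes f :: "'a::euclidean_space \<Rightarrow> 'b::euclidean_space"
  assumes X: "open X" "x0 \<in> X" and f: "smooth_on X f" and D: "(f has_derivative D) (at x0)"
    and rank: "\<And>x. x \<in> X \<Longrightarrow> dim (range (frechet_derivative f (at x))) \<le> dim (range D)"
  obtains P W Y s where "linear P" "range P = range D" "\<And>v. P (D v) = D v"
    "open W" "x0 \<in> W" "W \<subseteq> X" "open Y" "P (f x0) \<in> Y" "smooth_on Y s"
    "\<And>x. x \<in> W \<Longrightarrow> P (f x) \<in> Y \<and> f x = s (P (f x))" "\<And>y. y \<in> Y \<Longrightarrow> s y \<in> f ` X"
    "\<And>y. y \<in> Y \<Longrightarrow> y \<in> range P \<Longrightarrow> P (s y) = y"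
proof -
  have lin: "linear D"
    using D by (rule has_derivative_linear)
  obtain J where J: "linear J" "\<And>v. D (J (D v)) = D v"
    using linear_exists_right_inverse_on[OF lin subspace_UNIV] by auto
  define P where "P = D \<circ> J"
  have PD: "P (D v) = D v" for v
    using J(2) by (simp add: P_def)
  have linP: "linear P"
    unfolding P_def using J(1) lin by (rule linear_compose)
  have rP: "range P = range D"
    using PD unfolding P_def by (auto simp: image_iff) metis
  define \<Theta> where "\<Theta> x = x + J (P (f x) - D x)" for x
  have bl: "bounded_linear J" "bounded_linear D" "bounded_linear P"
    using J(1) lin linP linear_conv_bounded_linear by auto
  have smooth: "smooth_on X \<Theta>"
    unfolding \<Theta>_def
    by (intro smooth_on_add smooth_on_bounded_linear[OF _ bl(1)] smooth_on_diff
        smooth_on_bounded_linear[OF _ bl(2)] smooth_on_bounded_linear[OF _ bl(3)] smooth_on_id f X)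
  have "(\<Theta> has_derivative (\<lambda>v. v + J (P (D v) - D v))) (at x0)"
    unfolding \<Theta>_def
    by (intro has_derivative_add has_derivative_ident bounded_linear.has_derivative[OF bl(1)]
        bounded_linear.has_derivative[OF bl(3)]
        has_derivative_diff D bounded_linear_imp_has_derivative bl)
  then have der: "(\<Theta> has_derivative (\<lambda>v. v)) (at x0)"
    using linear_0[OF J(1)] by (simp add: PD)
  have D\<Theta>: "D (\<Theta> x) = P (f x)" for x
  proof -
    have "D (J (P u)) = P u" for u
      using J(2) by (simp add: P_def)
    then show ?thesis
      using lin J by (simp add: \<Theta>_def linear_add linear_diff)
  qed
  obtain U V g where U: "open U" "x0 \<in> U" "U \<subseteq> X" and V: "open V" and hom: "homeomorphism U V \<Theta> g"
    and g: "smooth_on V g" and bij: "\<And>x. x \<in> U \<Longrightarrow> bij (frechet_derivative \<Theta> (at x))"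
    using smooth_inverse_function_theorem[OF X(1) smooth X(2) der] by metis
  have hom': "g (\<Theta> x) = x" "\<Theta> x \<in> V" if "x \<in> U" for x
    using hom that by (auto simp: homeomorphism_def)
  have hom'': "\<Theta> (g z) = z" "g z \<in> U" if "z \<in> V" for z
    using hom that by (auto simp: homeomorphism_def)
  define z0 where "z0 = \<Theta> x0"
  obtain e where e: "e > 0" "ball z0 e \<subseteq> V"
    using openE[OF V hom'(2)[OF U(2)]] z0_def by blast
  define F where "F z = f (g z)" for z
  \<comment> \<open>\<open>P \<circ> f = D \<circ> \<Theta>\<close> has the rank of \<open>D\<close>
    wherever the derivative of \<open>\<Theta>\<close> is bijective, and the derivative of
    \<open>f\<close> has at most this rank there; so \<open>P\<close> loses no dimension on its
    range.\<close>
  have P_inj: "w = 0" if x: "x \<in> U" and w: "w \<in> range (frechet_derivative f (at x))" "P w = 0" for x w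
  proof (rule kernel_trivial_on_image[OF linP _ _ w])
    let ?f' = "frechet_derivative f (at x)" and ?\<Theta>' = "frechet_derivative \<Theta> (at x)"
    have f': "(f has_derivative ?f') (at x)" and \<Theta>': "(\<Theta> has_derivative ?\<Theta>') (at x)"
      using smooth_onD[OF f] smooth_onD[OF smooth] x U(3) by blast+
    show "subspace (range ?f')"
      by (rule linear_subspace_image[OF has_derivative_linear[OF f'] subspace_UNIV])
    have "((\<lambda>x. P (f x)) has_derivative (\<lambda>v. P (?f' v))) (at x)"
      using f' by (rule bounded_linear.has_derivative[OF bl(3)])
    moreover have "((\<lambda>x. P (f x)) has_derivative (\<lambda>v. D (?\<Theta>' v))) (at x)"
      using bounded_linear.has_derivative[OF bl(2) \<Theta>'] by (simp add: D\<Theta>)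
    ultimately have "(\<lambda>v. P (?f' v)) = (\<lambda>v. D (?\<Theta>' v))"
      by (rule has_derivative_unique)
    then have "P ` range ?f' = D ` range ?\<Theta>'"
      by (simp only: image_image)
    also have "range ?\<Theta>' = UNIV"
      using bij[OF x] by (simp add: bij_is_surj)
    finally show "dim (range ?f') \<le> dim (P ` range ?f')"
      using rank x U by auto
  qed
  \<comment> \<open>Since \<open>P (F z) = D z\<close>, the derivative of \<open>P \<circ> F\<close>
    vanishes along a segment inside a fibre of \<open>D\<close>, and by \<open>P_inj\<close> so does
    that of \<open>F\<close>. The ball is taken for its convexity: it contains the segment.\<close>
  have F_eq: "F z = F z'" if z: "z \<in> ball z0 e" "z' \<in> ball z0 e" "D z = D z'" for z z'
  proof -
    define c where "c t = z + t *\<^sub>R (z' - z)" for t :: real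
    have c: "c t \<in> ball z0 e" if "t \<in> {0..1}" for t
      using convexD_alt[OF convex_ball z(1,2), of t] that by (simp add: c_def algebra_simps)
    have "\<exists>k. \<forall>t\<in>{0..1}. F (c t) = k"
    proof (rule has_derivative_zero_constant)
      fix t :: real assume t: "t \<in> {0..1}"
      then have ct: "c t \<in> V" "g (c t) \<in> U" "g (c t) \<in> X"
        using c[OF t] e(2) hom''(2) U(3) by blast+
      let ?h = "\<lambda>v. frechet_derivative f (at (g (c t))) (frechet_derivative g (at (c t)) v)"
      have F': "(F has_derivative ?h) (at (c t))"
        unfolding F_def using smooth_onD[OF g ct(1)] smooth_onD[OF f ct(3)]
        by (rule has_derivative_compose)
      have "((\<lambda>z. P (F z)) has_derivative (\<lambda>v. P (?h v))) (at (c t))"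
        using F' by (rule bounded_linear.has_derivative[OF bl(3)])
      moreover have "((\<lambda>z. P (F z)) has_derivative D) (at (c t))"
      proof (rule has_derivative_transform_within_open[OF bounded_linear_imp_has_derivative[OF bl(2)] V ct(1)])
        show "D z = P (F z)" if "z \<in> V" for z
          using D\<Theta>[of "g z"] hom''[OF that] by (simp add: F_def)
      qed
      ultimately have "(\<lambda>v. P (?h v)) = D"
        by (rule has_derivative_unique)
      then have "P (?h (z' - z)) = 0"
        using z(3) lin by (metis (no_types, lifting) linear_diff right_minus_eq)
      then have 0: "?h (z' - z) = 0"
        using P_inj[OF ct(2)] by blast
      have "(c has_derivative (\<lambda>r. r *\<^sub>R (z' - z))) (at t within {0..1})"
        unfolding c_def by (auto intro!: derivative_eq_intros)
      then have "((\<lambda>t. F (c t)) has_derivative (\<lambda>r. ?h (r *\<^sub>R (z' - z)))) (at t within {0..1})"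
        using F' by (rule has_derivative_compose)
      moreover have "?h (r *\<^sub>R (z' - z)) = 0" for r
        using 0 linear_scale[OF has_derivative_linear[OF F'], of r "z' - z"] by simp
      ultimately show "((\<lambda>t. F (c t)) has_derivative (\<lambda>h. 0)) (at t within {0..1})"
        by simp
    qed simp
    then have "F (c 0) = F (c 1)"
      by force
    then show ?thesis
      by (simp add: c_def)
  qed
  \<comment> \<open>An affine section of \<open>D\<close> through \<open>z0\<close>. It picks one
    point from each fibre of \<open>D\<close>, and \<open>F\<close> does not depend on which point
    of the fibre is picked.\<close>
  define k where "k y = z0 + J (y - D z0)" for y
  have kc: "smooth_on UNIV k"
    unfolding k_def by (intro smooth_on_add smooth_on_const smooth_on_bounded_linear[OF _ bl(1)]
        smooth_on_diff smooth_on_id) auto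
  define Y where "Y = k -` ball z0 e"
  define W where "W = U \<inter> \<Theta> -` (ball z0 e \<inter> D -` Y)"
  define s where "s y = F (k y)" for y
  have Y: "open Y"
    unfolding Y_def using smooth_on_imp_continuous_on[OF kc] by (intro open_vimage) auto
  have Dk: "D (k y) = y" if "y \<in> range D" for y
    using that lin J by (auto simp: k_def linear_add linear_diff)
  have Fs: "smooth_on V F"
    unfolding F_def using hom'' U by (intro smooth_on_compose[OF f g V X(1)]) auto
  show ?thesis
  proof (rule that[OF linP rP PD _ _ _ Y])
    show "open W"
      unfolding W_def using hom U(1) Y linear_continuous_on[OF bl(2)]
      by (intro continuous_open_preimage open_Int open_ball open_vimage) (auto simp: homeomorphism_def)
    have k0: "k (D z0) = z0"
      using linear_0[OF J(1)] by (simp add: k_def)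
    show "x0 \<in> W"
      using U e k0 by (auto simp: W_def Y_def z0_def)
    show "W \<subseteq> X"
      using U by (auto simp: W_def)
    show "P (f x0) \<in> Y"
      using k0 e by (simp add: Y_def z0_def flip: D\<Theta>)
    show "smooth_on Y s"
      unfolding s_def using e(2)
      by (intro smooth_on_compose[OF Fs smooth_on_subset[OF kc] Y V]) (auto simp: Y_def)
    show "P (f x) \<in> Y \<and> f x = s (P (f x))" if x: "x \<in> W" for x
    proof -
      have *: "x \<in> U" "\<Theta> x \<in> ball z0 e" "D (\<Theta> x) \<in> Y"
        using x by (auto simp: W_def)
      have "F (\<Theta> x) = F (k (D (\<Theta> x)))"
        using * by (intro F_eq) (auto simp: Y_def Dk)
      then show ?thesis
        using * hom'[of x] by (simp add: s_def F_def D\<Theta>)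
    qed
    show "s y \<in> f ` X" if "y \<in> Y" for y
    proof -
      have "g (k y) \<in> X"
        using that e(2) hom''(2) U(3) unfolding Y_def by blast
      then show ?thesis
        by (simp add: s_def F_def)
    qed
    show "P (s y) = y" if "y \<in> Y" "y \<in> range P" for y
    proof -
      have "k y \<in> V"
        using that(1) e(2) unfolding Y_def by blast
      then have "P (F (k y)) = D (k y)"
        using D\<Theta>[of "g (k y)"] hom''[of "k y"] by (simp add: F_def)
      then show ?thesis
        using Dk[of y] that rP by (simp add: s_def)
    qed
  qed
qed

section \<open>Differentials of maps between manifolds\<close>

lemma is_chartD:
  assumes "is_chart (U, \<phi>)"
  shows "open U" "open (\<phi> ` U)" "inj_on \<phi> U" "continuous_on U \<phi>" "continuous_on (\<phi> ` U) (inv_into U \<phi>)"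
    "homeomorphism U (\<phi> ` U) \<phi> (inv_into U \<phi>)"
proof -
  show h: "homeomorphism U (\<phi> ` U) \<phi> (inv_into U \<phi>)" and "open U" "open (\<phi> ` U)"
    using assms by (auto simp: is_chart_def)
  then show "inj_on \<phi> U" "continuous_on U \<phi>" "continuous_on (\<phi> ` U) (inv_into U \<phi>)"
    by (auto simp: homeomorphism_def intro: inj_on_inverseI)
qed

lemma is_chart_open_image:
  assumes "is_chart (U, \<phi>)" "open T" "T \<subseteq> U"
  shows "open (\<phi> ` T)"
proof -
  have "\<phi> ` T = \<phi> ` U \<inter> inv_into U \<phi> -` T"
    using assms(3) is_chartD(3)[OF assms(1)] inv_into_f_f[OF is_chartD(3)[OF assms(1)]] by fastforce
  then show ?thesis
    using continuous_open_preimage[OF is_chartD(5,2)[OF assms(1)] assms(2)] by simp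
qed

text \<open>The part of \<open>smooth_atlas\<close> that does not speak of transition maps;
  continuity arguments and the chain rule get by with it.\<close>

definition charted :: "('m::topological_space, 'e::euclidean_space) chart set \<Rightarrow> bool" where
  "charted A \<longleftrightarrow> (\<forall>c\<in>A. is_chart c) \<and> (\<Union>c\<in>A. fst c) = UNIV"

lemma smooth_atlas_charted: "smooth_atlas A \<Longrightarrow> charted A"
  by (simp add: smooth_atlas_def charted_def)

abbreviation dom_at :: "('m, 'e) chart set \<Rightarrow> 'm \<Rightarrow> 'm set" where
  "dom_at A p \<equiv> fst (chart_at A p)"

lemma chart_at_mem:
  assumes "charted A"
  shows "chart_at A p \<in> A" "p \<in> dom_at A p"
proof -
  have "\<exists>c. c \<in> A \<and> p \<in> fst c"
    using assms unfolding charted_def by blast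
  from someI_ex[OF this] show "chart_at A p \<in> A" "p \<in> dom_at A p"
    by (simp_all add: chart_at_def)
qed

lemma chart_at_pair: "chart_at A p = (dom_at A p, coord A p)"
  by (simp add: coord_def)

lemma is_chart_at: "charted A \<Longrightarrow> is_chart (dom_at A p, coord A p)"
  using chart_at_mem(1)[of A p] by (simp add: charted_def flip: chart_at_pair)

lemma inv_coord_coord: "charted A \<Longrightarrow> q \<in> dom_at A p \<Longrightarrow> inv_coord A p (coord A p q) = q"
  using is_chartD(3)[OF is_chart_at[of A p]] by (simp add: inv_coord_def)

lemma coord_inv_coord:
  "x \<in> coord A p ` dom_at A p \<Longrightarrow> coord A p (inv_coord A p x) = x"
  by (simp add: inv_coord_def f_inv_into_f)

lemma open_dom_at: "charted A \<Longrightarrow> open (dom_at A p)"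
  using is_chartD(1)[OF is_chart_at] .

lemma open_coord_image: "charted A \<Longrightarrow> open (coord A p ` dom_at A p)"
  using is_chartD(2)[OF is_chart_at] .

lemma isCont_coord: "charted A \<Longrightarrow> q \<in> dom_at A p \<Longrightarrow> isCont (coord A p) q"
  using is_chartD(4)[OF is_chart_at[of A p]] open_dom_at[of A p]
  by (simp add: continuous_on_eq_continuous_at)

lemma isCont_inv_coord: "charted A \<Longrightarrow> x \<in> coord A p ` dom_at A p \<Longrightarrow> isCont (inv_coord A p) x"
  using is_chartD(5)[OF is_chart_at[of A p]] continuous_on_eq_continuous_at[OF open_coord_image[of A p]]
  unfolding inv_coord_def by blast

text \<open>Relational counterpart of \<open>tangent_map\<close>, whose value is arbitrary where no
  derivative exists. Continuity is demanded separately because the chart expression sees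
  \<open>f\<close> only through \<open>coord\<close>, and the chain rule needs points near
  \<open>p\<close> to land in the chart domain chosen at \<open>f p\<close>.\<close>

definition has_tangent ::
    "('m::t2_space, 'e::euclidean_space) chart set \<Rightarrow>
     ('n::t2_space, 'f::euclidean_space) chart set \<Rightarrow> ('m \<Rightarrow> 'n) \<Rightarrow> 'm \<Rightarrow> ('e \<Rightarrow> 'f) \<Rightarrow> bool" where
  "has_tangent A B f p D \<longleftrightarrow> isCont f p \<and>
     ((\<lambda>x. coord B (f p) (f (inv_coord A p x))) has_derivative D) (at (coord A p p))"

lemma tangent_map_eq: "has_tangent A B f p D \<Longrightarrow> tangent_map A B f p = D"
  using frechet_derivative_at unfolding has_tangent_def tangent_map_def by metis

lemma has_tangent_unique: "has_tangent A B f p D \<Longrightarrow> has_tangent A B f p E \<Longrightarrow> D = E"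
  using tangent_map_eq by blast

lemma has_tangent_linear: "has_tangent A B f p D \<Longrightarrow> linear D"
  unfolding has_tangent_def using has_derivative_linear by blast

lemma has_tangent_id:
  assumes "charted A"
  shows "has_tangent A A (\<lambda>x. x) p (\<lambda>v. v)"
  unfolding has_tangent_def
proof
  have "coord A p p \<in> coord A p ` dom_at A p"
    using chart_at_mem(2)[OF assms] by blast
  then show "((\<lambda>x. coord A p (inv_coord A p x)) has_derivative (\<lambda>v. v)) (at (coord A p p))"
    using open_coord_image[OF assms, of p]
    by (intro has_derivative_transform_within_open[OF has_derivative_ident])
      (auto intro: coord_inv_coord[symmetric])
qed simp

lemma has_tangent_const: "has_tangent A B (\<lambda>x. c) p (\<lambda>v. 0)"
  by (simp add: has_tangent_def)

lemma coord_at_mem: "charted A \<Longrightarrow> coord A p p \<in> coord A p ` dom_at A p"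
  using chart_at_mem(2) by blast

lemma filterlim_inv_coord:
  assumes "charted A"
  shows "((inv_coord A p) \<longlongrightarrow> p) (at (coord A p p))"
  using isCont_inv_coord[OF assms coord_at_mem[OF assms], of p]
    inv_coord_coord[OF assms chart_at_mem(2)[OF assms], of p]
  by (simp add: isCont_def)

lemma has_tangent_cong:
  assumes A: "charted A" and f: "has_tangent A B f p D" and eq: "\<forall>\<^sub>F q in nhds p. f q = g q"
  shows "has_tangent A B g p D"
proof -
  have p: "f p = g p"
    using eq by (rule eventually_nhds_x_imp_x)
  have "isCont g p"
    using f eq isCont_cong unfolding has_tangent_def by blast
  moreover have "\<forall>\<^sub>F x in at (coord A p p). f (inv_coord A p x) = g (inv_coord A p x)"
    using filterlim_inv_coord[OF A, of p] eq by (auto simp: filterlim_iff)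
  then have "\<forall>\<^sub>F x in at (coord A p p). coord B (f p) (f (inv_coord A p x)) = coord B (g p) (g (inv_coord A p x))"
    by eventually_elim (simp add: p)
  then have "((\<lambda>x. coord B (g p) (g (inv_coord A p x))) has_derivative D) (at (coord A p p))"
    using f p inv_coord_coord[OF A chart_at_mem(2)[OF A], of p] unfolding has_tangent_def
    by (auto intro: has_derivative_transform_eventually)
  ultimately show ?thesis
    by (simp add: has_tangent_def)
qed

lemma has_tangent_compose:
  assumes A: "charted A" and B: "charted B"
    and f: "has_tangent A B f p D" and g: "has_tangent B C g (f p) E"
  shows "has_tangent A C (\<lambda>x. g (f x)) p (\<lambda>v. E (D v))"
  unfolding has_tangent_def
proof
  show "isCont (\<lambda>x. g (f x)) p"
    using f g unfolding has_tangent_def by (blast intro: isCont_o2)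
  let ?F = "\<lambda>x. coord B (f p) (f (inv_coord A p x))"
  let ?G = "\<lambda>y. coord C (g (f p)) (g (inv_coord B (f p) y))"
  have p: "inv_coord A p (coord A p p) = p" "inv_coord B (f p) (coord B (f p) (f p)) = f p"
    using inv_coord_coord chart_at_mem(2) A B by blast+
  have "((\<lambda>x. f (inv_coord A p x)) \<longlongrightarrow> f p) (at (coord A p p))"
    using isCont_tendsto_compose[OF _ filterlim_inv_coord[OF A]] f by (auto simp: has_tangent_def)
  then have "\<forall>\<^sub>F x in at (coord A p p). f (inv_coord A p x) \<in> dom_at B (f p)"
    using chart_at_mem(2)[OF B] open_dom_at[OF B] topological_tendstoD by blast
  then have ev: "\<forall>\<^sub>F x in at (coord A p p). ?G (?F x) = coord C (g (f p)) (g (f (inv_coord A p x)))"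
    by eventually_elim (simp add: inv_coord_coord[OF B])
  have "(?F has_derivative D) (at (coord A p p))"
    using f unfolding has_tangent_def by blast
  moreover have "(?G has_derivative E) (at (?F (coord A p p)))"
    using g unfolding has_tangent_def p by blast
  ultimately have "((\<lambda>x. ?G (?F x)) has_derivative (\<lambda>v. E (D v))) (at (coord A p p))"
    by (rule has_derivative_compose[of ?F D _ _ ?G E])
  then show "((\<lambda>x. coord C (g (f p)) (g (f (inv_coord A p x)))) has_derivative (\<lambda>v. E (D v))) (at (coord A p p))"
    using ev by (rule has_derivative_transform_eventually) (simp_all add: p)
qed

lemma smooth_map_chart:
  "smooth_map A B f \<Longrightarrow> (U, \<phi>) \<in> A \<Longrightarrow> (V, \<psi>) \<in> B \<Longrightarrow>
    smooth_on (\<phi> ` (U \<inter> f -` V)) (\<lambda>x. \<psi> (f (inv_into U \<phi> x)))"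
  unfolding smooth_map_def by blast

lemma smooth_map_coord:
  assumes "charted A" "charted B" "smooth_map A B f"
  shows "smooth_on (coord A p ` (dom_at A p \<inter> f -` dom_at B q)) (\<lambda>x. coord B q (f (inv_coord A p x)))"
  using smooth_map_chart[OF assms(3), of "dom_at A p" "coord A p" "dom_at B q" "coord B q"]
    chart_at_mem(1)[OF assms(1)] chart_at_mem(1)[OF assms(2)]
  by (simp add: inv_coord_def flip: chart_at_pair)

lemma smooth_map_isCont: "smooth_map A B f \<Longrightarrow> isCont f p"
  unfolding smooth_map_def using continuous_on_eq_continuous_at[OF open_UNIV, of f] by blast

lemma smooth_map_has_tangent:
  assumes "charted A" "charted B" "smooth_map A B f"
  shows "has_tangent A B f p (tangent_map A B f p)"
proof -
  have "isCont f p"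
    using assms(3) by (rule smooth_map_isCont)
  moreover have "coord A p p \<in> coord A p ` (dom_at A p \<inter> f -` dom_at B (f p))"
    using chart_at_mem(2)[OF assms(1)] chart_at_mem(2)[OF assms(2)] by blast
  ultimately show ?thesis
    unfolding has_tangent_def tangent_map_def using smooth_onD[OF smooth_map_coord[OF assms]] by blast
qed

lemma smooth_map_tangent:
  assumes "charted A" "charted B" "smooth_map A B f"
  obtains D where "has_tangent A B f p D"
  using smooth_map_has_tangent[OF assms] by blast

section \<open>Smooth maps and product manifolds\<close>

lemma times_differentiable_on_local:
  assumes "\<And>x. x \<in> S \<Longrightarrow> \<exists>T. open T \<and> x \<in> T \<and> times_differentiable_on k T f"
  shows "times_differentiable_on k S f"
  using assms
proof (induction k arbitrary: f)
  case 0
  have "isCont f x" if "x \<in> S" for x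
    using 0[OF that] continuous_on_eq_continuous_at by auto
  then show ?case
    by (simp add: continuous_at_imp_continuous_on)
next
  case (Suc k)
  have "times_differentiable_on k S (\<lambda>x. frechet_derivative f (at x) v)" for v
  proof (rule Suc.IH)
    fix x assume "x \<in> S"
    then obtain T where "open T" "x \<in> T" "times_differentiable_on (Suc k) T f"
      using Suc.prems by blast
    then show "\<exists>T. open T \<and> x \<in> T \<and> times_differentiable_on k T (\<lambda>x. frechet_derivative f (at x) v)"
      by (intro exI[of _ T]) simp
  qed
  moreover have "f differentiable at x" if "x \<in> S" for x
    using Suc.prems[OF that] by auto
  ultimately show ?case by simp
qed

lemma smooth_on_local:
  assumes "\<And>x. x \<in> S \<Longrightarrow> \<exists>T. open T \<and> x \<in> T \<and> smooth_on T f"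
  shows "smooth_on S f"
  unfolding smooth_on_def
proof
  fix k show "times_differentiable_on k S f"
    by (rule times_differentiable_on_local) (use assms smooth_on_def in blast)
qed

lemma smooth_map_id: "smooth_atlas A \<Longrightarrow> smooth_map A A (\<lambda>x. x)"
  by (auto simp: smooth_map_def smooth_atlas_def transition_smooth_def)

lemma smooth_map_const:
  assumes "charted A"
  shows "smooth_map A B (\<lambda>x. c)"
  unfolding smooth_map_def
proof safe
  fix U \<phi> V \<psi> assume "(U, \<phi>) \<in> A"
  then have c: "is_chart (U, \<phi>)"
    using assms by (auto simp: charted_def)
  have "open (U \<inter> (\<lambda>x. c) -` V)"
    using is_chartD(1)[OF c] by (cases "c \<in> V") auto
  then show "smooth_on (\<phi> ` (U \<inter> (\<lambda>x. c) -` V)) (\<lambda>x. \<psi> c)"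
    by (intro smooth_on_const is_chart_open_image[OF c]) auto
qed simp

lemma smooth_map_Pair:
  assumes "charted A" "charted B" "charted C" and f: "smooth_map A B f" and g: "smooth_map A C g"
  shows "smooth_map A (product_atlas B C) (\<lambda>x. (f x, g x))"
  unfolding smooth_map_def product_atlas_def
proof safe
  have c: "continuous_on UNIV f" "continuous_on UNIV g"
    using f g by (auto simp: smooth_map_def)
  then show "continuous_on UNIV (\<lambda>x. (f x, g x))"
    by (rule continuous_on_Pair)
  fix U \<phi> V \<psi> W \<eta> assume UV: "(U, \<phi>) \<in> A" "(V, \<psi>) \<in> B" "(W, \<eta>) \<in> C"
  then have ch: "is_chart (U, \<phi>)" "is_chart (V, \<psi>)" "is_chart (W, \<eta>)"
    using assms by (auto simp: charted_def)
  let ?T = "U \<inter> (\<lambda>x. (f x, g x)) -` (V \<times> W)"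
  have "?T = U \<inter> f -` V \<inter> g -` W" by auto
  moreover have "open (f -` V)" "open (g -` W)"
    using c ch is_chartD(1) open_vimage by blast+
  ultimately have "open ?T"
    using is_chartD(1)[OF ch(1)] by auto
  then have op: "open (\<phi> ` ?T)"
    by (intro is_chart_open_image[OF ch(1)]) auto
  have "smooth_on (\<phi> ` ?T) (\<lambda>x. (\<psi> (f (inv_into U \<phi> x)), \<eta> (g (inv_into U \<phi> x))))"
    by (intro smooth_on_Pair op smooth_on_subset[OF smooth_map_chart[OF f UV(1,2)]]
        smooth_on_subset[OF smooth_map_chart[OF g UV(1,3)]]) auto
  then show "smooth_on (\<phi> ` ?T) (\<lambda>x. map_prod \<psi> \<eta> (f (inv_into U \<phi> x), g (inv_into U \<phi> x)))"
    by simp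
qed

lemma smooth_map_compose:
  fixes A :: "('m::topological_space, 'e::euclidean_space) chart set"
    and B :: "('n::topological_space, 'f::euclidean_space) chart set"
    and C :: "('k::topological_space, 'h::euclidean_space) chart set"
  assumes A: "charted A" and B: "charted B" and C: "charted C"
    and f: "smooth_map A B f" and g: "smooth_map B C g"
  shows "smooth_map A C (\<lambda>x. g (f x))"
  unfolding smooth_map_def
proof safe
  have c: "continuous_on UNIV f" "continuous_on UNIV g"
    using f g by (auto simp: smooth_map_def)
  then show "continuous_on UNIV (\<lambda>x. g (f x))"
    by (auto intro: continuous_on_compose2)
  fix U \<phi> W \<eta> assume UW: "(U, \<phi>) \<in> A" "(W, \<eta>) \<in> C"
  have chU: "is_chart (U, \<phi>)" and chW: "is_chart (W, \<eta>)"
    using UW A C by (auto simp: charted_def)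
  show "smooth_on (\<phi> ` (U \<inter> (\<lambda>x. g (f x)) -` W)) (\<lambda>x. \<eta> (g (f (inv_into U \<phi> x))))"
  proof (rule smooth_on_local)
    fix x assume "x \<in> \<phi> ` (U \<inter> (\<lambda>x. g (f x)) -` W)"
    then obtain q where q: "q \<in> U" "g (f q) \<in> W" "x = \<phi> q" by auto
    obtain V \<psi> where V: "(V, \<psi>) \<in> B" "f q \<in> V"
      using B unfolding charted_def by (metis UNIV_I UN_E prod.collapse)
    then have chV: "is_chart (V, \<psi>)"
      using B by (auto simp: charted_def)
    let ?S = "V \<inter> g -` W" and ?T = "U \<inter> f -` (V \<inter> g -` W)"
    have oS: "open ?S"
      using is_chartD(1)[OF chV] is_chartD(1)[OF chW] c open_vimage by (intro open_Int) auto
    have oT: "open ?T"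
      using is_chartD(1)[OF chU] open_vimage[OF oS c(1)] by (rule open_Int)
    have opS: "open (\<psi> ` ?S)" and opT: "open (\<phi> ` ?T)"
      using is_chart_open_image[OF chV oS] is_chart_open_image[OF chU oT] by auto
    have inv: "inv_into U \<phi> (\<phi> r) = r" if "r \<in> U" for r
      using is_chartD(3)[OF chU] that by simp
    have inv': "inv_into V \<psi> (\<psi> r) = r" if "r \<in> V" for r
      using is_chartD(3)[OF chV] that by simp
    have "smooth_on (\<phi> ` ?T) (\<lambda>x. \<eta> (g (inv_into V \<psi> (\<psi> (f (inv_into U \<phi> x))))))"
    proof (rule smooth_on_compose[OF smooth_map_chart[OF g V(1) UW(2)]
          smooth_on_subset[OF smooth_map_chart[OF f UW(1) V(1)]] opT opS])
      show "\<phi> ` ?T \<subseteq> \<phi> ` (U \<inter> f -` V)" by blast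
      show "(\<lambda>x. \<psi> (f (inv_into U \<phi> x))) ` \<phi> ` ?T \<subseteq> \<psi> ` ?S"
        using inv by auto
    qed
    then have "smooth_on (\<phi> ` ?T) (\<lambda>x. \<eta> (g (f (inv_into U \<phi> x))))"
    proof (rule smooth_on_cong[OF _ opT])
      fix y assume "y \<in> \<phi> ` ?T"
      then obtain r where "r \<in> U" "f r \<in> V" "y = \<phi> r" by auto
      then show "\<eta> (g (inv_into V \<psi> (\<psi> (f (inv_into U \<phi> y))))) = \<eta> (g (f (inv_into U \<phi> y)))"
        using inv inv' by simp
    qed
    then show "\<exists>T. open T \<and> x \<in> T \<and> smooth_on T (\<lambda>x. \<eta> (g (f (inv_into U \<phi> x))))"
      using opT q V(2) by (intro exI[of _ "\<phi> ` ?T"]) auto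
  qed
qed

lemma inv_into_map_prod:
  assumes "inj_on \<phi> U" "inj_on \<psi> V" "x \<in> \<phi> ` U" "y \<in> \<psi> ` V"
  shows "inv_into (U \<times> V) (map_prod \<phi> \<psi>) (x, y) = (inv_into U \<phi> x, inv_into V \<psi> y)"
proof -
  have "map_prod \<phi> \<psi> (inv_into U \<phi> x, inv_into V \<psi> y) = (x, y)"
    using assms by (simp add: f_inv_into_f)
  moreover have "(inv_into U \<phi> x, inv_into V \<psi> y) \<in> U \<times> V"
    using assms by (simp add: inv_into_into)
  ultimately show ?thesis
    using inv_into_f_f[OF map_prod_inj_on[OF assms(1,2)]] by metis
qed

lemma is_chart_product:
  assumes "is_chart (U, \<phi>)" "is_chart (V, \<psi>)"
  shows "is_chart (U \<times> V, map_prod \<phi> \<psi>)"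
proof -
  note c = is_chartD[OF assms(1)] and d = is_chartD[OF assms(2)]
  have im: "map_prod \<phi> \<psi> ` (U \<times> V) = \<phi> ` U \<times> \<psi> ` V" by auto
  have "continuous_on (\<phi> ` U \<times> \<psi> ` V) (\<lambda>z. (inv_into U \<phi> (fst z), inv_into V \<psi> (snd z)))"
    by (intro continuous_on_Pair continuous_on_compose2[OF c(5)] continuous_on_compose2[OF d(5)]
        continuous_on_fst continuous_on_snd continuous_on_id) auto
  then have cont: "continuous_on (\<phi> ` U \<times> \<psi> ` V) (inv_into (U \<times> V) (map_prod \<phi> \<psi>))"
    by (rule continuous_on_eq) (auto simp: inv_into_map_prod c d)
  have "continuous_on (U \<times> V) (\<lambda>z. (\<phi> (fst z), \<psi> (snd z)))"
    by (intro continuous_on_Pair continuous_on_compose2[OF c(4)] continuous_on_compose2[OF d(4)]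
        continuous_on_fst continuous_on_snd continuous_on_id) auto
  then have "continuous_on (U \<times> V) (map_prod \<phi> \<psi>)"
    by (rule continuous_on_eq) auto
  then have "homeomorphism (U \<times> V) (map_prod \<phi> \<psi> ` (U \<times> V)) (map_prod \<phi> \<psi>)
      (inv_into (U \<times> V) (map_prod \<phi> \<psi>))"
    using cont unfolding im[symmetric]
    by (rule homeomorphismI)
      (simp_all only: subset_refl image_inv_into_cancel inv_into_image_cancel inv_into_f_f f_inv_into_f
        map_prod_inj_on[OF c(3) d(3)])
  moreover have "open (U \<times> V)" "open (map_prod \<phi> \<psi> ` (U \<times> V))"
    unfolding im using c(1,2) d(1,2) by (simp_all add: open_Times)
  ultimately show ?thesis
    by (simp add: is_chart_def)
qed

lemma charted_product:
  assumes "charted A" "charted B"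
  shows "charted (product_atlas A B)"
  unfolding charted_def
proof
  show "\<forall>c\<in>product_atlas A B. is_chart c"
    using assms unfolding product_atlas_def charted_def by (blast intro: is_chart_product)
  have "\<exists>c\<in>product_atlas A B. z \<in> fst c" for z
  proof -
    obtain U \<phi> V \<psi> where "(U, \<phi>) \<in> A" "(V, \<psi>) \<in> B" "fst z \<in> U" "snd z \<in> V"
      using assms unfolding charted_def by (metis UNIV_I UN_E prod.collapse)
    then have "(U \<times> V, map_prod \<phi> \<psi>) \<in> product_atlas A B" "z \<in> U \<times> V"
      by (auto simp: product_atlas_def mem_Times_iff)
    then show ?thesis by force
  qed
  then show "(\<Union>c\<in>product_atlas A B. fst c) = UNIV" by blast
qed

lemma smooth_map_fst:
  assumes "smooth_atlas A" "charted B"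
  shows "smooth_map (product_atlas A B) A fst"
  unfolding smooth_map_def product_atlas_def
proof safe
  fix U \<phi> V \<psi> U' \<phi>' assume *: "(U, \<phi>) \<in> A" "(V, \<psi>) \<in> B" "(U', \<phi>') \<in> A"
  then have c: "is_chart (U, \<phi>)" "is_chart (V, \<psi>)" "is_chart (U', \<phi>')"
    and t: "smooth_on (\<phi> ` (U \<inter> U')) (\<lambda>x. \<phi>' (inv_into U \<phi> x))"
    using assms by (auto simp: smooth_atlas_def charted_def transition_smooth_def)
  have S: "map_prod \<phi> \<psi> ` (U \<times> V \<inter> fst -` U') = \<phi> ` (U \<inter> U') \<times> \<psi> ` V" by auto
  have op: "open (\<phi> ` (U \<inter> U'))" "open (\<psi> ` V)"
    using is_chart_open_image[OF c(1), of "U \<inter> U'"] is_chartD c by auto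
  have "smooth_on (\<phi> ` (U \<inter> U') \<times> \<psi> ` V) (\<lambda>z. \<phi>' (inv_into U \<phi> (fst z)))"
    using op by (intro smooth_on_compose[OF t] open_Times smooth_on_bounded_linear[OF _ bounded_linear_fst]
        smooth_on_id) auto
  then show "smooth_on (map_prod \<phi> \<psi> ` (U \<times> V \<inter> fst -` U'))
      (\<lambda>x. \<phi>' (fst (inv_into (U \<times> V) (map_prod \<phi> \<psi>) x)))"
    unfolding S by (rule smooth_on_cong) (auto simp: op open_Times inv_into_map_prod is_chartD[OF c(1)] is_chartD[OF c(2)])
qed (intro continuous_intros)

lemma smooth_map_snd:
  assumes "charted A" "smooth_atlas B"
  shows "smooth_map (product_atlas A B) B snd"
  unfolding smooth_map_def product_atlas_def
proof safe
  fix U \<phi> V \<psi> U' \<phi>' assume *: "(U, \<phi>) \<in> A" "(V, \<psi>) \<in> B" "(U', \<phi>') \<in> B"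
  then have c: "is_chart (U, \<phi>)" "is_chart (V, \<psi>)" "is_chart (U', \<phi>')"
    and t: "smooth_on (\<psi> ` (V \<inter> U')) (\<lambda>x. \<phi>' (inv_into V \<psi> x))"
    using assms by (auto simp: smooth_atlas_def charted_def transition_smooth_def)
  have S: "map_prod \<phi> \<psi> ` (U \<times> V \<inter> snd -` U') = \<phi> ` U \<times> \<psi> ` (V \<inter> U')" by auto
  have op: "open (\<psi> ` (V \<inter> U'))" "open (\<phi> ` U)"
    using is_chart_open_image[OF c(2), of "V \<inter> U'"] is_chartD c by auto
  have "smooth_on (\<phi> ` U \<times> \<psi> ` (V \<inter> U')) (\<lambda>z. \<phi>' (inv_into V \<psi> (snd z)))"
    using op by (intro smooth_on_compose[OF t] open_Times smooth_on_bounded_linear[OF _ bounded_linear_snd]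
        smooth_on_id) auto
  then show "smooth_on (map_prod \<phi> \<psi> ` (U \<times> V \<inter> snd -` U'))
      (\<lambda>x. \<phi>' (snd (inv_into (U \<times> V) (map_prod \<phi> \<psi>) x)))"
    unfolding S by (rule smooth_on_cong) (auto simp: op open_Times inv_into_map_prod is_chartD[OF c(1)] is_chartD[OF c(2)])
qed (intro continuous_intros)

lemma smooth_atlas_product:
  assumes A: "smooth_atlas A" and B: "smooth_atlas B"
  shows "smooth_atlas (product_atlas A B)"
proof -
  note ch = smooth_atlas_charted[OF A] smooth_atlas_charted[OF B]
  have P: "charted (product_atlas A B)"
    using ch by (rule charted_product)
  \<comment> \<open>Smoothness of the identity, read in all pairs of charts, is smoothness of the
    transition maps.\<close>
  have "smooth_map (product_atlas A B) (product_atlas A B) (\<lambda>z. (fst z, snd z))"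
    by (intro smooth_map_Pair P ch smooth_map_fst smooth_map_snd assms)
  then show ?thesis
    using P by (auto simp: smooth_map_def smooth_atlas_def charted_def transition_smooth_def)
qed

text \<open>The chart chosen at \<open>(g, h)\<close> may come from other factor charts than those
  chosen at \<open>g\<close> and \<open>h\<close>, so the two components of a vector in the model
  space need not be its projections to the factors. The differentials of projections and inclusions
  supply the splitting independently of that choice.\<close>

lemma tangent_product_decomposition:
  assumes A: "smooth_atlas A" and B: "smooth_atlas B"
  obtains D1 D2 E1 E2 where
    "has_tangent (product_atlas A B) A fst (g, h) D1"
    "has_tangent (product_atlas A B) B snd (g, h) D2"
    "has_tangent A (product_atlas A B) (\<lambda>x. (x, h)) g E1"
    "has_tangent B (product_atlas A B) (\<lambda>y. (g, y)) h E2"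
    "\<And>a b. D1 (E1 a + E2 b) = a" "\<And>a b. D2 (E1 a + E2 b) = b" "\<And>v. E1 (D1 v) + E2 (D2 v) = v"
proof -
  note cA = smooth_atlas_charted[OF A] and cB = smooth_atlas_charted[OF B]
  note cP = charted_product[OF cA cB]
  obtain D1 where D1: "has_tangent (product_atlas A B) A fst (g, h) D1"
    using smooth_map_tangent[OF cP cA smooth_map_fst[OF A cB]] .
  obtain D2 where D2: "has_tangent (product_atlas A B) B snd (g, h) D2"
    using smooth_map_tangent[OF cP cB smooth_map_snd[OF cA B]] .
  obtain E1 where E1: "has_tangent A (product_atlas A B) (\<lambda>x. (x, h)) g E1"
    using smooth_map_tangent[OF cA cP smooth_map_Pair[OF cA cA cB smooth_map_id[OF A] smooth_map_const[OF cA]]] .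
  obtain E2 where E2: "has_tangent B (product_atlas A B) (\<lambda>y. (g, y)) h E2"
    using smooth_map_tangent[OF cB cP smooth_map_Pair[OF cB cA cB smooth_map_const[OF cB] smooth_map_id[OF B]]] .
  note lin = D1[THEN has_tangent_linear] D2[THEN has_tangent_linear]
    E1[THEN has_tangent_linear] E2[THEN has_tangent_linear]
  have "(\<lambda>v. D1 (E1 v)) = (\<lambda>v. v)"
    using has_tangent_compose[OF cA cP E1, of A fst D1] D1 has_tangent_id[OF cA]
    by (intro has_tangent_unique[of A A "\<lambda>x. x" g]) auto
  moreover have "(\<lambda>v. D2 (E1 v)) = (\<lambda>v. 0)"
    using has_tangent_compose[OF cA cP E1, of B snd D2] D2 has_tangent_const
    by (intro has_tangent_unique[of A B "\<lambda>x. h" g]) auto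
  moreover have "(\<lambda>v. D1 (E2 v)) = (\<lambda>v. 0)"
    using has_tangent_compose[OF cB cP E2, of A fst D1] D1 has_tangent_const
    by (intro has_tangent_unique[of B A "\<lambda>x. g" h]) auto
  moreover have "(\<lambda>v. D2 (E2 v)) = (\<lambda>v. v)"
    using has_tangent_compose[OF cB cP E2, of B snd D2] D2 has_tangent_id[OF cB]
    by (intro has_tangent_unique[of B B "\<lambda>x. x" h]) auto
  ultimately have DE: "D1 (E1 a) = a" "D2 (E1 a) = 0" "D1 (E2 b) = 0" "D2 (E2 b) = b" for a b
    by metis+
  have 1: "D1 (E1 a + E2 b) = a" and 2: "D2 (E1 a + E2 b) = b" for a b
    using DE lin by (simp_all add: linear_add)
  \<comment> \<open>The sum of the inclusions has a left inverse; as source and target have the same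
    dimension it is onto, and the left inverse becomes two-sided.\<close>
  have "linear (\<lambda>z. E1 (fst z) + E2 (snd z))"
    by (rule linearI) (simp_all add: linear_add[OF lin(3)] linear_add[OF lin(4)]
        linear_scale[OF lin(3)] linear_scale[OF lin(4)] scaleR_add_right)
  moreover have "inj (\<lambda>z. E1 (fst z) + E2 (snd z))"
    by (rule inj_on_inverseI[where g = "\<lambda>v. (D1 v, D2 v)"]) (simp add: 1 2)
  ultimately have surj: "surj (\<lambda>z. E1 (fst z) + E2 (snd z))"
    by (rule linear_injective_imp_surjective) (rule refl)
  have 3: "E1 (D1 v) + E2 (D2 v) = v" for v
  proof -
    obtain z where z: "v = E1 (fst z) + E2 (snd z)"
      using surjD[OF surj] by blast
    show ?thesis
      unfolding z 1 2 by (rule refl)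
  qed
  show ?thesis
    using D1 D2 E1 E2 1 2 3 by (rule that[of D1 D2 E1 E2])
qed

text \<open>Curves are treated as maps from the manifold \<open>real\<close>.\<close>

abbreviation model_atlas :: "('e, 'e) chart set" where
  "model_atlas \<equiv> {(UNIV, \<lambda>x. x)}"

lemma chart_at_model: "chart_at model_atlas x = (UNIV, \<lambda>x. x)"
  unfolding chart_at_def by (rule some_equality) auto

lemma coord_model [simp]: "coord model_atlas x = (\<lambda>x. x)"
  by (simp add: coord_def chart_at_model)

lemma inv_coord_model [simp]: "inv_coord model_atlas x = (\<lambda>x. x)"
  by (auto simp: inv_coord_def chart_at_model inv_into_def)

lemma charted_model: "charted model_atlas"
  by (auto simp: charted_def is_chart_def homeomorphism_def image_ident inv_into_def)

lemma has_tangent_model: "has_tangent model_atlas model_atlas f x D \<longleftrightarrow> (f has_derivative D) (at x)"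
  using has_derivative_continuous by (auto simp: has_tangent_def)

text \<open>The tangent space at \<open>q\<close> is read in the chart chosen at \<open>q\<close>,
  so a chart chosen at another point is differentiated at \<open>q\<close> as a transition
  map.\<close>

lemma transition_has_derivative:
  assumes A: "smooth_atlas A" and q: "q \<in> dom_at A p" "q \<in> dom_at A r"
  obtains D where "((\<lambda>x. coord A p (inv_coord A r x)) has_derivative D) (at (coord A r q))"
proof -
  have "chart_at A r \<in> A" "chart_at A p \<in> A"
    using chart_at_mem(1)[OF smooth_atlas_charted[OF A]] by auto
  then have "transition_smooth (dom_at A r, coord A r) (dom_at A p, coord A p)"
    using A unfolding smooth_atlas_def chart_at_pair[symmetric] by blast
  then have "smooth_on (coord A r ` (dom_at A r \<inter> dom_at A p)) (\<lambda>x. coord A p (inv_coord A r x))"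
    by (simp add: transition_smooth_def inv_coord_def)
  from smooth_onD[OF this, of "coord A r q"] that show ?thesis
    using q by blast
qed

lemma has_tangent_coord:
  assumes A: "smooth_atlas A" and q: "q \<in> dom_at A p"
  obtains D where "has_tangent A model_atlas (coord A p) q D"
proof -
  obtain D where "((\<lambda>x. coord A p (inv_coord A q x)) has_derivative D) (at (coord A q q))"
    using transition_has_derivative[OF A q chart_at_mem(2)[OF smooth_atlas_charted[OF A]]] .
  then show ?thesis
    using isCont_coord[OF smooth_atlas_charted[OF A] q] that[of D] by (simp add: has_tangent_def)
qed

lemma has_tangent_inv_coord:
  assumes A: "smooth_atlas A" and q: "q \<in> dom_at A p"
  obtains D where "has_tangent model_atlas A (inv_coord A p) (coord A p q) D"
proof -
  note cA = smooth_atlas_charted[OF A]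
  obtain D where "((\<lambda>x. coord A q (inv_coord A p x)) has_derivative D) (at (coord A p q))"
    using transition_has_derivative[OF A chart_at_mem(2)[OF cA] q] .
  then show ?thesis
    using isCont_inv_coord[OF cA imageI[OF q]] inv_coord_coord[OF cA q] that[of D]
    by (simp add: has_tangent_def)
qed

lemma tangent_curve_has_tangent:
  assumes "charted A" "tangent_curve A S p \<gamma> v"
  shows "has_tangent model_atlas A \<gamma> 0 (\<lambda>t. t *\<^sub>R v)" "\<forall>\<^sub>F t in nhds 0. \<gamma> t \<in> S"
proof -
  obtain \<epsilon> where e: "\<gamma> 0 = p" "\<epsilon> > 0" "\<And>t. t \<in> {-\<epsilon><..<\<epsilon>} \<Longrightarrow> \<gamma> t \<in> S \<and> \<gamma> t \<in> dom_at A p"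
    and d: "((\<lambda>t. coord A p (\<gamma> t)) has_vector_derivative v) (at 0)"
    using assms(2) unfolding tangent_curve_def by blast
  have ev: "\<forall>\<^sub>F t in nhds 0. t \<in> {-\<epsilon><..<\<epsilon>}"
    using e(2) by (intro eventually_nhds_in_open) auto
  then show "\<forall>\<^sub>F t in nhds 0. \<gamma> t \<in> S"
    by (rule eventually_mono) (use e(3) in blast)
  \<comment> \<open>The velocity condition only concerns the coordinate expression; continuity of
    \<open>\<gamma>\<close> itself is recovered through the inverse chart, because
    \<open>\<gamma>\<close> stays in the chart domain near time 0.\<close>
  have "isCont (\<lambda>t. inv_coord A p (coord A p (\<gamma> t))) 0"
  proof (rule isCont_o2[OF has_vector_derivative_continuous[OF d]])
    show "isCont (inv_coord A p) (coord A p (\<gamma> 0))"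
      using isCont_inv_coord[OF assms(1) coord_at_mem[OF assms(1)]] e(1) by simp
  qed
  moreover have "\<forall>\<^sub>F t in nhds 0. inv_coord A p (coord A p (\<gamma> t)) = \<gamma> t"
    using ev by (rule eventually_mono) (use e(3) inv_coord_coord[OF assms(1)] in blast)
  ultimately have "isCont \<gamma> 0"
    by (rule isCont_cong[THEN iffD1, rotated])
  then show "has_tangent model_atlas A \<gamma> 0 (\<lambda>t. t *\<^sub>R v)"
    using d e(1) by (simp add: has_tangent_def has_vector_derivative_def)
qed

section \<open>Level sets are embedded submanifolds\<close>

text \<open>The slice chart is \<open>\<eta>\<close> followed by the straightening map
  \<open>\<Theta>\<close>, which carries the zero set to a linear subspace. Smoothness of
  \<open>\<Theta>\<close> and of its inverse makes this chart compatible with every chart of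
  \<open>A\<close>.\<close>

lemma level_set_slice_chart:
  fixes A :: "('m::{second_countable_topology, t2_space}, 'e::euclidean_space) chart set"
    and \<Phi> :: "'e \<Rightarrow> 'b::euclidean_space"
  assumes A: "smooth_atlas A" and W: "(W, \<eta>) \<in> A" and N: "open N" "p \<in> N" "N \<subseteq> W"
    and \<Phi>: "smooth_on (\<eta> ` N) \<Phi>" "(\<Phi> has_derivative D) (at (\<eta> p))" "surj D"
    and S: "\<And>q. q \<in> N \<Longrightarrow> q \<in> S \<longleftrightarrow> \<Phi> (\<eta> q) = 0"
  shows "\<exists>(U, \<phi>)\<in>maximal_atlas A. p \<in> U \<and>
    (\<exists>L. subspace L \<and> dim L + DIM('b) = DIM('e) \<and> \<phi> ` (U \<inter> S) = \<phi> ` U \<inter> L)"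
proof -
  have cW: "is_chart (W, \<eta>)"
    using A W by (auto simp: smooth_atlas_def)
  note ch = is_chartD[OF cW]
  have X: "open (\<eta> ` N)"
    using is_chart_open_image[OF cW N(1,3)] .
  obtain U0 V0 and \<Theta> :: "'e \<Rightarrow> 'e" and g L where
    U0: "open U0" "\<eta> p \<in> U0" "U0 \<subseteq> \<eta> ` N" and V0: "open V0" and hom: "homeomorphism U0 V0 \<Theta> g"
    and \<Theta>: "smooth_on U0 \<Theta>" and g: "smooth_on V0 g"
    and L: "subspace L" "dim L + DIM('b) = DIM('e)" "\<And>x. \<Phi> x = 0 \<longleftrightarrow> \<Theta> x \<in> L"
    using submersion_slice[OF X \<Phi>(1) _ \<Phi>(2,3)] N(2) by (metis imageI)
  define U where "U = W \<inter> \<eta> -` U0"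
  define \<phi> where "\<phi> = (\<lambda>q. \<Theta> (\<eta> q))"
  have U: "open U"
    unfolding U_def using ch(4,1) U0(1) by (rule continuous_open_preimage)
  have UN: "U \<subseteq> N" and UW: "U \<subseteq> W"
    using U0(3) ch(3) N(3) by (auto simp: U_def dest: inj_onD)
  have \<eta>U: "\<eta> ` U = U0"
    using U0(3) N(3) unfolding U_def by blast
  have homU: "homeomorphism U U0 \<eta> (inv_into W \<eta>)"
    by (rule homeomorphism_of_subsets[OF ch(6) UW subset_refl \<eta>U])
  have hom2: "homeomorphism U V0 \<phi> (inv_into W \<eta> \<circ> g)"
    using homeomorphism_compose[OF homU hom] by (simp add: \<phi>_def comp_def)
  have \<phi>U: "\<phi> ` U = V0"
    using hom2 by (simp add: homeomorphism_def)
  have inj: "inj_on \<phi> U"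
    using hom2 by (auto simp: homeomorphism_def intro: inj_on_inverseI)
  have inv: "inv_into U \<phi> y = inv_into W \<eta> (g y)" if "y \<in> V0" for y
  proof -
    have "inv_into W \<eta> (g y) \<in> U" "\<phi> (inv_into W \<eta> (g y)) = y"
      using hom2 that by (auto simp: homeomorphism_def)
    then show ?thesis
      using inv_into_f_f[OF inj] by metis
  qed
  have chart: "is_chart (U, \<phi>)"
  proof -
    have "homeomorphism U V0 \<phi> (inv_into U \<phi>)"
      by (rule homeomorphism_cong[OF hom2]) (simp_all add: inv)
    then show ?thesis
      using U V0 by (simp add: is_chart_def \<phi>U)
  qed
  have "transition_smooth (U, \<phi>) d \<and> transition_smooth d (U, \<phi>)" if d: "d \<in> A" for d
  proof -
    obtain V \<psi> where V: "d = (V, \<psi>)" by force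
    have cV: "is_chart (V, \<psi>)" and
      t: "smooth_on (\<eta> ` (W \<inter> V)) (\<lambda>x. \<psi> (inv_into W \<eta> x))"
        "smooth_on (\<psi> ` (V \<inter> W)) (\<lambda>x. \<eta> (inv_into V \<psi> x))"
      using A W d V by (auto simp: smooth_atlas_def transition_smooth_def)
    have op: "open (\<phi> ` (U \<inter> V))" "open (\<psi> ` (V \<inter> U))" "open (\<eta> ` (W \<inter> V))"
      using is_chart_open_image[OF chart, of "U \<inter> V"] is_chart_open_image[OF cV, of "V \<inter> U"]
        is_chart_open_image[OF cW, of "W \<inter> V"] U is_chartD(1)[OF cV] ch(1) by auto
    have "smooth_on (\<phi> ` (U \<inter> V)) (\<lambda>x. \<psi> (inv_into W \<eta> (g x)))"
    proof (rule smooth_on_compose[OF t(1) smooth_on_subset[OF g] op(1,3)])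
      show "\<phi> ` (U \<inter> V) \<subseteq> V0"
        using \<phi>U by blast
      have "g (\<phi> q) = \<eta> q" if "q \<in> U" for q
        using hom \<eta>U that by (auto simp: homeomorphism_def \<phi>_def)
      then show "g ` \<phi> ` (U \<inter> V) \<subseteq> \<eta> ` (W \<inter> V)"
        using UW by auto
    qed
    then have "smooth_on (\<phi> ` (U \<inter> V)) (\<lambda>x. \<psi> (inv_into U \<phi> x))"
      by (rule smooth_on_cong[OF _ op(1)]) (use inv \<phi>U in auto)
    moreover have "smooth_on (\<psi> ` (V \<inter> U)) (\<lambda>x. \<Theta> (\<eta> (inv_into V \<psi> x)))"
      using is_chartD(3)[OF cV] UW \<eta>U
      by (intro smooth_on_compose[OF \<Theta> smooth_on_subset[OF t(2)] op(2) U0(1)]) auto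
    ultimately show ?thesis
      by (simp add: V transition_smooth_def \<phi>_def)
  qed
  then have "(U, \<phi>) \<in> maximal_atlas A"
    using chart by (simp add: maximal_atlas_def)
  moreover have "\<phi> ` (U \<inter> S) = \<phi> ` U \<inter> L"
  proof -
    have "q \<in> S \<longleftrightarrow> \<phi> q \<in> L" if "q \<in> U" for q
      using S[OF subsetD[OF UN that]] L(3)[of "\<eta> q"] by (simp add: \<phi>_def)
    then show ?thesis by blast
  qed
  moreover have "p \<in> U"
    using N U0(2) unfolding U_def by blast
  ultimately show ?thesis
    using L(1,2) by blast
qed

section \<open>Pairs of commuting isometries\<close>

text \<open>\<open>S'\<close> and \<open>T'\<close> are carried as explicit inverses; for isometries
  they are also the adjoints, so every operator can be moved to one side of
  \<open>ip\<close>.\<close>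

locale commuting_isometries =
  fixes ip :: "'e::real_vector \<Rightarrow> 'e \<Rightarrow> real" and S S' T T' :: "'e \<Rightarrow> 'e"
  assumes ip: "is_inner_product ip"
    and lin: "linear S" "linear S'" "linear T" "linear T'"
    and inverse: "S (S' x) = x" "S' (S x) = x" "T (T' x) = x" "T' (T x) = x"
    and isometry: "ip (S x) (S y) = ip x y" "ip (T x) (T y) = ip x y"
    and commute: "T (S x) = S (T x)"
begin

lemma linear_ip: "linear (ip x)"
  using ip by (simp add: is_inner_product_def)

lemma ip_sym: "ip x y = ip y x"
  using ip by (simp add: is_inner_product_def)

lemma ip_right: "ip x (y + z) = ip x y + ip x z" "ip x (y - z) = ip x y - ip x z" "ip x (- y) = - ip x y"
  using linear_add[OF linear_ip] linear_diff[OF linear_ip] linear_neg[OF linear_ip] by auto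

lemma ip_left: "ip (y + z) x = ip y x + ip z x" "ip (y - z) x = ip y x - ip z x" "ip (- y) x = - ip y x"
  using ip_right ip_sym by metis+

lemma ip_zero: "(\<And>y. ip y x = 0) \<Longrightarrow> x = 0"
  using ip unfolding is_inner_product_def by force

lemma adjoint:
  "ip (S x) y = ip x (S' y)" "ip (S' x) y = ip x (S y)" "ip (T x) y = ip x (T' y)" "ip (T' x) y = ip x (T y)"
  using isometry inverse by metis+

lemma commutes:
  "T (S' x) = S' (T x)" "T' (S x) = S (T' x)" "T' (S' x) = S' (T' x)"
  using commute inverse by metis+

lemmas lin_simps = lin[THEN linear_add] lin[THEN linear_diff] lin[THEN linear_neg]

text \<open>With \<open>(a, b)\<close> and \<open>(a', b')\<close> the left-trivialized components
  of two tangent vectors, \<open>form a b a' b' - form a' b' a b\<close> is twice the two-form of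
  the double; the three summands correspond to its three pairings.\<close>

definition form :: "'e \<Rightarrow> 'e \<Rightarrow> 'e \<Rightarrow> 'e \<Rightarrow> real" where
  "form a b a' b' = ip a (T' b') + ip (S' a) b' - ip (T a + b) (a' + S b')"

lemma form_nondegenerate:
  assumes "\<And>a' b'. form a b a' b' - form a' b' a b = 0"
  shows "a = 0" "b = 0"
proof -
  \<comment> \<open>\<open>X\<close> and \<open>Z\<close> represent the antisymmetrized form against
    \<open>(a', 0)\<close> and \<open>(0, b')\<close>: all operators are moved off \<open>a'\<close>
    and \<open>b'\<close> by taking adjoints. They are the two rows of the block matrix applied to
    \<open>(a, b)\<close>.\<close>
  define X where "X = T' a - T a - T' b - S b - b + S (T' b)"
  define Z where "Z = T a + S' a - S' (T a) + a - S' b + S b"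
  have four: "c = 0" if "c + c + c + c = 0" for c :: 'e
  proof -
    have "(1 + 1 + 1 + 1 :: real) *\<^sub>R c = c + c + c + c"
      by (simp only: scaleR_add_left scaleR_one)
    then show ?thesis
      using that by simp
  qed
  have "ip a' X = 0" for a'
    using assms[of a' 0] linear_0[OF linear_ip] ip_sym[of 0]
    by (simp add: form_def X_def lin[THEN linear_0] ip_left ip_right adjoint lin_simps commutes
        ip_sym[of b a'] ip_sym[of a "T' a'"] ip_sym[of a "T a'"] ip_sym[of a a'])
  then have X: "X = 0"
    by (rule ip_zero)
  have "ip b' Z = 0" for b'
    using assms[of 0 b'] linear_0[OF linear_ip] ip_sym[of 0]
    by (simp add: form_def Z_def lin[THEN linear_0] ip_left ip_right adjoint lin_simps commutes
        ip_sym[of b "S b'"] ip_sym[of a "T' b'"] ip_sym[of a "S b'"] ip_sym[of a "S (T' b')"])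
  then have Z: "Z = 0"
    by (rule ip_zero)
  text \<open>The block matrix of the form has commuting entries and its determinant is \<open>4\<close>; its
    adjugate gives both components.\<close>
  have "a + a + a + a = S X - S' X + T' Z + S Z + Z - S (T' Z)"
    by (simp add: X_def Z_def lin_simps commute commutes inverse)
  then have "a + a + a + a = 0"
    using X Z lin[THEN linear_0] by simp
  then show "a = 0"
    by (rule four)
  have "T' Z = a + S' (T' a) - S' a + T' a - S' (T' b) + S (T' b)"
    "T Z = T (T a) + S' (T a) - S' (T (T a)) + T a - S' (T b) + S (T b)"
    "T X = a - T (T a) - b - S (T b) - T b + S b"
    "S' X = S' (T' a) - S' (T a) - S' (T' b) - b - S' b + T' b"
    "S' (T X) = S' a - S' (T (T a)) - S' b - T b - S' (T b) + b"
    by (simp_all only: X_def Z_def lin_simps commute commutes inverse)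
  then have "b + b + b + b = T' Z - T Z - T X - S' X + S' (T X) - X"
    by (simp only: X_def) (simp only: algebra_simps)
  then have "b + b + b + b = 0"
    using X Z lin[THEN linear_0] by simp
  then show "b = 0"
    by (rule four)
qed

text \<open>On these vectors \<open>T a + b\<close> and \<open>a + S b\<close> are the same vector
  \<open>S (T \<xi>) - \<xi> + \<kappa>\<close>, so the last summand of \<open>form\<close> is
  symmetric in the two arguments. The other two reduce to a symmetric form \<open>q\<close> in \<xi>
  and \<xi>', and antisymmetrizing kills everything.\<close>

lemma form_isotropic:
  assumes \<kappa>: "T \<kappa> = \<kappa>" and ab: "a = S \<xi> - \<xi> + \<kappa>" "b = T \<xi> - \<xi>"
    and \<kappa>': "T \<kappa>' = \<kappa>'" and ab': "a' = S \<xi>' - \<xi>' + \<kappa>'" "b' = T \<xi>' - \<xi>'"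
  shows "form a b a' b' - form a' b' a b = 0"
proof -
  \<comment> \<open>The operator behind \<open>q\<close> is S + S' + T + T' - S' T' - S T - 2, in
    which every term occurs together with its adjoint; hence the symmetry.\<close>
  define q where "q x y = ip x (S y) + ip x (S' y) + ip x (T y) + ip x (T' y)
    - ip x (S' (T' y)) - ip x (S (T y)) - 2 * ip x y" for x y
  have q_sym: "q x y = q y x" for x y
    using adjoint ip_sym commute commutes unfolding q_def by smt
  define X where "X x k = S (T x) - x + k" for x k
  have *: "form (S x - x + k) (T x - x) (S x' - x' + k') (T x' - x') = q x x' - ip (X x k) (X x' k')"
    if k: "T k = k" and k': "T k' = k'" for x k x' k'
  proof -
    have "T' k = k"
      using k inverse by metis
    then have "ip k (T' y) = ip k y" "ip k (T y) = ip k y" for y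
      using k adjoint by metis+
    then have k0: "ip k (T' (T x' - x')) + ip (S' k) (T x' - x') = 0"
      by (simp add: lin_simps inverse ip_right adjoint flip: commute)
    have "T (S x - x + k) + (T x - x) = X x k" "S x' - x' + k' + S (T x' - x') = X x' k'"
      using k by (simp_all add: X_def lin_simps commute)
    then have "form (S x - x + k) (T x - x) (S x' - x' + k') (T x' - x')
        = ip (S x - x) (T' (T x' - x')) + ip (S' (S x - x)) (T x' - x')
          + (ip k (T' (T x' - x')) + ip (S' k) (T x' - x')) - ip (X x k) (X x' k')"
      unfolding form_def by (simp add: lin_simps ip_left)
    also have "\<dots> = q x x' - ip (X x k) (X x' k')"
      unfolding k0 by (simp add: q_def lin_simps inverse ip_left ip_right adjoint commute commutes)
    finally show ?thesis .
  qed
  show ?thesis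
    unfolding ab ab' *[OF \<kappa> \<kappa>'] *[OF \<kappa>' \<kappa>] using q_sym[of \<xi> \<xi>'] ip_sym[of "X \<xi> \<kappa>"] by simp
qed

end

section \<open>Logarithmic derivatives on a Lie group\<close>

context lie_group
begin

lemma in_carrier [simp]: "x \<in> carrier G"
  by (simp add: carrier_eq_UNIV)

lemma mult_cancel [simp]: "inv x \<otimes> (x \<otimes> y) = y" "x \<otimes> (inv x \<otimes> y) = y"
  by (simp_all flip: m_assoc)

lemma charted: "charted A"
  using atlas by (rule smooth_atlas_charted)

lemma charted_square: "charted (product_atlas A A)"
  using charted charted by (rule charted_product)

lemma smooth_map_mult:
  assumes M: "charted M" and f: "smooth_map M A f" and k: "smooth_map M A k"
  shows "smooth_map M A (\<lambda>x. f x \<otimes> k x)"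
  using smooth_map_compose[OF M charted_square charted
      smooth_map_Pair[OF M charted charted f k] smooth_mult] by simp

lemma smooth_map_inverse:
  assumes M: "charted M" and f: "smooth_map M A f"
  shows "smooth_map M A (\<lambda>x. inv (f x))"
  using smooth_map_compose[OF M charted charted f smooth_inv] .

lemmas smooth_group_intros = smooth_map_mult smooth_map_inverse smooth_map_id[OF atlas]
  smooth_map_const charted charted_square smooth_map_fst[OF atlas charted] smooth_map_snd[OF charted atlas]

text \<open>Along each axis through \<open>(\<one>, \<one>)\<close> multiplication is the identity,
  so its differential there is addition. Other base points are reduced to this one by translating
  and conjugating.\<close>

lemma has_tangent_mult_one:
  assumes M: "charted M" and f: "smooth_map M A f" "has_tangent M A f p D" "f p = \<one>"
    and k: "smooth_map M A k" "has_tangent M A k p E" "k p = \<one>"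
  shows "has_tangent M A (\<lambda>x. f x \<otimes> k x) p (\<lambda>v. D v + E v)"
proof -
  let ?P = "product_atlas A A"
  obtain D1 D2 E1 E2 where
    D1: "has_tangent ?P A fst (\<one>, \<one>) D1" and D2: "has_tangent ?P A snd (\<one>, \<one>) D2"
    and E1: "has_tangent A ?P (\<lambda>x. (x, \<one>)) \<one> E1" and E2: "has_tangent A ?P (\<lambda>y. (\<one>, y)) \<one> E2"
    and "\<And>a b. D1 (E1 a + E2 b) = a" "\<And>a b. D2 (E1 a + E2 b) = b"
    and dec: "\<And>v. E1 (D1 v) + E2 (D2 v) = v"
    by (rule tangent_product_decomposition[OF atlas atlas, of "\<one>" "\<one>"]) (rule that; assumption)
  obtain Q where Q: "has_tangent M ?P (\<lambda>x. (f x, k x)) p Q"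
    using smooth_map_tangent[OF M charted_square smooth_map_Pair[OF M charted charted f(1) k(1)]] .
  have "smooth_map ?P A (\<lambda>z. fst z \<otimes> snd z)"
    by (intro smooth_group_intros)
  then obtain m where m: "has_tangent ?P A (\<lambda>z. fst z \<otimes> snd z) (\<one>, \<one>) m"
    using smooth_map_has_tangent[OF charted_square charted] by blast
  note lin = has_tangent_linear[OF m]
  have "(\<lambda>v. D1 (Q v)) = D"
    using has_tangent_compose[OF M charted_square Q, of A fst D1] D1 f
    by (intro has_tangent_unique[of M A f p]) (simp_all add: k(3))
  moreover have "(\<lambda>v. D2 (Q v)) = E"
    using has_tangent_compose[OF M charted_square Q, of A snd D2] D2 k
    by (intro has_tangent_unique[of M A k p]) (simp_all add: f(3))
  ultimately have Q': "Q v = E1 (D v) + E2 (E v)" for v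
    using dec[of "Q v"] by metis
  have "(\<lambda>v. m (E1 v)) = (\<lambda>v. v)"
    using has_tangent_compose[OF charted charted_square E1 m]
    by (intro has_tangent_unique[of A A "\<lambda>x. x" "\<one>"] has_tangent_id charted) simp
  moreover have "(\<lambda>v. m (E2 v)) = (\<lambda>v. v)"
    using has_tangent_compose[OF charted charted_square E2 m]
    by (intro has_tangent_unique[of A A "\<lambda>x. x" "\<one>"] has_tangent_id charted) simp
  ultimately have "m (Q v) = D v + E v" for v
    unfolding Q' linear_add[OF lin] by metis
  moreover have "has_tangent M A (\<lambda>x. f x \<otimes> k x) p (\<lambda>v. m (Q v))"
    using has_tangent_compose[OF M charted_square Q, of A "\<lambda>z. fst z \<otimes> snd z" m] m f(3) k(3) by simp
  ultimately show ?thesis by simp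
qed

lemma has_tangent_inv_one:
  assumes M: "charted M" and f: "smooth_map M A f" "has_tangent M A f p D" "f p = \<one>"
  shows "has_tangent M A (\<lambda>x. inv (f x)) p (\<lambda>v. - D v)"
proof -
  have s: "smooth_map M A (\<lambda>x. inv (f x))"
    by (intro smooth_group_intros M f)
  obtain E where E: "has_tangent M A (\<lambda>x. inv (f x)) p E"
    using smooth_map_tangent[OF M charted s] .
  have "has_tangent M A (\<lambda>x. f x \<otimes> inv (f x)) p (\<lambda>v. D v + E v)"
    using has_tangent_mult_one[OF M f s E] f(3) by simp
  then have "(\<lambda>v. D v + E v) = (\<lambda>v. 0)"
    by (intro has_tangent_unique[OF _ has_tangent_const[of M A "\<one>"]]) simp
  then have "E = (\<lambda>v. - D v)"
    by (metis (no_types) add_eq_0_iff)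
  then show ?thesis
    using E by simp
qed

section \<open>The adjoint representation\<close>

lemma has_tangent_Ad: "has_tangent A A (\<lambda>y. x \<otimes> y \<otimes> inv x) \<one> (Ad G A x)"
  unfolding Ad_def by (intro smooth_map_has_tangent charted smooth_group_intros)

lemma linear_Ad: "linear (Ad G A x)"
  using has_tangent_Ad by (rule has_tangent_linear)

lemma has_tangent_conj:
  assumes M: "charted M" and f: "has_tangent M A f p D" "f p = \<one>"
  shows "has_tangent M A (\<lambda>y. x \<otimes> f y \<otimes> inv x) p (\<lambda>v. Ad G A x (D v))"
  using has_tangent_compose[OF M charted f(1), of A "\<lambda>y. x \<otimes> y \<otimes> inv x" "Ad G A x"]
    has_tangent_Ad f(2) by simp

lemma Ad_one: "Ad G A \<one> v = v"
proof -
  have "Ad G A \<one> = (\<lambda>v. v)"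
    using has_tangent_Ad[of "\<one>"]
    by (intro has_tangent_unique[OF _ has_tangent_id[OF charted, of "\<one>"]]) simp
  then show ?thesis by simp
qed

lemma Ad_mult: "Ad G A (x \<otimes> y) v = Ad G A x (Ad G A y v)"
proof -
  have "has_tangent A A (\<lambda>z. x \<otimes> (y \<otimes> z \<otimes> inv y) \<otimes> inv x) \<one> (\<lambda>v. Ad G A x (Ad G A y v))"
    by (rule has_tangent_conj[OF charted has_tangent_Ad]) simp
  moreover have "x \<otimes> (y \<otimes> z \<otimes> inv y) \<otimes> inv x = (x \<otimes> y) \<otimes> z \<otimes> inv (x \<otimes> y)" for z
    by (simp add: m_assoc inv_mult_group)
  ultimately have "Ad G A (x \<otimes> y) = (\<lambda>v. Ad G A x (Ad G A y v))"
    using has_tangent_unique[OF has_tangent_Ad] by simp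
  then show ?thesis by simp
qed

lemma Ad_inverse: "Ad G A (inv x) (Ad G A x v) = v" "Ad G A x (Ad G A (inv x) v) = v"
  by (simp_all add: Ad_one flip: Ad_mult)

text \<open>\<open>log_deriv M f p d\<close> says that \<open>d\<close> is the pullback \<open>f\<^sup>*\<theta>\<^sup>L\<close> at \<open>p\<close>.\<close>

definition log_deriv where
  "log_deriv M f p d \<longleftrightarrow> smooth_map M A f \<and> has_tangent M A (\<lambda>x. inv (f p) \<otimes> f x) p d"

lemma log_derivI:
  assumes "charted M" "smooth_map M A f"
  shows "log_deriv M f p (\<lambda>v. theta_L G A (f p) (tangent_map M A f p v))"
proof -
  have "has_tangent A A (\<lambda>x. inv (f p) \<otimes> x) (f p) (theta_L G A (f p))"
    unfolding theta_L_def by (intro smooth_map_has_tangent charted smooth_group_intros)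
  from has_tangent_compose[OF assms(1) charted smooth_map_has_tangent[OF assms(1) charted assms(2)] this]
  show ?thesis
    using assms(2) by (simp add: log_deriv_def)
qed

lemma log_deriv_unique:
  "log_deriv M f p d \<Longrightarrow> log_deriv M f p e \<Longrightarrow> d = e"
  using has_tangent_unique unfolding log_deriv_def by blast

lemma log_deriv_theta_L:
  "charted M \<Longrightarrow> log_deriv M f p d \<Longrightarrow> theta_L G A (f p) (tangent_map M A f p v) = d v"
  using log_deriv_unique[OF log_derivI] unfolding log_deriv_def by metis

text \<open>\<open>f x \<otimes> inv (f p)\<close> is the conjugate of
  \<open>inv (f p) \<otimes> f x\<close> by \<open>f p\<close>, so the right and left logarithmic
  derivatives differ by \<open>Ad G A (f p)\<close>.\<close>

lemma log_deriv_theta_R: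
  assumes M: "charted M" and f: "log_deriv M f p d"
  shows "theta_R G A (f p) (tangent_map M A f p v) = Ad G A (f p) (d v)"
proof -
  have s: "smooth_map M A f" and t: "has_tangent M A (\<lambda>x. inv (f p) \<otimes> f x) p d"
    using f by (auto simp: log_deriv_def)
  have "has_tangent A A (\<lambda>x. x \<otimes> inv (f p)) (f p) (theta_R G A (f p))"
    unfolding theta_R_def by (intro smooth_map_has_tangent charted smooth_group_intros)
  from has_tangent_compose[OF M charted smooth_map_has_tangent[OF M charted s] this]
  have "has_tangent M A (\<lambda>x. f x \<otimes> inv (f p)) p (\<lambda>v. theta_R G A (f p) (tangent_map M A f p v))" .
  moreover have "has_tangent M A (\<lambda>x. f p \<otimes> (inv (f p) \<otimes> f x) \<otimes> inv (f p)) p (\<lambda>v. Ad G A (f p) (d v))"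
    by (rule has_tangent_conj[OF M t]) simp
  ultimately have "(\<lambda>v. theta_R G A (f p) (tangent_map M A f p v)) = (\<lambda>v. Ad G A (f p) (d v))"
    by (intro has_tangent_unique) simp_all
  then show ?thesis
    by metis
qed

lemma log_deriv_const: "charted M \<Longrightarrow> log_deriv M (\<lambda>x. c) p (\<lambda>v. 0)"
  by (simp add: log_deriv_def has_tangent_const smooth_map_const)

text \<open>\<open>inv (f p \<otimes> k p) \<otimes> (f x \<otimes> k x)\<close> is the conjugate of
  \<open>inv (f p) \<otimes> f x\<close> by \<open>inv (k p)\<close>, times
  \<open>inv (k p) \<otimes> k x\<close>. Both factors equal \<open>\<one>\<close> at
  \<open>p\<close>, where multiplication differentiates to addition.\<close>

lemma log_deriv_mult:
  assumes M: "charted M" and f: "log_deriv M f p d" and k: "log_deriv M k p e"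
  shows "log_deriv M (\<lambda>x. f x \<otimes> k x) p (\<lambda>v. Ad G A (inv (k p)) (d v) + e v)"
proof -
  let ?f = "\<lambda>x. inv (k p) \<otimes> (inv (f p) \<otimes> f x) \<otimes> inv (inv (k p))" and ?k = "\<lambda>x. inv (k p) \<otimes> k x"
  have s: "smooth_map M A f" "smooth_map M A k"
    and t: "has_tangent M A (\<lambda>x. inv (f p) \<otimes> f x) p d" "has_tangent M A ?k p e"
    using f k by (auto simp: log_deriv_def)
  have "has_tangent M A ?f p (\<lambda>v. Ad G A (inv (k p)) (d v))"
    by (rule has_tangent_conj[OF M t(1)]) simp
  then have "has_tangent M A (\<lambda>x. ?f x \<otimes> ?k x) p (\<lambda>v. Ad G A (inv (k p)) (d v) + e v)"
    using t(2) by (intro has_tangent_mult_one M smooth_group_intros s) simp_all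
  moreover have "?f x \<otimes> ?k x = inv (f p \<otimes> k p) \<otimes> (f x \<otimes> k x)" for x
    by (simp add: m_assoc inv_mult_group)
  ultimately show ?thesis
    using smooth_map_mult[OF M s] by (simp add: log_deriv_def)
qed

lemma log_deriv_inverse:
  assumes M: "charted M" and f: "log_deriv M f p d"
  shows "log_deriv M (\<lambda>x. inv (f x)) p (\<lambda>v. - Ad G A (f p) (d v))"
proof -
  have s: "smooth_map M A f" and t: "has_tangent M A (\<lambda>x. inv (f p) \<otimes> f x) p d"
    using f by (auto simp: log_deriv_def)
  have "has_tangent M A (\<lambda>x. inv (inv (f p) \<otimes> f x)) p (\<lambda>v. - d v)"
    by (intro has_tangent_inv_one M t smooth_group_intros s) simp
  then have "has_tangent M A (\<lambda>x. f p \<otimes> inv (inv (f p) \<otimes> f x) \<otimes> inv (f p)) p (\<lambda>v. Ad G A (f p) (- d v))"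
    by (intro has_tangent_conj M) simp_all
  moreover have "f p \<otimes> inv (inv (f p) \<otimes> f x) \<otimes> inv (f p) = inv (inv (f p)) \<otimes> inv (f x)" for x
    by (simp add: m_assoc inv_mult_group)
  ultimately show ?thesis
    using smooth_map_inverse[OF M s] linear_neg[OF linear_Ad] by (simp add: log_deriv_def)
qed

lemma theta_L_inverse:
  obtains K where "linear K" "\<And>v. K (theta_L G A g v) = v" "\<And>v. theta_L G A g (K v) = v"
proof -
  have L: "has_tangent A A (\<lambda>x. inv g \<otimes> x) g (theta_L G A g)"
    unfolding theta_L_def by (intro smooth_map_has_tangent charted smooth_group_intros)
  have "smooth_map A A (\<lambda>x. g \<otimes> x)"
    by (intro smooth_group_intros)
  then obtain K where K: "has_tangent A A (\<lambda>x. g \<otimes> x) \<one> K"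
    using smooth_map_has_tangent[OF charted charted] by blast
  have "(\<lambda>v. K (theta_L G A g v)) = (\<lambda>v. v)"
    using has_tangent_compose[OF charted charted L, of A "\<lambda>x. g \<otimes> x" K] K
    by (intro has_tangent_unique[OF _ has_tangent_id[OF charted, of g]]) simp
  moreover have "(\<lambda>v. theta_L G A g (K v)) = (\<lambda>v. v)"
    using has_tangent_compose[OF charted charted K, of A "\<lambda>x. inv g \<otimes> x" "theta_L G A g"] L
    by (intro has_tangent_unique[OF _ has_tangent_id[OF charted, of "\<one>"]]) simp
  ultimately show ?thesis
    using that has_tangent_linear[OF K] by metis
qed

section \<open>The two-form of the double in a left trivialization\<close>

definition left_fst :: "'g \<times> 'g \<Rightarrow> 'e \<times> 'e \<Rightarrow> 'e" where
  "left_fst p v = theta_L G A (fst p) (tangent_map (product_atlas A A) A fst p v)"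

definition left_snd :: "'g \<times> 'g \<Rightarrow> 'e \<times> 'e \<Rightarrow> 'e" where
  "left_snd p v = theta_L G A (snd p) (tangent_map (product_atlas A A) A snd p v)"

lemma log_deriv_fst: "log_deriv (product_atlas A A) fst p (left_fst p)"
  unfolding left_fst_def by (intro log_derivI smooth_group_intros)

lemma log_deriv_snd: "log_deriv (product_atlas A A) snd p (left_snd p)"
  unfolding left_snd_def by (intro log_derivI smooth_group_intros)

text \<open>The product splitting and \<open>theta_L\<close> are both invertible. Surjectivity lets
  the second argument of the two-form run over all pairs \<open>(a', b')\<close>; injectivity
  carries \<open>a = 0\<close>, \<open>b = 0\<close> back to the tangent vector.\<close>

lemma left_trivialization_surj: "\<exists>v. left_fst p v = a \<and> left_snd p v = b"
  and left_trivialization_inj: "left_fst p v = 0 \<Longrightarrow> left_snd p v = 0 \<Longrightarrow> v = 0"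
proof -
  obtain g h where p: "p = (g, h)" by force
  obtain D1 D2 E1 E2 where
    D: "has_tangent (product_atlas A A) A fst (g, h) D1" "has_tangent (product_atlas A A) A snd (g, h) D2"
    and E: "has_tangent A (product_atlas A A) (\<lambda>x. (x, h)) g E1"
      "has_tangent A (product_atlas A A) (\<lambda>y. (g, y)) h E2"
    and DE: "\<And>a b. D1 (E1 a + E2 b) = a" "\<And>a b. D2 (E1 a + E2 b) = b" "\<And>v. E1 (D1 v) + E2 (D2 v) = v"
    by (rule tangent_product_decomposition[OF atlas atlas, of g h]) (rule that; assumption)
  obtain K where K: "linear K" "\<And>v. K (theta_L G A g v) = v" "\<And>v. theta_L G A g (K v) = v"
    by (rule theta_L_inverse[of g]) (rule that; assumption)
  obtain L where L: "linear L" "\<And>v. L (theta_L G A h v) = v" "\<And>v. theta_L G A h (L v) = v"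
    by (rule theta_L_inverse[of h]) (rule that; assumption)
  have eq: "left_fst p v = theta_L G A g (D1 v)" "left_snd p v = theta_L G A h (D2 v)" for v
    using D[THEN tangent_map_eq] by (simp_all add: left_fst_def left_snd_def p)
  show "\<exists>v. left_fst p v = a \<and> left_snd p v = b"
    by (rule exI[of _ "E1 (K a) + E2 (L b)"]) (simp add: eq DE K L)
  assume "left_fst p v = 0" "left_snd p v = 0"
  then have "D1 v = 0" "D2 v = 0"
    using K(2)[of "D1 v"] L(2)[of "D2 v"] linear_0[OF K(1)] linear_0[OF L(1)] by (simp_all add: eq)
  then show "v = 0"
    using DE(3)[of v] E[THEN has_tangent_linear, THEN linear_0] by simp
qed

text \<open>The logarithmic product and inverse rules express every pullback through the two left
  components. Commutation of \<open>g\<close> and \<open>h\<close> makes the adjoint operators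
  commute; the minus sign in \<open>form\<close> comes from the pullback of \<open>theta_R\<close>
  along the product of inverses, which is \<open>- (a + S b)\<close>.\<close>

lemma omega_double_left:
  assumes ip: "is_inner_product ip"
    and inv: "\<And>g X Y. ip (Ad G A g X) (Ad G A g Y) = ip X Y"
    and comm: "g \<otimes> h = h \<otimes> g"
  defines "F \<equiv> commuting_isometries.form ip (Ad G A (inv g)) (Ad G A g) (Ad G A (inv h)) (Ad G A h)"
  shows "commuting_isometries ip (Ad G A (inv g)) (Ad G A g) (Ad G A (inv h)) (Ad G A h)"
    "omega_double G A ip (g, h) v w = 1/2 *
      (F (left_fst (g, h) v) (left_snd (g, h) v) (left_fst (g, h) w) (left_snd (g, h) w)
       - F (left_fst (g, h) w) (left_snd (g, h) w) (left_fst (g, h) v) (left_snd (g, h) v))"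
proof -
  have swap: "inv h \<otimes> inv g = inv g \<otimes> inv h"
    using comm by (simp flip: inv_mult_group)
  show ci: "commuting_isometries ip (Ad G A (inv g)) (Ad G A g) (Ad G A (inv h)) (Ad G A h)"
  proof (rule commuting_isometries.intro)
    show "Ad G A (inv h) (Ad G A (inv g) x) = Ad G A (inv g) (Ad G A (inv h) x)" for x
      unfolding Ad_mult[symmetric] swap ..
  qed (rule ip linear_Ad Ad_inverse inv)+
  interpret commuting_isometries ip "Ad G A (inv g)" "Ad G A g" "Ad G A (inv h)" "Ad G A h"
    by (rule ci)
  let ?P = "product_atlas A A"
  define a where "a = left_fst (g, h)"
  define b where "b = left_snd (g, h)"
  have a: "log_deriv ?P fst (g, h) a" and b: "log_deriv ?P snd (g, h) b"
    unfolding a_def b_def by (rule log_deriv_fst, rule log_deriv_snd)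
  note M = charted_square
  have prd: "log_deriv ?P (\<lambda>z. fst z \<otimes> snd z) (g, h) (\<lambda>v. Ad G A (inv h) (a v) + b v)"
    using log_deriv_mult[OF M a b] by simp
  have prd_inv: "log_deriv ?P (\<lambda>z. inv (fst z) \<otimes> inv (snd z)) (g, h)
      (\<lambda>v. Ad G A h (- Ad G A g (a v)) + - Ad G A h (b v))"
    using log_deriv_mult[OF M log_deriv_inverse[OF M a] log_deriv_inverse[OF M b]] by simp
  have split: "(\<lambda>(x, y). f x y) = (\<lambda>z. f (fst z) (snd z))" for f :: "'g \<Rightarrow> 'g \<Rightarrow> 'g"
    by (simp add: case_prod_unfold)
  have pb1: "pullback ?P A fst (theta_L G A) (g, h) = a" "pullback ?P A fst (theta_R G A) (g, h) = (\<lambda>v. Ad G A g (a v))"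
    using log_deriv_theta_L[OF M a] log_deriv_theta_R[OF M a] by (auto simp: pullback_def)
  have pb2: "pullback ?P A snd (theta_L G A) (g, h) = b" "pullback ?P A snd (theta_R G A) (g, h) = (\<lambda>v. Ad G A h (b v))"
    using log_deriv_theta_L[OF M b] log_deriv_theta_R[OF M b] by (auto simp: pullback_def)
  have pb3: "pullback ?P A (\<lambda>z. fst z \<otimes> snd z) (theta_L G A) (g, h) = (\<lambda>v. Ad G A (inv h) (a v) + b v)"
    using log_deriv_theta_L[OF M prd] by (auto simp: pullback_def)
  have pb4: "pullback ?P A (\<lambda>z. inv (fst z) \<otimes> inv (snd z)) (theta_R G A) (g, h)
      = (\<lambda>v. - (a v + Ad G A (inv g) (b v)))"
  proof
    fix v
    have "pullback ?P A (\<lambda>z. inv (fst z) \<otimes> inv (snd z)) (theta_R G A) (g, h) v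
        = Ad G A (inv g \<otimes> inv h) (Ad G A h (- Ad G A g (a v)) + - Ad G A h (b v))"
      using log_deriv_theta_R[OF M prd_inv] by (simp add: pullback_def)
    also have "\<dots> = - (a v + Ad G A (inv g) (b v))"
      by (simp add: Ad_mult lin_simps Ad_inverse)
    finally show "pullback ?P A (\<lambda>z. inv (fst z) \<otimes> inv (snd z)) (theta_R G A) (g, h) v
        = - (a v + Ad G A (inv g) (b v))" .
  qed
  show "omega_double G A ip (g, h) v w = 1/2 *
      (F (left_fst (g, h) v) (left_snd (g, h) v) (left_fst (g, h) w) (left_snd (g, h) w)
       - F (left_fst (g, h) w) (left_snd (g, h) w) (left_fst (g, h) v) (left_snd (g, h) v))"
    unfolding omega_double_def Let_def form_pairing_def split pb1 pb2 pb3 pb4 F_def form_def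
      a_def[symmetric] b_def[symmetric] ip_right(3)
    by argo
qed

end

section \<open>Conjugacy classes are locally graphs\<close>

context lie_group
begin

lemma smooth_map_conj: "smooth_map A A (\<lambda>x. x \<otimes> h \<otimes> inv x)"
  by (intro smooth_group_intros)

lemma conj_translate: "p \<otimes> ((inv p \<otimes> y) \<otimes> h \<otimes> inv (inv p \<otimes> y)) \<otimes> inv p = y \<otimes> h \<otimes> inv y"
  by (simp add: m_assoc inv_mult_group)

lemma conjugacy_class_iff: "q \<in> conjugacy_class G h \<longleftrightarrow> (\<exists>x. q = x \<otimes> h \<otimes> inv x)"
  by (auto simp: conjugacy_class_def)

text \<open>Compactness enters here: it makes the orbit map open onto the conjugacy class.\<close>

lemma conjugacy_class_local_image:
  assumes "compact (UNIV :: 'g set)" "open W" "\<one> \<in> W"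
  obtains V where "open V" "h \<in> V" "\<And>q. q \<in> V \<Longrightarrow> q \<in> conjugacy_class G h \<Longrightarrow> \<exists>w\<in>W. q = w \<otimes> h \<otimes> inv w"
proof -
  \<comment> \<open>\<open>M\<close> is \<open>W\<close> saturated by the stabilizer of
    \<open>h\<close>, so whether \<open>x\<close> lies in \<open>M\<close> depends only on the
    conjugate of \<open>h\<close> by \<open>x\<close>. The complement of \<open>M\<close> is
    compact, and its image is a closed set missing \<open>h\<close>; every class point off this
    image is reached from \<open>W\<close>.\<close>
  define M where "M = (\<Union>k\<in>{k. k \<otimes> h \<otimes> inv k = h}. (\<lambda>x. x \<otimes> inv k) -` W)"
  have "continuous_on UNIV (\<lambda>x. x \<otimes> inv k)" for k
  proof -
    have "smooth_map A A (\<lambda>x. x \<otimes> inv k)"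
      by (intro smooth_group_intros)
    then show ?thesis
      by (simp add: smooth_map_def)
  qed
  then have "open M"
    unfolding M_def using assms(2) by (intro open_UN ballI open_vimage) auto
  then have "compact (- M)"
    using compact_Int_closed[OF assms(1), of "- M"] by (simp add: closed_Compl)
  moreover have "continuous_on (- M) (\<lambda>x. x \<otimes> h \<otimes> inv x)"
    using smooth_map_conj continuous_on_subset unfolding smooth_map_def by blast
  ultimately have "compact ((\<lambda>x. x \<otimes> h \<otimes> inv x) ` (- M))"
    by (intro compact_continuous_image)
  then have cl: "closed ((\<lambda>x. x \<otimes> h \<otimes> inv x) ` (- M))"
    by (rule compact_imp_closed)
  show ?thesis
  proof
    show "open (- ((\<lambda>x. x \<otimes> h \<otimes> inv x) ` (- M)))"
      using cl by (rule open_Compl)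
    have "x \<in> M" if "h = x \<otimes> h \<otimes> inv x" for x
      unfolding M_def using assms(3) that[symmetric] by (intro UN_I[of x]) simp_all
    then show "h \<in> - ((\<lambda>x. x \<otimes> h \<otimes> inv x) ` (- M))"
      by blast
    fix q assume q: "q \<in> - ((\<lambda>x. x \<otimes> h \<otimes> inv x) ` (- M))" "q \<in> conjugacy_class G h"
    then obtain x where x: "q = x \<otimes> h \<otimes> inv x"
      by (auto simp: conjugacy_class_iff)
    then have "x \<in> M"
      using q(1) by blast
    then obtain k where k: "k \<otimes> h \<otimes> inv k = h" "x \<otimes> inv k \<in> W"
      by (auto simp: M_def)
    have "(x \<otimes> inv k) \<otimes> (k \<otimes> h \<otimes> inv k) \<otimes> inv (x \<otimes> inv k) = q"
      by (simp add: x m_assoc inv_mult_group)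
    then show "\<exists>w\<in>W. q = w \<otimes> h \<otimes> inv w"
      using k by metis
  qed
qed

text \<open>In the chart at \<open>h\<close>, the conjugacy class of \<open>h\<close> is near \<open>h\<close> the graph of \<open>s\<close> over the range of
  the differential \<open>D\<close> of the orbit map.\<close>

definition orbit_graph ::
    "'g \<Rightarrow> ('e \<Rightarrow> 'e) \<Rightarrow> ('e \<Rightarrow> 'e) \<Rightarrow> 'e set \<Rightarrow> ('e \<Rightarrow> 'e) \<Rightarrow> 'g set \<Rightarrow> bool" where
  "orbit_graph h D P Y s V \<longleftrightarrow>
     has_tangent A A (\<lambda>x. x \<otimes> h \<otimes> inv x) \<one> D \<and>
     linear P \<and> range P = range D \<and> (\<forall>v. P (D v) = D v) \<and>
     open V \<and> h \<in> V \<and> V \<subseteq> dom_at A h \<and> open Y \<and> smooth_on Y s \<and>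
     (\<forall>q\<in>V. P (coord A h q) \<in> Y \<and> (q \<in> conjugacy_class G h \<longleftrightarrow> coord A h q = s (P (coord A h q)))) \<and>
     (\<forall>y\<in>Y \<inter> range P. P (s y) = y) \<and>
     (\<forall>v. frechet_derivative s (at (P (coord A h h))) (D v) = D v)"

lemma orbit_graph_exists:
  assumes compact: "compact (UNIV :: 'g set)"
  shows "\<exists>D P Y s V. orbit_graph h D P Y s V"
proof -
  define c where "c x = x \<otimes> h \<otimes> inv x" for x
  have c_one: "c \<one> = h"
    by (simp add: c_def)
  have sc: "smooth_map A A c"
    unfolding c_def by (rule smooth_map_conj)
  define f where "f = (\<lambda>x. coord A h (c (inv_coord A \<one> x)))"
  define X where "X = coord A \<one> ` (dom_at A \<one> \<inter> c -` dom_at A h)"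
  define x0 where "x0 = coord A \<one> \<one>"
  have oc: "open (c -` dom_at A h)"
    using sc open_dom_at[OF charted] open_vimage by (auto simp: smooth_map_def)
  have X: "open X"
    unfolding X_def using oc open_dom_at[OF charted]
    by (intro is_chart_open_image[OF is_chart_at[OF charted]]) auto
  have x0: "x0 \<in> X"
    unfolding X_def x0_def using chart_at_mem(2)[OF charted] c_one by auto
  have f: "smooth_on X f"
    unfolding X_def f_def by (rule smooth_map_coord[OF charted charted sc])
  obtain D where D: "has_tangent A A c \<one> D"
    using smooth_map_has_tangent[OF charted charted sc] by blast
  then have fD: "(f has_derivative D) (at x0)"
    by (simp add: has_tangent_def c_one f_def x0_def)
  \<comment> \<open>Equivariance: the orbit map is conjugation by \<open>p\<close> after the orbit
    map after left translation by \<open>inv p\<close>, so its differential at \<open>p\<close>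
    factors through \<open>D\<close>.\<close>
  have rank: "dim (range (frechet_derivative f (at x))) \<le> dim (range D)" if x: "x \<in> X" for x
  proof -
    obtain p where p: "p \<in> dom_at A \<one>" "c p \<in> dom_at A h" "x = coord A \<one> p"
      using x unfolding X_def by blast
    have px: "inv_coord A \<one> x = p"
      using inv_coord_coord[OF charted p(1)] p(3) by simp
    obtain F1 where F1: "has_tangent model_atlas A (inv_coord A \<one>) x F1"
      using has_tangent_inv_coord[OF atlas p(1)] p(3) by blast
    obtain E1 where E1: "has_tangent A A (\<lambda>y. inv p \<otimes> y) p E1"
      using smooth_map_has_tangent[OF charted charted smooth_map_mult[OF charted smooth_map_const[OF charted]
            smooth_map_id[OF atlas]]] by blast
    have "smooth_map A A (\<lambda>y. p \<otimes> y \<otimes> inv p)"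
      by (intro smooth_group_intros)
    then obtain E3 where E3: "has_tangent A A (\<lambda>y. p \<otimes> y \<otimes> inv p) h E3"
      using smooth_map_has_tangent[OF charted charted] by blast
    obtain F2 where F2: "has_tangent A model_atlas (coord A h) (c p) F2"
      using has_tangent_coord[OF atlas p(2)] by blast
    have 1: "has_tangent model_atlas A (\<lambda>x. inv p \<otimes> inv_coord A \<one> x) x (\<lambda>v. E1 (F1 v))"
      using E1 px by (intro has_tangent_compose[OF charted_model charted F1]) simp
    have 2: "has_tangent model_atlas A (\<lambda>x. c (inv p \<otimes> inv_coord A \<one> x)) x (\<lambda>v. D (E1 (F1 v)))"
      using D px by (intro has_tangent_compose[OF charted_model charted 1]) simp
    have 3: "has_tangent model_atlas A (\<lambda>x. p \<otimes> c (inv p \<otimes> inv_coord A \<one> x) \<otimes> inv p) x (\<lambda>v. E3 (D (E1 (F1 v))))"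
      using E3 px c_one by (intro has_tangent_compose[OF charted_model charted 2]) simp
    have shift: "p \<otimes> c (inv p \<otimes> y) \<otimes> inv p = c y" for y
      unfolding c_def by (rule conj_translate)
    have "has_tangent model_atlas model_atlas f x (\<lambda>v. F2 (E3 (D (E1 (F1 v)))))"
      unfolding f_def using F2 px
      by (intro has_tangent_compose[OF charted_model charted 3[unfolded shift]]) simp
    then have "(f has_derivative (\<lambda>v. F2 (E3 (D (E1 (F1 v)))))) (at x)"
      by (simp only: has_tangent_model)
    then have "frechet_derivative f (at x) = (\<lambda>v. F2 (E3 (D (E1 (F1 v)))))"
      using frechet_derivative_at by metis
    then have "range (frechet_derivative f (at x)) \<subseteq> (\<lambda>v. F2 (E3 v)) ` range D"
      by auto
    then have "dim (range (frechet_derivative f (at x))) \<le> dim ((\<lambda>v. F2 (E3 v)) ` range D)"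
      by (rule dim_subset)
    also have "\<dots> \<le> dim (range D)"
      using linear_compose[OF has_tangent_linear[OF E3] has_tangent_linear[OF F2]]
      by (intro dim_image_le) (simp add: comp_def)
    finally show ?thesis .
  qed
  obtain P W Y s where P: "linear P" "range P = range D" "\<And>v. P (D v) = D v"
    and W: "open W" "x0 \<in> W" "W \<subseteq> X" and Y: "open Y" "P (f x0) \<in> Y" "smooth_on Y s"
    and graph: "\<And>x. x \<in> W \<Longrightarrow> P (f x) \<in> Y \<and> f x = s (P (f x))"
      "\<And>y. y \<in> Y \<Longrightarrow> s y \<in> f ` X" "\<And>y. y \<in> Y \<Longrightarrow> y \<in> range P \<Longrightarrow> P (s y) = y"
    by (rule constant_rank_image[OF X x0 f fD rank], assumption) (rule that; assumption)
  have fx0: "f x0 = coord A h h"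
    using inv_coord_coord[OF charted chart_at_mem(2)[OF charted]] by (simp add: f_def x0_def c_one)
  have blP: "bounded_linear P"
    using P(1) by (simp add: linear_conv_bounded_linear)
  define W' where "W' = dom_at A \<one> \<inter> coord A \<one> -` W"
  have W': "open W'" "\<one> \<in> W'"
    unfolding W'_def using W(1,2) chart_at_mem(2)[OF charted] is_chartD(1,4)[OF is_chart_at[OF charted]]
    by (auto intro!: continuous_open_preimage simp: x0_def)
  obtain V1 where V1: "open V1" "h \<in> V1"
    and V1c: "\<And>q. q \<in> V1 \<Longrightarrow> q \<in> conjugacy_class G h \<Longrightarrow> \<exists>w\<in>W'. q = w \<otimes> h \<otimes> inv w"
    by (rule conjugacy_class_local_image[OF compact W', of h]) (rule that; assumption)
  define V where "V = V1 \<inter> (dom_at A h \<inter> coord A h -` (P -` Y))"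
  have "open (dom_at A h \<inter> coord A h -` (P -` Y))"
    using is_chartD(1,4)[OF is_chart_at[OF charted]] Y(1) linear_continuous_on[OF blP]
    by (intro continuous_open_preimage open_vimage) auto
  then have V: "open V" "V \<subseteq> dom_at A h"
    using V1 by (auto simp: V_def)
  have hV: "h \<in> V"
    using V1 chart_at_mem(2)[OF charted] Y(2) by (simp add: V_def fx0)
  \<comment> \<open>Forwards, \<open>V1\<close> ensures that the class point comes from the small
    neighbourhood where \<open>f = s \<circ> P \<circ> f\<close>. Backwards, every value of
    \<open>s\<close> on \<open>Y\<close> is a value of \<open>f\<close>, and the chart is
    injective.\<close>
  have iff: "q \<in> conjugacy_class G h \<longleftrightarrow> coord A h q = s (P (coord A h q))" if q: "q \<in> V" for q
  proof
    assume "q \<in> conjugacy_class G h"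
    then obtain w where w: "w \<in> W'" "q = c w"
      using V1c[of q] q unfolding V_def c_def by blast
    then have "f (coord A \<one> w) = coord A h q" "coord A \<one> w \<in> W"
      using inv_coord_coord[OF charted, of w "\<one>"] by (simp_all add: f_def W'_def)
    then show "coord A h q = s (P (coord A h q))"
      using graph(1)[of "coord A \<one> w"] by simp
  next
    assume eq: "coord A h q = s (P (coord A h q))"
    have "P (coord A h q) \<in> Y"
      using q by (simp add: V_def)
    then obtain x where x: "x \<in> X" "coord A h q = f x"
      using graph(2) eq by (metis imageE)
    then obtain p where p: "p \<in> dom_at A \<one>" "c p \<in> dom_at A h" "x = coord A \<one> p"
      unfolding X_def by blast
    then have "coord A h q = coord A h (c p)"
      using inv_coord_coord[OF charted p(1)] x(2) by (simp add: f_def)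
    then have "q = c p"
      using inj_onD[OF is_chartD(3)[OF is_chart_at[OF charted]] _ subsetD[OF V(2) q] p(2)] by blast
    then show "q \<in> conjugacy_class G h"
      unfolding conjugacy_class_iff c_def by blast
  qed
  \<comment> \<open>Differentiating \<open>f = s \<circ> P \<circ> f\<close> at \<open>x0\<close>
    shows that the derivative of \<open>s\<close> is the identity on the range of
    \<open>D\<close>.\<close>
  let ?s' = "frechet_derivative s (at (P (coord A h h)))"
  have "(s has_derivative ?s') (at (P (f x0)))"
    using smooth_onD[OF Y(3,2)] by (simp add: fx0)
  from has_derivative_compose[OF bounded_linear.has_derivative[OF blP fD] this]
  have "((\<lambda>x. s (P (f x))) has_derivative (\<lambda>v. ?s' (P (D v)))) (at x0)" .
  then have "(f has_derivative (\<lambda>v. ?s' (P (D v)))) (at x0)"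
    by (rule has_derivative_transform_within_open[OF _ W(1,2)]) (use graph(1) in metis)
  then have "(\<lambda>v. ?s' (P (D v))) = D"
    using fD by (rule has_derivative_unique)
  then have s': "?s' (D v) = D v" for v
    using P(3) by metis
  have "orbit_graph h D P Y s V"
    unfolding orbit_graph_def
  proof (intro conjI ballI allI)
    show "has_tangent A A (\<lambda>x. x \<otimes> h \<otimes> inv x) \<one> D"
      using D unfolding c_def .
    show "P (coord A h q) \<in> Y" if "q \<in> V" for q
      using that by (simp add: V_def)
    show "P (s y) = y" if "y \<in> Y \<inter> range P" for y
      using graph(3) that by blast
  qed (fact P V hV Y iff s')+
  then show ?thesis
    by blast
qed

text \<open>A curve in the class is reproduced by \<open>s \<circ> P\<close> in the chart, so its
  velocity \<open>w\<close> is the derivative of \<open>s\<close> applied to \<open>P w\<close>; as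
  \<open>P w\<close> lies in the range of \<open>D\<close>, where that derivative is the identity,
  \<open>w = P w\<close>. Working with the graph avoids lifting the curve to the group.\<close>

lemma orbit_graph_tangent:
  assumes og: "orbit_graph h D P Y s V" and \<gamma>: "has_tangent model_atlas A \<gamma> 0 (\<lambda>t. t *\<^sub>R w)" "\<gamma> 0 = h"
    and ev: "\<forall>\<^sub>F t in nhds 0. \<gamma> t \<in> conjugacy_class G h"
  obtains \<xi> where "w = D \<xi>"
proof -
  let ?s' = "frechet_derivative s (at (P (coord A h h)))"
  have P: "linear P" "range P = range D" and V: "open V" "h \<in> V" and s: "smooth_on Y s"
    and YV: "\<And>q. q \<in> V \<Longrightarrow> P (coord A h q) \<in> Y"
    and iff: "\<And>q. q \<in> V \<Longrightarrow> q \<in> conjugacy_class G h \<longleftrightarrow> coord A h q = s (P (coord A h q))"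
    and s': "\<And>v. ?s' (D v) = D v"
    using og unfolding orbit_graph_def by blast+
  have blP: "bounded_linear P"
    using P(1) by (simp add: linear_conv_bounded_linear)
  have d: "((\<lambda>t. coord A h (\<gamma> t)) has_derivative (\<lambda>t. t *\<^sub>R w)) (at 0)" and "isCont \<gamma> 0"
    using \<gamma> by (simp_all add: has_tangent_def)
  then have "(\<gamma> \<longlongrightarrow> h) (nhds 0)"
    using tendsto_at_iff_tendsto_nhds[of \<gamma> 0] by (simp add: isCont_def \<gamma>(2))
  then have "\<forall>\<^sub>F t in nhds 0. \<gamma> t \<in> V"
    using V by (rule topological_tendstoD)
  then have eq: "\<forall>\<^sub>F t in nhds 0. s (P (coord A h (\<gamma> t))) = coord A h (\<gamma> t)"
    using ev by eventually_elim (use iff in metis)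
  have "(s has_derivative ?s') (at (P (coord A h (\<gamma> 0))))"
    using smooth_onD[OF s YV[OF V(2)]] by (simp add: \<gamma>(2))
  from has_derivative_compose[OF bounded_linear.has_derivative[OF blP d] this]
  have "((\<lambda>t. s (P (coord A h (\<gamma> t)))) has_derivative (\<lambda>t. ?s' (P (t *\<^sub>R w)))) (at 0)" .
  then have "((\<lambda>t. coord A h (\<gamma> t)) has_derivative (\<lambda>t. ?s' (P (t *\<^sub>R w)))) (at 0)"
    by (rule has_derivative_transform_eventually)
      (use eq eventually_nhds_x_imp_x[OF eq] in \<open>auto simp: eventually_at_filter elim: eventually_mono\<close>)
  from has_derivative_unique[OF this d] have "?s' (P (1 *\<^sub>R w)) = 1 *\<^sub>R w"
    by metis
  moreover obtain \<xi> where "P w = D \<xi>"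
    using P(2) by blast
  ultimately have "w = D \<xi>"
    using s' by simp
  then show ?thesis
    by (rule that)
qed

section \<open>The universal centralizer\<close>

lemma universal_centralizer_iff:
  "(g, h) \<in> universal_centralizer G C \<longleftrightarrow> h \<in> C \<and> g \<otimes> h = h \<otimes> g"
proof -
  have "g \<otimes> h \<otimes> inv g = h \<longleftrightarrow> g \<otimes> h = h \<otimes> g"
    by (metis in_carrier inv_solve_right m_closed)
  then show ?thesis
    by (simp add: universal_centralizer_def)
qed

lemma conjugacy_class_eq:
  assumes "h \<in> conjugacy_class G k"
  shows "conjugacy_class G k = conjugacy_class G h"
proof -
  obtain x where x: "h = x \<otimes> k \<otimes> inv x"
    using assms by (auto simp: conjugacy_class_iff)
  have "y \<otimes> k \<otimes> inv y = (y \<otimes> inv x) \<otimes> h \<otimes> inv (y \<otimes> inv x)"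
    and "y \<otimes> h \<otimes> inv y = (y \<otimes> x) \<otimes> k \<otimes> inv (y \<otimes> x)" for y
    by (simp_all add: x m_assoc inv_mult_group)
  then show ?thesis
    unfolding set_eq_iff conjugacy_class_iff by metis
qed

lemma universal_centralizer_nondegenerate:
  assumes inner: "is_inner_product ip" "\<And>g X Y. ip (Ad G A g X) (Ad G A g Y) = ip X Y"
  shows "universal_centralizer G C \<subseteq> nondegenerate_locus (omega_double G A ip)"
proof
  fix p assume "p \<in> universal_centralizer G C"
  then obtain g h where p: "p = (g, h)" and comm: "g \<otimes> h = h \<otimes> g"
    using universal_centralizer_iff by (metis prod.exhaust)
  note ci = omega_double_left(1)[OF inner comm]
  interpret commuting_isometries ip "Ad G A (inv g)" "Ad G A g" "Ad G A (inv h)" "Ad G A h"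
    by (rule ci)
  have "v = 0" if v: "\<And>w. omega_double G A ip (g, h) v w = 0" for v
  proof -
    have "form (left_fst (g, h) v) (left_snd (g, h) v) a b - form a b (left_fst (g, h) v) (left_snd (g, h) v) = 0" for a b
    proof -
      obtain w where "left_fst (g, h) w = a" "left_snd (g, h) w = b"
        using left_trivialization_surj by blast
      then show ?thesis
        using v[of w] omega_double_left(2)[OF inner comm, of v w] by simp
    qed
    from form_nondegenerate[OF this] show ?thesis
      by (rule left_trivialization_inj)
  qed
  then show "p \<in> nondegenerate_locus (omega_double G A ip)"
    unfolding nondegenerate_locus_def p by blast
qed

text \<open>Tangency of the second component to the class yields \<xi> with
  \<open>b = (T - 1) \<xi>\<close>. The differentiated relation \<open>g h = h g\<close> reads
  \<open>(T - 1) a = (S - 1) b\<close>, and since \<open>S\<close> and \<open>T\<close> commute,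
  \<kappa> = a - (S - 1) \<xi> is fixed by \<open>T\<close>.\<close>

lemma universal_centralizer_tangent:
  assumes compact: "compact (UNIV :: 'g set)" and gh: "(g, h) \<in> universal_centralizer G (conjugacy_class G h)"
    and v: "v \<in> tangent_space (product_atlas A A) (universal_centralizer G (conjugacy_class G h)) (g, h)"
  obtains \<xi> \<kappa> where "Ad G A (inv h) \<kappa> = \<kappa>"
    "left_fst (g, h) v = Ad G A (inv g) \<xi> - \<xi> + \<kappa>" "left_snd (g, h) v = Ad G A (inv h) \<xi> - \<xi>"
proof -
  let ?P = "product_atlas A A" and ?\<Lambda> = "universal_centralizer G (conjugacy_class G h)"
  let ?a = "left_fst (g, h) v" and ?b = "left_snd (g, h) v"
  have comm: "g \<otimes> h = h \<otimes> g"
    using gh universal_centralizer_iff by blast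
  obtain \<gamma> where "tangent_curve ?P ?\<Lambda> (g, h) \<gamma> v"
    using v unfolding tangent_space_def by blast
  then have \<gamma>: "has_tangent model_atlas ?P \<gamma> 0 (\<lambda>t. t *\<^sub>R v)" "\<forall>\<^sub>F t in nhds 0. \<gamma> t \<in> ?\<Lambda>" "\<gamma> 0 = (g, h)"
    using tangent_curve_has_tangent[OF charted_square, of ?\<Lambda> "(g, h)" \<gamma> v] by (auto simp: tangent_curve_def)
  have lin: "linear (Ad G A x)" for x
    by (rule linear_Ad)
  text \<open>Differentiating \<open>g h = h g\<close>.\<close>
  have rel: "Ad G A (inv h) ?a + ?b = Ad G A (inv g) ?b + ?a"
  proof -
    have 1: "log_deriv ?P (\<lambda>z. fst z \<otimes> snd z) (g, h) (\<lambda>v. Ad G A (inv h) (left_fst (g, h) v) + left_snd (g, h) v)"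
      using log_deriv_mult[OF charted_square log_deriv_fst[of "(g, h)"] log_deriv_snd[of "(g, h)"]] by simp
    have 2: "log_deriv ?P (\<lambda>z. snd z \<otimes> fst z) (g, h) (\<lambda>v. Ad G A (inv g) (left_snd (g, h) v) + left_fst (g, h) v)"
      using log_deriv_mult[OF charted_square log_deriv_snd[of "(g, h)"] log_deriv_fst[of "(g, h)"]] by simp
    have t1: "has_tangent model_atlas A (\<lambda>t. inv (g \<otimes> h) \<otimes> (fst (\<gamma> t) \<otimes> snd (\<gamma> t))) 0
        (\<lambda>t. Ad G A (inv h) (left_fst (g, h) (t *\<^sub>R v)) + left_snd (g, h) (t *\<^sub>R v))"
      using 1 \<gamma>(3) by (intro has_tangent_compose[OF charted_model charted_square \<gamma>(1)]) (simp add: log_deriv_def)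
    have t2: "has_tangent model_atlas A (\<lambda>t. inv (g \<otimes> h) \<otimes> (snd (\<gamma> t) \<otimes> fst (\<gamma> t))) 0
        (\<lambda>t. Ad G A (inv g) (left_snd (g, h) (t *\<^sub>R v)) + left_fst (g, h) (t *\<^sub>R v))"
      using 2 \<gamma>(3) comm by (intro has_tangent_compose[OF charted_model charted_square \<gamma>(1)]) (simp add: log_deriv_def)
    have "\<forall>\<^sub>F t in nhds 0. inv (g \<otimes> h) \<otimes> (fst (\<gamma> t) \<otimes> snd (\<gamma> t)) = inv (g \<otimes> h) \<otimes> (snd (\<gamma> t) \<otimes> fst (\<gamma> t))"
      using \<gamma>(2)
    proof eventually_elim
      case (elim t)
      then show ?case
        using universal_centralizer_iff[of "fst (\<gamma> t)" "snd (\<gamma> t)"] by simp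
    qed
    from has_tangent_unique[OF has_tangent_cong[OF charted_model t1 this] t2]
    have "Ad G A (inv h) (left_fst (g, h) (1 *\<^sub>R v)) + left_snd (g, h) (1 *\<^sub>R v)
        = Ad G A (inv g) (left_snd (g, h) (1 *\<^sub>R v)) + left_fst (g, h) (1 *\<^sub>R v)"
      by metis
    then show ?thesis by simp
  qed
  obtain D P Y s V where og: "orbit_graph h D P Y s V"
    using orbit_graph_exists[OF compact] by blast
  let ?w = "tangent_map ?P A snd (g, h) v"
  have snd: "has_tangent ?P A snd (g, h) (tangent_map ?P A snd (g, h))"
    by (intro smooth_map_has_tangent smooth_group_intros)
  have "has_tangent model_atlas A (\<lambda>t. snd (\<gamma> t)) 0 (\<lambda>t. tangent_map ?P A snd (g, h) (t *\<^sub>R v))"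
    using snd \<gamma>(3) by (intro has_tangent_compose[OF charted_model charted_square \<gamma>(1)]) simp
  then have "has_tangent model_atlas A (\<lambda>t. snd (\<gamma> t)) 0 (\<lambda>t. t *\<^sub>R ?w)"
    using linear_scale[OF has_tangent_linear[OF snd]] by simp
  moreover have "\<forall>\<^sub>F t in nhds 0. snd (\<gamma> t) \<in> conjugacy_class G h"
    using \<gamma>(2)
  proof eventually_elim
    case (elim t)
    then show ?case
      using universal_centralizer_iff[of "fst (\<gamma> t)" "snd (\<gamma> t)"] by simp
  qed
  ultimately obtain \<xi> where \<xi>: "?w = D \<xi>"
    using orbit_graph_tangent[OF og] \<gamma>(3) by (metis snd_conv)
  \<comment> \<open>The logarithmic derivative of the orbit map at \<open>\<one>\<close> is
    \<open>Ad G A (inv h) - 1\<close>; \<open>left_snd\<close> is \<open>theta_L\<close> applied to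
    the second velocity, which is \<open>D \<xi>\<close>.\<close>
  have b: "?b = Ad G A (inv h) \<xi> - \<xi>"
  proof -
    let ?c = "\<lambda>x. x \<otimes> h \<otimes> inv x"
    have id: "log_deriv A (\<lambda>x. x) \<one> (\<lambda>v. v)"
      using has_tangent_id[OF charted] smooth_map_id[OF atlas] by (simp add: log_deriv_def)
    have "log_deriv A ?c \<one> (\<lambda>v. Ad G A (inv (inv \<one>)) (Ad G A (inv h) v + 0) + - Ad G A \<one> v)"
      by (intro log_deriv_mult log_deriv_inverse log_deriv_const charted id)
    then have "theta_L G A (?c \<one>) (tangent_map A A ?c \<one> \<xi>) = Ad G A (inv h) \<xi> - \<xi>"
      using log_deriv_theta_L[OF charted] by (fastforce simp: Ad_one)
    moreover have "tangent_map A A ?c \<one> = D"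
      using og tangent_map_eq unfolding orbit_graph_def by blast
    ultimately show ?thesis
      using \<xi> by (simp add: left_snd_def)
  qed
  interpret I: linear "Ad G A (inv h)" by (rule lin)
  interpret J: linear "Ad G A (inv g)" by (rule lin)
  have "inv h \<otimes> inv g = inv g \<otimes> inv h"
    using comm by (simp flip: inv_mult_group)
  then have TS: "Ad G A (inv h) (Ad G A (inv g) x) = Ad G A (inv g) (Ad G A (inv h) x)" for x
    unfolding Ad_mult[symmetric] by simp
  show ?thesis
  proof
    show "Ad G A (inv h) (?a - Ad G A (inv g) \<xi> + \<xi>) = ?a - Ad G A (inv g) \<xi> + \<xi>"
    proof -
      have "Ad G A (inv h) ?a = Ad G A (inv g) ?b + ?a - ?b"
        using rel by (simp add: algebra_simps)
      then show ?thesis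
        unfolding I.add I.diff TS b by (simp add: J.diff)
    qed
  qed (simp_all add: b)
qed

lemma universal_centralizer_isotropic:
  assumes compact: "compact (UNIV :: 'g set)"
    and inner: "is_inner_product ip" "\<And>g X Y. ip (Ad G A g X) (Ad G A g Y) = ip X Y"
    and C: "C = conjugacy_class G k"
  shows "isotropic (product_atlas A A) (omega_double G A ip) (universal_centralizer G C)"
  unfolding isotropic_def
proof (intro ballI)
  fix p v w
  assume p: "p \<in> universal_centralizer G C"
    and v: "v \<in> tangent_space (product_atlas A A) (universal_centralizer G C) p"
    and w: "w \<in> tangent_space (product_atlas A A) (universal_centralizer G C) p"
  obtain g h where gh: "p = (g, h)" by force
  have comm: "g \<otimes> h = h \<otimes> g" and "h \<in> C"
    using p universal_centralizer_iff gh by auto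
  then have Ch: "C = conjugacy_class G h"
    using conjugacy_class_eq C by blast
  obtain \<xi> \<kappa> where 1: "Ad G A (inv h) \<kappa> = \<kappa>"
    "left_fst (g, h) v = Ad G A (inv g) \<xi> - \<xi> + \<kappa>" "left_snd (g, h) v = Ad G A (inv h) \<xi> - \<xi>"
    using universal_centralizer_tangent[OF compact] p v unfolding gh Ch by blast
  obtain \<xi>' \<kappa>' where 2: "Ad G A (inv h) \<kappa>' = \<kappa>'"
    "left_fst (g, h) w = Ad G A (inv g) \<xi>' - \<xi>' + \<kappa>'" "left_snd (g, h) w = Ad G A (inv h) \<xi>' - \<xi>'"
    using universal_centralizer_tangent[OF compact] p w unfolding gh Ch by blast
  show "omega_double G A ip p v w = 0"
    unfolding gh omega_double_left(2)[OF inner comm]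
      commuting_isometries.form_isotropic[OF omega_double_left(1)[OF inner comm] 1 2] by simp
qed

text \<open>Near \<open>(g, h)\<close> the set is cut out by a submersion \<open>\<Phi>\<close> with
  values in the model space of the group, so the codimension is that of one factor.\<close>

lemma universal_centralizer_slice:
  assumes compact: "compact (UNIV :: 'g set)" and gh: "(g, h) \<in> universal_centralizer G (conjugacy_class G h)"
  shows "\<exists>(U, \<phi>)\<in>maximal_atlas (product_atlas A A). (g, h) \<in> U \<and>
    (\<exists>L. subspace L \<and> dim L + DIM('e) = DIM('e \<times> 'e) \<and>
      \<phi> ` (U \<inter> universal_centralizer G (conjugacy_class G h)) = \<phi> ` U \<inter> L)"
proof -
  let ?P = "product_atlas A A"
  have comm: "g \<otimes> h = h \<otimes> g"
    using gh universal_centralizer_iff by blast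
  have ghg: "g \<otimes> h \<otimes> inv g = h" "inv g \<otimes> h \<otimes> g = h"
    by (simp_all add: comm m_assoc) (simp flip: comm)
  obtain D P Y s V where og: "orbit_graph h D P Y s V"
    using orbit_graph_exists[OF compact] by blast
  have D: "has_tangent A A (\<lambda>x. x \<otimes> h \<otimes> inv x) \<one> D"
    and P: "linear P" "range P = range D" "\<And>v. P (D v) = D v"
    and V: "open V" "h \<in> V" "V \<subseteq> dom_at A h" and Y: "open Y" and s: "smooth_on Y s"
    and YV: "\<And>q. q \<in> V \<Longrightarrow> P (coord A h q) \<in> Y"
    and iff: "\<And>q. q \<in> V \<Longrightarrow> q \<in> conjugacy_class G h \<longleftrightarrow> coord A h q = s (P (coord A h q))"
    and Ps: "\<And>y. y \<in> Y \<inter> range P \<Longrightarrow> P (s y) = y"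
    using og unfolding orbit_graph_def by blast+
  have PP: "P (P v) = P v" for v
    using P(2,3) by (metis rangeE rangeI)
  have blP: "bounded_linear P"
    using P(1) by (simp add: linear_conv_bounded_linear)
  define W where "W = dom_at A g \<times> dom_at A h"
  define \<eta> where "\<eta> = map_prod (coord A g) (coord A h)"
  have chA: "(dom_at A x, coord A x) \<in> A" for x
    using chart_at_mem(1)[OF charted] by (simp flip: chart_at_pair)
  then have W: "(W, \<eta>) \<in> ?P"
    unfolding W_def \<eta>_def product_atlas_def by blast
  then have chW: "is_chart (W, \<eta>)"
    using charted_square unfolding charted_def by blast
  have inv\<eta>: "inv_into W \<eta> (\<eta> q) = q" if "q \<in> W" for q
    using is_chartD(3)[OF chW] that by simp
  define k where "k = (\<lambda>z. fst z \<otimes> snd z \<otimes> inv (fst z))"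
  have sk: "smooth_map ?P A k"
    unfolding k_def by (intro smooth_group_intros)
  define N where "N = (dom_at A g \<times> V) \<inter> k -` V"
  have "continuous_on UNIV k"
    using sk by (simp add: smooth_map_def)
  then have oN: "open N"
    unfolding N_def by (intro open_Int open_Times open_vimage open_dom_at charted V(1))
  have ghN: "(g, h) \<in> N"
    using V(2) chart_at_mem(2)[OF charted] by (simp add: N_def k_def ghg(1))
  have NW: "N \<subseteq> W"
    using V(3) by (auto simp: N_def W_def)
  have o\<eta>N: "open (\<eta> ` N)"
    using is_chart_open_image[OF chW oN NW] .
  define F where "F = (\<lambda>x. coord A h (k (inv_into W \<eta> x)))"
  from smooth_map_chart[OF sk W chA[of h]] have F: "smooth_on (\<eta> ` N) F"
    unfolding F_def by (rule smooth_on_subset) (use NW V(3) in \<open>auto simp: N_def\<close>)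
  \<comment> \<open>With b and c the coordinates of y and x y x^-1 this is (b - s (P b)) + (P c - P
    b). The first bracket tests membership of y in the class and is killed by \<open>P\<close>; the
    second compares the two points along the class and lies in the range of \<open>P\<close>. Hence
    the sum vanishes only if both brackets do.\<close>
  define \<Phi> where "\<Phi> = (\<lambda>x. snd x - s (P (snd x)) + P (F x) - P (snd x))"
  have Psnd: "smooth_on (\<eta> ` N) (\<lambda>x. P (snd x))"
    by (intro smooth_on_bounded_linear[OF _ blP] smooth_on_bounded_linear[OF _ bounded_linear_snd]
        smooth_on_id o\<eta>N)
  have \<Phi>: "smooth_on (\<eta> ` N) \<Phi>"
    unfolding \<Phi>_def
  proof (intro smooth_on_diff smooth_on_add o\<eta>N Psnd smooth_on_bounded_linear[OF _ blP] F
      smooth_on_bounded_linear[OF _ bounded_linear_snd] smooth_on_id)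
    show "smooth_on (\<eta> ` N) (\<lambda>x. s (P (snd x)))"
      by (rule smooth_on_compose[OF s Psnd o\<eta>N Y]) (use YV in \<open>auto simp: N_def \<eta>_def\<close>)
  qed
  let ?x0 = "\<eta> (g, h)"
  define s' where "s' = frechet_derivative s (at (P (coord A h h)))"
  define F' where "F' = frechet_derivative F (at ?x0)"
  have ds: "(s has_derivative s') (at (P (snd ?x0)))"
    using smooth_onD[OF s YV[OF V(2)]] by (simp add: s'_def \<eta>_def)
  have dF: "(F has_derivative F') (at ?x0)"
    using smooth_onD[OF F imageI[OF ghN]] by (simp add: F'_def)
  define D\<Phi> where "D\<Phi> = (\<lambda>u. snd u - s' (P (snd u)) + P (F' u) - P (snd u))"
  have dsnd: "(snd has_derivative snd) (at ?x0)"
    by (rule bounded_linear_imp_has_derivative[OF bounded_linear_snd])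
  note dPsnd = bounded_linear.has_derivative[OF blP dsnd]
  have d\<Phi>: "(\<Phi> has_derivative D\<Phi>) (at ?x0)"
    unfolding \<Phi>_def D\<Phi>_def
    by (intro has_derivative_diff has_derivative_add dsnd dPsnd
        bounded_linear.has_derivative[OF blP dF] has_derivative_compose[OF dPsnd ds])
  \<comment> \<open>Because \<open>g\<close> commutes with \<open>h\<close>, the orbit map is
    unchanged when its argument is multiplied on the right by \<open>inv g\<close>. This moves the
    base point from \<open>g\<close> to \<open>\<one>\<close>, and the differential at
    \<open>g\<close> is \<open>D\<close> after the right translation \<open>R\<close>, with right
    inverse \<open>Q\<close>.\<close>
  have "smooth_map A A (\<lambda>x. x \<otimes> inv g)" "smooth_map A A (\<lambda>x. x \<otimes> g)"
    by (intro smooth_group_intros)+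
  then obtain R Q where R: "has_tangent A A (\<lambda>x. x \<otimes> inv g) g R" and Q: "has_tangent A A (\<lambda>x. x \<otimes> g) \<one> Q"
    using smooth_map_has_tangent[OF charted charted] by blast
  have "has_tangent A A (\<lambda>x. x \<otimes> g \<otimes> inv g) \<one> (\<lambda>v. R (Q v))"
    using R by (intro has_tangent_compose[OF charted charted Q]) simp
  then have "(\<lambda>v. R (Q v)) = (\<lambda>v. v)"
    by (intro has_tangent_unique[OF _ has_tangent_id[OF charted, of "\<one>"]]) (simp add: m_assoc)
  then have RQ: "R (Q v) = v" for v
    by metis
  have "has_tangent A A (\<lambda>x. (x \<otimes> inv g) \<otimes> h \<otimes> inv (x \<otimes> inv g)) g (\<lambda>v. D (R v))"
    using D by (intro has_tangent_compose[OF charted charted R]) simp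
  moreover have "(x \<otimes> inv g) \<otimes> h \<otimes> inv (x \<otimes> inv g) = x \<otimes> h \<otimes> inv x" for x
  proof -
    have "(x \<otimes> inv g) \<otimes> h \<otimes> inv (x \<otimes> inv g) = x \<otimes> (inv g \<otimes> h \<otimes> g) \<otimes> inv x"
      by (simp add: m_assoc inv_mult_group)
    then show ?thesis
      by (simp add: ghg(2))
  qed
  ultimately have "has_tangent A A (\<lambda>x. x \<otimes> h \<otimes> inv x) g (\<lambda>v. D (R v))"
    by simp
  then have dc: "((\<lambda>x. coord A h (inv_coord A g x \<otimes> h \<otimes> inv (inv_coord A g x))) has_derivative (\<lambda>v. D (R v)))
      (at (coord A g g))"
    by (simp add: has_tangent_def ghg(1))
  have F'D: "F' (v, 0) = D (R v)" for v
  proof -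
    have "((\<lambda>x. (x, coord A h h)) has_derivative (\<lambda>v. (v, 0))) (at (coord A g g))"
      by (intro has_derivative_Pair has_derivative_ident has_derivative_const)
    moreover have "(F has_derivative F') (at (coord A g g, coord A h h))"
      using dF by (simp add: \<eta>_def)
    ultimately have "((\<lambda>x. F (x, coord A h h)) has_derivative (\<lambda>v. F' (v, 0))) (at (coord A g g))"
      by (rule has_derivative_compose)
    then have "((\<lambda>x. coord A h (inv_coord A g x \<otimes> h \<otimes> inv (inv_coord A g x))) has_derivative (\<lambda>v. F' (v, 0)))
        (at (coord A g g))"
    proof (rule has_derivative_transform_within_open[OF _ open_coord_image[OF charted] coord_at_mem[OF charted]])
      fix x assume "x \<in> coord A g ` dom_at A g"
      then obtain y where y: "y \<in> dom_at A g" "x = coord A g y" by blast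
      have "(x, coord A h h) = \<eta> (y, h)" "(y, h) \<in> W"
        using y chart_at_mem(2)[OF charted] by (simp_all add: \<eta>_def W_def)
      then show "F (x, coord A h h) = coord A h (inv_coord A g x \<otimes> h \<otimes> inv (inv_coord A g x))"
        using inv\<eta> inv_coord_coord[OF charted y(1)] by (simp add: F_def k_def y(2))
    qed
    from has_derivative_unique[OF this dc] show ?thesis
      by metis
  qed
  \<comment> \<open>Taking the second component \<open>w = u - P u\<close> in the kernel of
    \<open>P\<close> reduces \<open>D\<Phi>\<close> to \<open>w + P (F' (v, w))\<close>. The first
    component \<open>v = Q \<xi>\<close> is then tuned so that the last term is \<open>P u\<close>,
    which is possible because \<open>F' (v, 0)\<close> runs over the range of \<open>D\<close>.
    \<open>SOME\<close> makes the preimage an explicit function of \<open>u\<close>, as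
    \<open>surjI\<close> asks.\<close>
  have surj: "surj D\<Phi>"
  proof (rule surjI)
    fix u
    define w where "w = u - P u"
    define \<xi> where "\<xi> = (SOME \<xi>. D \<xi> = P (u - F' (0, w)))"
    have "\<exists>\<xi>. D \<xi> = P (u - F' (0, w))"
      using P(2) by (metis rangeE rangeI)
    then have \<xi>: "D \<xi> = P (u - F' (0, w))"
      unfolding \<xi>_def by (rule someI_ex)
    have Pw: "P w = 0"
      using P(1) by (simp add: w_def linear_diff PP)
    have "F' (Q \<xi>, w) = F' (Q \<xi>, 0) + F' (0, w)"
      using linear_add[OF has_derivative_linear[OF dF], of "(Q \<xi>, 0)" "(0, w)"] by simp
    also have "\<dots> = P u - P (F' (0, w)) + F' (0, w)"
      using P(1) by (simp add: F'D RQ \<xi> linear_diff)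
    finally have "P (F' (Q \<xi>, w)) = P u"
      using P(1) by (simp add: linear_add linear_diff PP)
    then show "D\<Phi> (Q (SOME \<xi>. D \<xi> = P (u - F' (0, u - P u))), u - P u) = u"
      using Pw linear_0[OF has_derivative_linear[OF ds]]
      by (simp add: D\<Phi>_def flip: w_def \<xi>_def) (simp add: w_def)
  qed
  have mem: "q \<in> universal_centralizer G (conjugacy_class G h) \<longleftrightarrow> \<Phi> (\<eta> q) = 0" if q: "q \<in> N" for q
  proof -
    obtain x y where xy: "q = (x, y)" by force
    have y: "y \<in> V" and kq: "k q \<in> V"
      using q by (auto simp: N_def xy)
    define b where "b = coord A h y"
    define c where "c = coord A h (k q)"
    have "F (\<eta> q) = c"
      using inv\<eta>[OF subsetD[OF NW q]] by (simp add: F_def c_def)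
    then have \<Phi>q: "\<Phi> (\<eta> q) = b - s (P b) + P c - P b"
      by (simp add: \<Phi>_def \<eta>_def xy b_def)
    have k: "k q = x \<otimes> y \<otimes> inv x"
      by (simp add: k_def xy)
    show ?thesis
    proof
      assume "q \<in> universal_centralizer G (conjugacy_class G h)"
      then have "y \<in> conjugacy_class G h" "k q = y"
        unfolding k by (auto simp: universal_centralizer_def xy)
      then show "\<Phi> (\<eta> q) = 0"
        using iff[OF y] by (simp add: \<Phi>q b_def c_def)
    next
      assume zero: "\<Phi> (\<eta> q) = 0"
      \<comment> \<open>Applying \<open>P\<close> isolates the second bracket, and what remains is
        the first. Once y is in the class so is its conjugate, and two class points in
        \<open>V\<close> with the same \<open>P\<close>-coordinate coincide.\<close>
      have "P (s (P b)) = P b"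
        using YV[OF y] by (intro Ps) (simp add: b_def)
      then have "P (\<Phi> (\<eta> q)) = P c - P b"
        using P(1) by (simp add: \<Phi>q linear_add linear_diff PP)
      then have cb: "P c = P b"
        using zero linear_0[OF P(1)] by simp
      then have b: "b = s (P b)"
        using zero by (simp add: \<Phi>q)
      then have yC: "y \<in> conjugacy_class G h"
        using iff[OF y] by (simp add: b_def)
      then obtain z where "y = z \<otimes> h \<otimes> inv z"
        by (auto simp: conjugacy_class_iff)
      then have "k q = (x \<otimes> z) \<otimes> h \<otimes> inv (x \<otimes> z)"
        by (simp add: k m_assoc inv_mult_group)
      then have "k q \<in> conjugacy_class G h"
        unfolding conjugacy_class_iff by blast
      then have "c = s (P c)"
        using iff[OF kq] by (simp add: c_def)
      then have "coord A h (k q) = coord A h y"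
        using b cb by (simp add: b_def c_def)
      then have "k q = y"
        using inj_onD[OF is_chartD(3)[OF is_chart_at[OF charted]] _ subsetD[OF V(3) kq] subsetD[OF V(3) y]] by blast
      then show "q \<in> universal_centralizer G (conjugacy_class G h)"
        using yC unfolding k by (simp add: universal_centralizer_def xy)
    qed
  qed
  show ?thesis
    by (rule level_set_slice_chart[OF smooth_atlas_product[OF atlas atlas] W oN ghN NW \<Phi> d\<Phi> surj mem])
qed

lemma universal_centralizer_embedded:
  assumes compact: "compact (UNIV :: 'g set)" and C: "C = conjugacy_class G k"
  shows "embedded_submanifold (product_atlas A A) DIM('e) (universal_centralizer G C)"
  unfolding embedded_submanifold_def
proof
  fix p assume p: "p \<in> universal_centralizer G C"
  obtain g h where gh: "p = (g, h)" by force
  have "h \<in> C"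
    using p universal_centralizer_iff gh by blast
  then have Ch: "C = conjugacy_class G h"
    using conjugacy_class_eq C by blast
  have "dim L + DIM('e) = DIM('e \<times> 'e) \<longleftrightarrow> dim L = DIM('e)" for L :: "('e \<times> 'e) set"
    by simp
  then show "\<exists>(U, \<phi>)\<in>maximal_atlas (product_atlas A A). p \<in> U \<and>
      (\<exists>L. subspace L \<and> dim L = DIM('e) \<and> \<phi> ` (U \<inter> universal_centralizer G C) = \<phi> ` U \<inter> L)"
    using universal_centralizer_slice[OF compact, of g h] p unfolding gh Ch by simp
qed

end

theorem theorem1p2p2:
  fixes G :: "'g::{second_countable_topology, t2_space} monoid"
    and A :: "('g, 'e::euclidean_space) chart set"
    and ip :: "'e \<Rightarrow> 'e \<Rightarrow> real"
    and n :: nat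
    and C :: "'g set"
  assumes "lie_group G A"
    and "DIM('e) = n"
    and "compact (carrier G)"
    and "connected (carrier G)"
    and "simply_connected (carrier G)"
    and "simple_lie_algebra (lie_bracket G A)"
    and "basic_inner_product G A ip"
    and "regular_conjugacy_class G A C"
  shows "universal_centralizer G C \<subseteq> nondegenerate_locus (omega_double G A ip)
    \<and> embedded_submanifold (product_atlas A A) n (universal_centralizer G C)
    \<and> isotropic (product_atlas A A) (omega_double G A ip) (universal_centralizer G C)"
proof -
  interpret lie_group G A by (rule assms(1))
  have compact: "compact (UNIV :: 'g set)"
    using assms(3) by (simp add: carrier_eq_UNIV)
  have ip: "is_inner_product ip" "ip (Ad G A g X) (Ad G A g Y) = ip X Y" for g X Y
    using assms(7) by (auto simp: basic_inner_product_def)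
  obtain k where C: "C = conjugacy_class G k"
    using assms(8) unfolding regular_conjugacy_class_def by blast
  show ?thesis
    using universal_centralizer_nondegenerate[OF ip] universal_centralizer_embedded[OF compact C]
      universal_centralizer_isotropic[OF compact ip C] assms(2) by blast
qed

end
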